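(* For every $s\in\mathbb N\cup\{0\}$ and $k\in\mathbb N$ there is a constant $c_{s,k}=c(s,k)>0$ such that the following holds. Let $\epsilon>0$. Let $u$ be the solution of the Cauchy problem $u_t+u_{xxx}+uu_x=0$, $x\in\mathbb R$, $t>0$, with initial data $u_0(x)$, and let $U$ be the solution of the Cauchy problem $U_t+U_{xxx}+U^kU_x=0$, $x\in\mathbb R$, $t>0$, with initial data $U_0(x)$. For $s\in\mathbb N\cup\{0\}$ set $$\widetilde T_s=c_{s,k}\min\big\{\|U_0\|_{H^{s+1}(\mathbb R)}^{-k},\ \|u_0\|_{H^{s+1}(\mathbb R)}^{-1}\big\}.$$ (i) ($L^2$ distance) If $u_0,U_0\in H^2(\mathbb R)$ satisfy $$\|u_0\|_{H^2(\mathbb R)}\le c_0\epsilon,\quad \|U_0\|_{H^2(\mathbb R)}\le C_0\epsilon,\quad \|u_0-U_0\|_{L^2(\mathbb R)}\le C\max\{\epsilon^2,\epsilon^{k+1}\}$$ for some constants $c_0,C_0,C$, then for each fixed finite $T\in(0,\widetilde T_1]$ there exists a constant $\widetilde C=\widetilde C(k,T)$ such that $$\sup_{t\in[0,T]}\|u(t)-U(t)\|_{L^2_x(\mathbb R)}\le\widetilde C\max\{\epsilon^2,\epsilon^{k+1}\}.$$ (ii) ($H^s$ and $L^\infty$ distance for any $s\in\mathbb N$) Let $s\in\mathbb N$. If $u_0,U_0\in H^{s+1}(\mathbb R)$ satisfy $$\|u_0\|_{H^{s+1}(\mathbb R)}\le c_{0,s}\epsilon,\quad \|U_0\|_{H^{s+1}(\mathbb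 R)}\le C_{0,s}\epsilon,\quad \|u_0-U_0\|_{H^s(\mathbb R)}\le C_s\max\{\epsilon^2,\epsilon^{k+1}\}$$ for some constants $c_{0,s},C_{0,s},C_s$, then for each fixed finite $T\in(0,\widetilde T_s]$ there exists a constant $\widetilde C_s=\widetilde C(s,k,T)$ such that $$\sup_{t\in[0,T]}\|u(t)-U(t)\|_{H^s_x(\mathbb R)}\le\widetilde C_s\max\{\epsilon^2,\epsilon^{k+1}\}.$$ Consequently, there exists a constant $\widetilde C_s'=\widetilde C'(s,k,T)$ such that $$\sup_{t\in[0,T]}\|u(t)-U(t)\|_{L^\infty_x(\mathbb R)}\le\widetilde C_s'\max\{\epsilon^2,\epsilon^{k+1}\}.$$ Here $\widetilde C$, $\widetilde C_s$ and $\widetilde C_s'$ do not depend on $\epsilon$ or on the particular data and solutions; besides the indicated quantities they may depend on the constants in the hypotheses ($c_0,C_0,C$, respectively $c_{0,s},C_{0,s},C_s$).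
   Context: $\mathbb N=\{1,2,3,\dots\}$. All data and solutions are real-valued and $H^s(\mathbb R)$ is the usual $L^2$-based Sobolev space. For $\sigma\in\mathbb N$, $\sigma\ge2$, and data in $H^\sigma(\mathbb R)$, "the solution" of either Cauchy problem means its unique strong solution, continuous in $t$ with values in $H^\sigma_x(\mathbb R)$ on its interval of existence (local existence and uniqueness is a known theorem of Staffilani, 1997, valid in $H^\sigma(\mathbb R)$ for $\sigma>1/2$); in (i) take $\sigma=2$ and in (ii) take $\sigma=s+1$. Both solutions are understood to exist on $[0,T]$ for the times $T$ in the claim. The reciprocal of $0$ is read as $+\infty$. *)

theory Defs
  imports "HOL-Analysis.Analysis" "HOL-Probability.Essential_Supremum"
begin

text \<open>
  Elements of \<open>L\<^sup>2(\<real>)\<close> and \<open>H\<^sup>s(\<real>)\<close> are represented by Borel functions, not by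
  almost-everywhere classes. The notions below do not depend on the representative.
\<close>

definition test_functions :: "(real \<Rightarrow> real) set" where
  "test_functions =
     {\<phi>. (\<forall>n x. (deriv ^^ n) \<phi> field_differentiable (at x)) \<and> compact (closure {x. \<phi> x \<noteq> 0})}"

definition L2_space :: "(real \<Rightarrow> real) set" where
  "L2_space = {f \<in> borel_measurable lborel. integrable lborel (\<lambda>x. (f x)\<^sup>2)}"

definition L2_norm :: "(real \<Rightarrow> real) \<Rightarrow> real" where
  "L2_norm f = sqrt (\<integral>x. (f x)\<^sup>2 \<partial>lborel)"

definition Linf_norm :: "(real \<Rightarrow> real) \<Rightarrow> ereal" where
  "Linf_norm f = esssup lborel (\<lambda>x. ereal \<bar>f x\<bar>)"

definition locally_integrable :: "(real \<Rightarrow> real) \<Rightarrow> bool" where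
  "locally_integrable f \<longleftrightarrow> (\<forall>a b. set_integrable lborel {a..b} f)"

definition has_weak_deriv :: "nat \<Rightarrow> (real \<Rightarrow> real) \<Rightarrow> (real \<Rightarrow> real) \<Rightarrow> bool" where
  "has_weak_deriv j f g \<longleftrightarrow> locally_integrable f \<and> locally_integrable g \<and>
     (\<forall>\<phi>\<in>test_functions.
        (\<integral>x. f x * (deriv ^^ j) \<phi> x \<partial>lborel) = (- 1) ^ j * (\<integral>x. g x * \<phi> x \<partial>lborel))"

text \<open>The choice is immaterial: weak derivatives are unique almost everywhere.\<close>

definition weak_deriv :: "nat \<Rightarrow> (real \<Rightarrow> real) \<Rightarrow> (real \<Rightarrow> real)" where
  "weak_deriv j f = (SOME g. has_weak_deriv j f g)"

definition H_space :: "nat \<Rightarrow> (real \<Rightarrow> real) set" where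
  "H_space s = {f \<in> L2_space. \<forall>j\<le>s. \<exists>g\<in>L2_space. has_weak_deriv j f g}"

definition H_norm :: "nat \<Rightarrow> (real \<Rightarrow> real) \<Rightarrow> real" where
  "H_norm s f = sqrt (\<Sum>j\<le>s. (L2_norm (weak_deriv j f))\<^sup>2)"

text \<open>
  Strong \<open>H\<^sup>\<sigma>\<close> solution, \<open>\<sigma> \<ge> 2\<close>, of \<open>v\<^sub>t + v\<^sub>x\<^sub>x\<^sub>x + v\<^sup>k v\<^sub>x = 0\<close>, \<open>v(0) = v0\<close>, on \<open>[0,T]\<close>, with
  \<open>v t x\<close> for \<open>v(t,x)\<close>. For \<open>\<sigma> = 2\<close> the term \<open>v\<^sub>x\<^sub>x\<^sub>x\<close> is only in \<open>H\<^sup>-\<^sup>1\<close>, so at each time the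
  equation is an identity of distributions in \<open>x\<close>. As \<open>v\<close> is continuous into \<open>H\<^sup>\<sigma>\<close>,
  \<open>v\<^sub>x\<^sub>x\<^sub>x + v\<^sup>k v\<^sub>x\<close> is continuous into \<open>H\<^sup>\<sigma>\<^sup>-\<^sup>3\<close>, so \<open>v\<close> is then automatically \<open>C\<^sup>1\<close> into
  \<open>H\<^sup>\<sigma>\<^sup>-\<^sup>3\<close> and solves the equation there.
\<close>

definition gkdv_solution ::
    "nat \<Rightarrow> nat \<Rightarrow> (real \<Rightarrow> real) \<Rightarrow> real \<Rightarrow> (real \<Rightarrow> real \<Rightarrow> real) \<Rightarrow> bool" where
  "gkdv_solution k \<sigma> v0 T v \<longleftrightarrow>
     (\<forall>t\<in>{0..T}. v t \<in> H_space \<sigma>) \<and>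
     (\<forall>t\<in>{0..T}. ((\<lambda>\<tau>. H_norm \<sigma> (\<lambda>x. v \<tau> x - v t x)) \<longlongrightarrow> 0) (at t within {0..T})) \<and>
     (AE x in lborel. v 0 x = v0 x) \<and>
     (\<forall>\<phi>\<in>test_functions. \<forall>t\<in>{0..T}.
        ((\<lambda>\<tau>. \<integral>x. v \<tau> x * \<phi> x \<partial>lborel) has_real_derivative
           (\<integral>x. v t x * (deriv ^^ 3) \<phi> x \<partial>lborel)
            - (\<integral>x. (v t x) ^ k * weak_deriv 1 (v t) x * \<phi> x \<partial>lborel))
          (at t within {0..T}))"

text \<open>Extended-real valued, since \<open>inverse 0 = \<infinity>\<close> there.\<close>

definition T_tilde ::
    "(nat \<Rightarrow> nat \<Rightarrow> real) \<Rightarrow> nat \<Rightarrow> nat \<Rightarrow> (real \<Rightarrow> real) \<Rightarrow> (real \<Rightarrow> real) \<Rightarrow> ereal" where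
  "T_tilde c s k u0 U0 =
     ereal (c s k) *
       min (inverse (ereal (H_norm (s + 1) U0 ^ k))) (inverse (ereal (H_norm (s + 1) u0)))"

end

theory Submission
  imports Defs
begin

text \<open>
  Both equations are treated as the free dispersive flow \<open>v\<^sub>t + v\<^sub>x\<^sub>x\<^sub>x = - N\<close> with a source
  \<open>N = v\<^sup>k v\<^sub>x\<close>. The flow preserves every Sobolev norm, so the difference \<open>w = u - U\<close> satisfies
  \<open>\<parallel>w(t)\<parallel> \<le> \<parallel>w(0)\<parallel> + 2 t sup \<parallel>u u\<^sub>x - U\<^sup>k U\<^sub>x\<parallel>\<close> in \<open>H\<^sup>s\<close>. No cancellation between the two sources
  is used: since \<open>H\<^sup>s\<^sup>+\<^sup>1\<close> controls \<open>u u\<^sub>x\<close> quadratically and \<open>U\<^sup>k U\<^sub>x\<close> with homogeneity \<open>k + 1\<close>, both are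
  of the claimed size as soon as \<open>u(t)\<close> and \<open>U(t)\<close> stay comparable in \<open>H\<^sup>s\<^sup>+\<^sup>1\<close> to their data, hence to
  \<open>\<epsilon>\<close>. Losing one derivative is harmless here (\<open>gkdv_difference_bound\<close>). The statement on
  \<open>L\<^sup>\<infinity>\<close> then follows from the embedding of \<open>H\<^sup>1\<close> (\<open>Linf_norm_le\<close>).

  What remains is the a priori bound \<open>\<parallel>v(t)\<parallel> \<le> 2 \<parallel>v(0)\<parallel>\<close> in \<open>H\<^sup>s\<^sup>+\<^sup>1\<close> for times up to a constant
  times \<open>\<parallel>v(0)\<parallel>\<^sup>-\<^sup>k\<close> (\<open>gkdv_a_priori_bound\<close>). It is the classical energy estimate: the time derivative
  of \<open>\<parallel>v\<parallel>\<^sup>2\<close> is at most a constant times \<open>\<parallel>v\<parallel>\<^sup>k\<^sup>+\<^sup>2\<close>. The top order part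
  \<open>\<partial>\<^sup>s\<^sup>+\<^sup>1 (v\<^sup>k v\<^sub>x)\<close> contains one derivative too many, namely \<open>v\<^sup>k \<partial>\<^sub>x g\<close> with \<open>g = \<partial>\<^sup>s\<^sup>+\<^sup>1 v\<close> only in
  \<open>L\<^sup>2\<close>; paired with \<open>g\<close> it is half of \<open>v\<^sup>k \<partial>\<^sub>x (g\<^sup>2)\<close>, and an integration by parts leaves only the derivative
  of \<open>v\<^sup>k\<close>, which is bounded.
  A continuity argument (\<open>continuity_bootstrap\<close>) turns the differential inequality into the bound.

  The solution has no derivatives to spare, so all of this is done on the regularised energies
  \<open>\<integral>\<integral> f(x) K(x - y) f(y) dx dy\<close> (\<open>conv_form\<close>) with \<open>K\<close> an even smooth kernel of compact support:
  derivatives fall on \<open>K\<close>, the dispersive term drops out because \<open>K'''\<close> is odd, and the top order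
  term is antisymmetrised in \<open>x\<close> and \<open>y\<close> (\<open>conv_form_odd_commutator\<close>), with a bound that does not
  change when \<open>K\<close> concentrates at the origin. In time only the mean value theorem for the scalar
  functions \<open>t \<mapsto> \<integral> v(t) \<phi>\<close> is used (\<open>conv_form_growth\<close>), so neither vector-valued integration nor
  joint measurability in time and space enters. The rest is the required calculus of weak derivatives in
  \<open>L\<^sup>2\<close>, obtained by mollification: uniqueness, the embedding of \<open>H\<^sup>1\<close> into bounded functions, the
  product rule, and the algebra property of \<open>H\<^sup>m\<close>.
\<close>

section \<open>Square integrable functions\<close>

lemma borel_measurable_L2 [measurable_dest]: "f \<in> L2_space \<Longrightarrow> f \<in> borel_measurable borel"
  by (simp add: L2_space_def)

lemma integrable_square_L2: "f \<in> L2_space \<Longrightarrow> integrable lborel (\<lambda>x. (f x)\<^sup>2)"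
  by (simp add: L2_space_def)

lemma integrable_mult_L2:
  assumes f: "f \<in> L2_space" and g: "g \<in> L2_space"
  shows "integrable lborel (\<lambda>x. f x * g x)"
proof (rule Bochner_Integration.integrable_bound)
  show "integrable lborel (\<lambda>x. (f x)\<^sup>2 + (g x)\<^sup>2)"
    using assms by (auto intro: integrable_square_L2)
  show "(\<lambda>x. f x * g x) \<in> borel_measurable lborel"
    using assms by measurable
  have "\<bar>f x * g x\<bar> \<le> (f x)\<^sup>2 + (g x)\<^sup>2" for x
  proof -
    have "0 \<le> (\<bar>f x\<bar> - \<bar>g x\<bar>)\<^sup>2" by simp
    then have "2 * \<bar>f x * g x\<bar> \<le> (f x)\<^sup>2 + (g x)\<^sup>2"
      by (simp add: power2_diff abs_mult)
    then show ?thesis by linarith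
  qed
  then show "AE x in lborel. norm (f x * g x) \<le> norm ((f x)\<^sup>2 + (g x)\<^sup>2)"
    by (intro AE_I2) (simp add: sum_power2_ge_zero)
qed

lemma L2_cmult: "f \<in> L2_space \<Longrightarrow> (\<lambda>x. c * f x) \<in> L2_space"
  by (auto simp: L2_space_def power_mult_distrib)

lemma L2_abs: "f \<in> L2_space \<Longrightarrow> (\<lambda>x. \<bar>f x\<bar>) \<in> L2_space"
  by (auto simp: L2_space_def)

lemma L2_add:
  assumes f: "f \<in> L2_space" and g: "g \<in> L2_space"
  shows "(\<lambda>x. f x + g x) \<in> L2_space"
proof -
  have [measurable]: "f \<in> borel_measurable borel" "g \<in> borel_measurable borel"
    using assms by (auto simp: borel_measurable_L2)
  have "integrable lborel (\<lambda>x. (f x)\<^sup>2 + (g x)\<^sup>2 + 2 * (f x * g x))"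
    using integrable_square_L2[OF f] integrable_square_L2[OF g] integrable_mult_L2[OF f g] by auto
  then show ?thesis
    by (simp add: L2_space_def power2_sum algebra_simps)
qed

lemma L2_minus: "f \<in> L2_space \<Longrightarrow> (\<lambda>x. - f x) \<in> L2_space"
  using L2_cmult[of f "-1"] by simp

lemma L2_diff: "f \<in> L2_space \<Longrightarrow> g \<in> L2_space \<Longrightarrow> (\<lambda>x. f x - g x) \<in> L2_space"
  using L2_add[of f "\<lambda>x. - g x"] L2_minus[of g] by simp

lemma L2_zero: "(\<lambda>x. 0) \<in> L2_space"
  by (simp add: L2_space_def)

lemma L2_norm_nonneg [simp]: "0 \<le> L2_norm f"
  by (simp add: L2_norm_def)

lemma L2_norm_square: "(L2_norm f)\<^sup>2 = (\<integral>x. (f x)\<^sup>2 \<partial>lborel)"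
  by (simp add: L2_norm_def)

lemma L2_norm_cmult: "L2_norm (\<lambda>x. c * f x) = \<bar>c\<bar> * L2_norm f"
  by (simp add: L2_norm_def power_mult_distrib real_sqrt_mult)

lemma L2_norm_minus: "L2_norm (\<lambda>x. - f x) = L2_norm f"
  by (simp add: L2_norm_def)

lemma L2_norm_abs: "L2_norm (\<lambda>x. \<bar>f x\<bar>) = L2_norm f"
  by (simp add: L2_norm_def)

lemma L2_norm_commute: "L2_norm (\<lambda>x. f x - g x) = L2_norm (\<lambda>x. g x - f x)"
  by (simp add: L2_norm_def power2_commute)

lemma L2_norm_mono_AE:
  assumes f: "f \<in> L2_space" and g: "g \<in> borel_measurable borel"
    and le: "AE x in lborel. \<bar>g x\<bar> \<le> \<bar>f x\<bar>"
  shows "g \<in> L2_space" "L2_norm g \<le> L2_norm f"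
proof -
  have le2: "AE x in lborel. (g x)\<^sup>2 \<le> (f x)\<^sup>2"
    using le by eventually_elim (simp add: abs_le_square_iff)
  have i: "integrable lborel (\<lambda>x. (g x)\<^sup>2)"
    by (rule Bochner_Integration.integrable_bound[OF integrable_square_L2[OF f]])
      (use g le2 in auto)
  then show "g \<in> L2_space" using g by (simp add: L2_space_def)
  show "L2_norm g \<le> L2_norm f"
    unfolding L2_norm_def
    by (intro real_sqrt_le_mono integral_mono_AE i integrable_square_L2 f le2)
qed

lemma L2_norm_cong_AE:
  assumes "f \<in> borel_measurable borel" "g \<in> borel_measurable borel"
    and "AE x in lborel. f x = g x"
  shows "L2_norm f = L2_norm g"
  unfolding L2_norm_def using assms
  by (intro arg_cong[where f=sqrt] integral_cong_AE) auto

text \<open>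
  The arithmetic-geometric-mean bound with a free weight is optimal for the weight \<open>b / a\<close>.
  Shifting \<open>a\<close> and \<open>b\<close> by a small \<open>d\<close> avoids a case distinction when one of them vanishes.
\<close>

lemma le_mult_if_weighted_sum_bound:
  fixes I \<kappa> a b :: real
  assumes bound: "\<And>l. l > 0 \<Longrightarrow> 2 * I \<le> \<kappa> * (l * a\<^sup>2 + b\<^sup>2 / l)" and "0 \<le> a" "0 \<le> b" "0 \<le> \<kappa>"
  shows "I \<le> \<kappa> * a * b"
proof -
  have ev: "2 * I \<le> 2 * \<kappa> * (a + d) * (b + d)" if d: "d > 0" for d
  proof -
    let ?l = "(b + d) / (a + d)"
    have pos: "a + d > 0" "b + d > 0" using assms d by auto
    then have l: "?l > 0" by simp
    have "?l * a\<^sup>2 \<le> ?l * (a + d)\<^sup>2"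
      using l d assms by (intro mult_left_mono power_mono) auto
    also have "\<dots> = (a + d) * (b + d)" using pos by (simp add: power2_eq_square)
    finally have 1: "?l * a\<^sup>2 \<le> (a + d) * (b + d)" .
    have "b\<^sup>2 / ?l \<le> (b + d)\<^sup>2 / ?l"
      using l d assms by (intro divide_right_mono power_mono) auto
    also have "\<dots> = (a + d) * (b + d)" using pos by (simp add: power2_eq_square)
    finally have 2: "b\<^sup>2 / ?l \<le> (a + d) * (b + d)" .
    have "2 * I \<le> \<kappa> * (?l * a\<^sup>2 + b\<^sup>2 / ?l)" using bound[OF l] .
    also have "\<dots> \<le> \<kappa> * (2 * ((a + d) * (b + d)))"
      using 1 2 assms by (intro mult_left_mono) auto
    finally show ?thesis by (simp add: algebra_simps)
  qed
  have "((\<lambda>d. 2 * \<kappa> * (a + d) * (b + d)) \<longlongrightarrow> 2 * \<kappa> * (a + 0) * (b + 0)) (at_right 0)"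
    by (intro tendsto_intros)
  moreover have "eventually (\<lambda>d. 2 * I \<le> 2 * \<kappa> * (a + d) * (b + d)) (at_right 0)"
    using ev by (auto simp: eventually_at_right_less intro: eventually_mono[OF eventually_at_right_less])
  ultimately have "2 * I \<le> 2 * \<kappa> * (a + 0) * (b + 0)"
    by (intro tendsto_lowerbound[where F = "at_right 0"]) auto
  then show ?thesis by simp
qed

lemma Cauchy_Schwarz_L2:
  assumes f: "f \<in> L2_space" and g: "g \<in> L2_space"
  shows "(\<integral>x. \<bar>f x * g x\<bar> \<partial>lborel) \<le> L2_norm f * L2_norm g"
proof -
  have "(\<integral>x. \<bar>f x * g x\<bar> \<partial>lborel) \<le> 1 * L2_norm f * L2_norm g"
  proof (rule le_mult_if_weighted_sum_bound)
    fix l :: real assume l: "l > 0"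
    have pt: "2 * \<bar>f x * g x\<bar> \<le> l * (f x)\<^sup>2 + (g x)\<^sup>2 / l" for x
    proof -
      have "0 \<le> (sqrt l * \<bar>f x\<bar> - \<bar>g x\<bar> / sqrt l)\<^sup>2" by simp
      also have "\<dots> = l * (f x)\<^sup>2 + (g x)\<^sup>2 / l - 2 * \<bar>f x * g x\<bar>"
        using l by (simp add: power2_diff power_mult_distrib power_divide abs_mult)
      finally show ?thesis by simp
    qed
    have "2 * (\<integral>x. \<bar>f x * g x\<bar> \<partial>lborel) = (\<integral>x. 2 * \<bar>f x * g x\<bar> \<partial>lborel)" by simp
    also have "\<dots> \<le> (\<integral>x. l * (f x)\<^sup>2 + (g x)\<^sup>2 / l \<partial>lborel)"
      using integrable_square_L2[OF f] integrable_square_L2[OF g] integrable_mult_L2[OF f g] pt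
      by (intro integral_mono) auto
    also have "\<dots> = l * (L2_norm f)\<^sup>2 + (L2_norm g)\<^sup>2 / l"
      using integrable_square_L2[OF f] integrable_square_L2[OF g]
      by (simp add: L2_norm_square)
    finally show "2 * (\<integral>x. \<bar>f x * g x\<bar> \<partial>lborel) \<le> 1 * (l * (L2_norm f)\<^sup>2 + (L2_norm g)\<^sup>2 / l)"
      by simp
  qed auto
  then show ?thesis by simp
qed

lemma abs_inner_L2_le:
  assumes f: "f \<in> L2_space" and g: "g \<in> L2_space"
  shows "\<bar>\<integral>x. f x * g x \<partial>lborel\<bar> \<le> L2_norm f * L2_norm g"
proof -
  have "\<bar>\<integral>x. f x * g x \<partial>lborel\<bar> \<le> (\<integral>x. \<bar>f x * g x\<bar> \<partial>lborel)"
    using integral_norm_bound[of lborel "\<lambda>x. f x * g x"] by simp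
  then show ?thesis using Cauchy_Schwarz_L2[OF f g] by linarith
qed

lemma L2_norm_triangle:
  assumes f: "f \<in> L2_space" and g: "g \<in> L2_space"
  shows "L2_norm (\<lambda>x. f x + g x) \<le> L2_norm f + L2_norm g"
proof (rule power2_le_imp_le)
  have "(L2_norm (\<lambda>x. f x + g x))\<^sup>2 = (\<integral>x. (f x)\<^sup>2 + (g x)\<^sup>2 + 2 * (f x * g x) \<partial>lborel)"
    by (simp add: L2_norm_square power2_sum algebra_simps)
  also have "\<dots> = (L2_norm f)\<^sup>2 + (L2_norm g)\<^sup>2 + 2 * (\<integral>x. f x * g x \<partial>lborel)"
    using integrable_square_L2[OF f] integrable_square_L2[OF g] integrable_mult_L2[OF f g]
    by (simp add: L2_norm_square)
  also have "\<dots> \<le> (L2_norm f + L2_norm g)\<^sup>2"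
    using abs_inner_L2_le[OF f g] by (simp add: power2_sum)
  finally show "(L2_norm (\<lambda>x. f x + g x))\<^sup>2 \<le> (L2_norm f + L2_norm g)\<^sup>2" .
qed auto

lemma L2_norm_triangle_diff:
  assumes f: "f \<in> L2_space" and g: "g \<in> L2_space" and h: "h \<in> L2_space"
  shows "L2_norm (\<lambda>x. f x - h x) \<le> L2_norm (\<lambda>x. f x - g x) + L2_norm (\<lambda>x. g x - h x)"
  using L2_norm_triangle[OF L2_diff[OF f g] L2_diff[OF g h]] by simp

lemma abs_L2_norm_diff_le:
  assumes f: "f \<in> L2_space" and g: "g \<in> L2_space"
  shows "\<bar>L2_norm f - L2_norm g\<bar> \<le> L2_norm (\<lambda>x. f x - g x)"
  using L2_norm_triangle[OF L2_diff[OF f g] g] L2_norm_triangle[OF L2_diff[OF g f] f]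
    L2_norm_commute[of f g] by simp

lemma L2_mult_bounded:
  assumes f: "f \<in> L2_space" and a: "a \<in> borel_measurable borel"
    and bd: "AE x in lborel. \<bar>a x\<bar> \<le> B"
  shows "(\<lambda>x. a x * f x) \<in> L2_space" "L2_norm (\<lambda>x. a x * f x) \<le> B * L2_norm f"
proof -
  have B: "0 \<le> B"
  proof (rule ccontr)
    assume "\<not> 0 \<le> B"
    with bd have "AE x::real in lborel. False" by (auto elim!: eventually_mono)
    then show False by (simp add: eventually_False ae_filter_eq_bot_iff)
  qed
  have le: "AE x in lborel. \<bar>a x * f x\<bar> \<le> \<bar>B * f x\<bar>"
    using bd by eventually_elim (use B in \<open>simp add: abs_mult mult_right_mono\<close>)
  have m: "(\<lambda>x. a x * f x) \<in> borel_measurable borel" using f a by measurable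
  from L2_norm_mono_AE[OF L2_cmult[OF f] m le]
  show "(\<lambda>x. a x * f x) \<in> L2_space" "L2_norm (\<lambda>x. a x * f x) \<le> B * L2_norm f"
    using B by (auto simp: L2_norm_cmult)
qed

lemma integrable_indicator_L2:
  assumes f: "f \<in> L2_space"
  shows "set_integrable lborel {a..b} f"
proof -
  have "indicator {a..b} \<in> L2_space"
    unfolding L2_space_def
    by (auto simp: power2_eq_square indicator_inter_arith[symmetric] emeasure_lborel_Icc_eq)
  from integrable_mult_L2[OF this f] show ?thesis
    by (simp add: set_integrable_def)
qed

lemma locally_integrable_L2: "f \<in> L2_space \<Longrightarrow> locally_integrable f"
  by (simp add: locally_integrable_def integrable_indicator_L2)

lemma borel_measurable_locally_integrable:
  assumes "locally_integrable f"
  shows "f \<in> borel_measurable borel"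
proof (rule borel_measurable_LIMSEQ_real)
  fix n :: nat
  have "set_integrable lborel {- real n..real n} f"
    using assms by (simp add: locally_integrable_def)
  then show "(\<lambda>x. indicator {- real n..real n} x * f x) \<in> borel_measurable borel"
    by (auto simp: set_integrable_def dest: borel_measurable_integrable)
next
  fix x :: real
  obtain N :: nat where N: "\<bar>x\<bar> \<le> real N" using real_arch_simple by blast
  have "eventually (\<lambda>n. indicator {- real n..real n} x * f x = f x) sequentially"
    using eventually_ge_at_top[of N]
  proof eventually_elim
    case (elim n)
    with N have "x \<in> {- real n..real n}" by (auto simp: abs_le_iff)
    then show ?case by simp
  qed
  then show "(\<lambda>n. indicator {- real n..real n} x * f x) \<longlonglongrightarrow> f x"
    by (rule tendsto_eventually)
qed

section \<open>Convolution with continuous kernels of compact support\<close>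

definition kernel :: "(real \<Rightarrow> real) \<Rightarrow> bool" where
  "kernel K \<longleftrightarrow> continuous_on UNIV K \<and> (\<exists>R. \<forall>x. R < \<bar>x\<bar> \<longrightarrow> K x = 0)"

definition L1_norm :: "(real \<Rightarrow> real) \<Rightarrow> real" where
  "L1_norm K = (\<integral>x. \<bar>K x\<bar> \<partial>lborel)"

definition conv :: "(real \<Rightarrow> real) \<Rightarrow> (real \<Rightarrow> real) \<Rightarrow> real \<Rightarrow> real" where
  "conv K f x = (\<integral>y. K (x - y) * f y \<partial>lborel)"

text \<open>
  The quadratic form \<open>conv_form K f f\<close> is a regularised square of the \<open>L\<^sup>2\<close> norm when \<open>K\<close> is even and
  concentrated near the origin. Derivatives of \<open>f\<close> can be moved onto \<open>K\<close>, which is why energies of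
  non-smooth functions are expressed through it.
\<close>

definition conv_form :: "(real \<Rightarrow> real) \<Rightarrow> (real \<Rightarrow> real) \<Rightarrow> (real \<Rightarrow> real) \<Rightarrow> real" where
  "conv_form K f g = (\<integral>x. f x * conv K g x \<partial>lborel)"

lemma L1_norm_nonneg [simp]: "0 \<le> L1_norm K"
  by (simp add: L1_norm_def)

lemma kernel_measurable: "kernel K \<Longrightarrow> K \<in> borel_measurable borel"
  by (simp add: kernel_def borel_measurable_continuous_onI)

lemma kernel_support:
  assumes "kernel K" obtains R where "R > 0" "\<And>x. R < \<bar>x\<bar> \<Longrightarrow> K x = 0"
proof -
  obtain R where R: "\<And>x. R < \<bar>x\<bar> \<Longrightarrow> K x = 0" using assms by (auto simp: kernel_def)
  show ?thesis by (rule that[of "max R 1"]) (auto intro: R)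
qed

lemma kernel_integrable:
  assumes "kernel K" shows "integrable lborel K"
proof -
  obtain R where R: "\<And>x. R < \<bar>x\<bar> \<Longrightarrow> K x = 0" using assms by (auto simp: kernel_def)
  have "set_integrable lborel {-R..R} K"
    using assms by (intro borel_integrable_atLeastAtMost') (auto simp: kernel_def intro: continuous_on_subset)
  moreover have "(\<lambda>x. indicator {-R..R} x *\<^sub>R K x) = K"
    using R by (force simp: indicator_def fun_eq_iff)
  ultimately show ?thesis by (simp add: set_integrable_def)
qed

lemma kernel_bounded:
  assumes "kernel K" obtains B where "B > 0" "\<And>x. \<bar>K x\<bar> \<le> B"
proof -
  obtain R where R: "R > 0" "\<And>x. R < \<bar>x\<bar> \<Longrightarrow> K x = 0" using kernel_support[OF assms] by blast
  have "compact (K ` {-R..R})"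
    using assms by (intro compact_continuous_image) (auto simp: kernel_def intro: continuous_on_subset)
  then have "bounded (K ` {-R..R})" by (rule compact_imp_bounded)
  then obtain B where B: "B > 0" "\<And>x. x \<in> {-R..R} \<Longrightarrow> \<bar>K x\<bar> \<le> B"
    by (auto simp: bounded_pos)
  show ?thesis
  proof (rule that[OF B(1)])
    fix x show "\<bar>K x\<bar> \<le> B"
      using B R(2)[of x] by (cases "x \<in> {-R..R}") (auto simp: not_le)
  qed
qed

lemma kernel_abs: "kernel K \<Longrightarrow> kernel (\<lambda>x. \<bar>K x\<bar>)"
  by (auto simp: kernel_def intro!: continuous_intros)

lemma kernel_mult: "kernel K \<Longrightarrow> continuous_on UNIV f \<Longrightarrow> kernel (\<lambda>x. f x * K x)"
  by (auto simp: kernel_def intro!: continuous_intros)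

lemma kernel_add:
  assumes "kernel u" "kernel v" shows "kernel (\<lambda>x. u x + v x)"
proof -
  obtain R where R: "\<And>x. R < \<bar>x\<bar> \<Longrightarrow> u x = 0" using assms(1) by (auto simp: kernel_def)
  obtain S where S: "\<And>x. S < \<bar>x\<bar> \<Longrightarrow> v x = 0" using assms(2) by (auto simp: kernel_def)
  have "\<forall>x. max R S < \<bar>x\<bar> \<longrightarrow> u x + v x = 0" using R S by simp
  moreover have "continuous_on UNIV (\<lambda>x. u x + v x)"
    using assms by (intro continuous_intros) (auto simp: kernel_def)
  ultimately show ?thesis unfolding kernel_def by blast
qed

lemma kernel_reflect_shift:
  assumes "kernel K" shows "kernel (\<lambda>y. K (x - y))"
proof -
  obtain R where R: "\<And>x. R < \<bar>x\<bar> \<Longrightarrow> K x = 0" using assms by (auto simp: kernel_def)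
  have "\<forall>y. R + \<bar>x\<bar> < \<bar>y\<bar> \<longrightarrow> K (x - y) = 0" by (intro allI impI R) auto
  moreover have "continuous_on UNIV (\<lambda>y. K (x - y))"
    using assms by (auto simp: kernel_def intro!: continuous_on_compose2[of UNIV K] continuous_intros)
  ultimately show ?thesis by (auto simp: kernel_def)
qed

lemma kernel_reflect: "kernel K \<Longrightarrow> kernel (\<lambda>y. K (- y))"
  using kernel_reflect_shift[of K 0] by simp

lemma kernel_L2:
  assumes "kernel K" shows "K \<in> L2_space"
proof -
  have "kernel (\<lambda>x. K x * K x)" using assms by (intro kernel_mult) (auto simp: kernel_def)
  then show ?thesis
    using kernel_integrable kernel_measurable[OF assms] by (auto simp: L2_space_def power2_eq_square)
qed

lemma integral_reflect_shift: "(\<integral>y. f (x - y) \<partial>lborel) = (\<integral>y. f y \<partial>lborel)" for f :: "real \<Rightarrow> real"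
  using lborel_integral_real_affine[of "-1" f x] by simp

lemma integral_shift: "(\<integral>y. f (y - x) \<partial>lborel) = (\<integral>y. f y \<partial>lborel)" for f :: "real \<Rightarrow> real"
  using lborel_integral_real_affine[of "1" f "-x"] by simp

lemma integrable_conv_integrand:
  assumes "kernel K" "f \<in> L2_space" shows "integrable lborel (\<lambda>y. K (x - y) * f y)"
  using kernel_L2[OF kernel_reflect_shift[OF assms(1)]] assms(2) by (rule integrable_mult_L2)

lemma integrable_pair_conv_L1:
  assumes K: "kernel K" and h: "integrable lborel h"
  shows "integrable (lborel \<Otimes>\<^sub>M lborel) (\<lambda>(y, x). K (x - y) * h y)"
proof (rule lborel_pair.Fubini_integrable)
  have [measurable]: "K \<in> borel_measurable borel" "h \<in> borel_measurable borel"
    using kernel_measurable[OF K] h by auto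
  show "(\<lambda>(y, x). K (x - y) * h y) \<in> borel_measurable (lborel \<Otimes>\<^sub>M lborel)"
    by measurable
  have "(\<integral>x. norm (K (x - y) * h y) \<partial>lborel) = L1_norm K * \<bar>h y\<bar>" for y
    using integral_shift[of "\<lambda>x. \<bar>K x\<bar>" y] by (simp add: abs_mult L1_norm_def)
  then show "integrable lborel (\<lambda>y. \<integral>x. norm (case (y, x) of (y, x) \<Rightarrow> K (x - y) * h y) \<partial>lborel)"
    using h by simp
  have "integrable lborel (\<lambda>x. K (x - y))" for y
    using lborel_integrable_real_affine[OF kernel_integrable[OF K], of 1 "-y"] by simp
  then show "AE y in lborel. integrable lborel (\<lambda>x. case (y, x) of (y, x) \<Rightarrow> K (x - y) * h y)"
    by auto
qed

lemma conv_L1: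
  assumes K: "kernel K" and h: "integrable lborel h"
  shows "integrable lborel (\<lambda>x. \<integral>y. K (x - y) * h y \<partial>lborel)"
    and "(\<integral>x. (\<integral>y. K (x - y) * h y \<partial>lborel) \<partial>lborel) = (\<integral>x. K x \<partial>lborel) * (\<integral>x. h x \<partial>lborel)"
proof -
  note i = integrable_pair_conv_L1[OF K h]
  show "integrable lborel (\<lambda>x. \<integral>y. K (x - y) * h y \<partial>lborel)"
    using lborel_pair.integrable_snd[OF i] by simp
  have "(\<integral>x. (\<integral>y. K (x - y) * h y \<partial>lborel) \<partial>lborel) = (\<integral>y. (\<integral>x. K (x - y) * h y \<partial>lborel) \<partial>lborel)"
    by (rule lborel_pair.Fubini_integral) (use i in simp)
  also have "\<dots> = (\<integral>y. (\<integral>x. K x \<partial>lborel) * h y \<partial>lborel)"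
    using integral_shift[of K] by simp
  finally show "(\<integral>x. (\<integral>y. K (x - y) * h y \<partial>lborel) \<partial>lborel) = (\<integral>x. K x \<partial>lborel) * (\<integral>x. h x \<partial>lborel)"
    by simp
qed

lemma conv_measurable:
  assumes "kernel K" "f \<in> borel_measurable borel" shows "conv K f \<in> borel_measurable borel"
proof -
  have [measurable]: "K \<in> borel_measurable borel" "f \<in> borel_measurable borel"
    using kernel_measurable assms by auto
  show ?thesis unfolding conv_def[abs_def] by measurable
qed

text \<open>
  Young's inequality. Splitting \<open>\<bar>K\<bar>\<close> into two square roots in the Cauchy-Schwarz inequality bounds
  \<open>(K * f)\<^sup>2\<close> by \<open>\<parallel>K\<parallel>\<^sub>1 (\<bar>K\<bar> * f\<^sup>2)\<close>, whose integral is known by Fubini.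
\<close>

lemma conv_L2:
  assumes K: "kernel K" and f: "f \<in> L2_space"
  shows "conv K f \<in> L2_space" "L2_norm (conv K f) \<le> L1_norm K * L2_norm f"
proof -
  have Km: "K \<in> borel_measurable borel" using kernel_measurable[OF K] .
  have fm: "f \<in> borel_measurable borel" using f by (rule borel_measurable_L2)
  let ?g = "\<lambda>x. \<integral>y. \<bar>K (x - y)\<bar> * (f y)\<^sup>2 \<partial>lborel"
  note g = conv_L1[OF kernel_abs[OF K] integrable_square_L2[OF f]]
  have pt: "(conv K f x)\<^sup>2 \<le> L1_norm K * ?g x" for x
  proof -
    let ?s = "\<lambda>y. sqrt \<bar>K (x - y)\<bar>"
    have k: "kernel (\<lambda>y. \<bar>K (x - y)\<bar>)" by (intro kernel_abs kernel_reflect_shift K)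
    obtain B where B: "B > 0" "\<And>x. \<bar>K x\<bar> \<le> B" using kernel_bounded[OF K] by blast
    have s: "?s \<in> L2_space"
      using kernel_integrable[OF k] Km by (auto simp: L2_space_def)
    have sm: "?s \<in> borel_measurable borel" using s by (rule borel_measurable_L2)
    have sf: "(\<lambda>y. ?s y * f y) \<in> L2_space"
      by (rule L2_mult_bounded(1)[OF f sm, of "sqrt B"]) (use B in auto)
    have ns: "(L2_norm ?s)\<^sup>2 = L1_norm K"
      using integral_reflect_shift[of "\<lambda>y. \<bar>K y\<bar>" x] by (simp add: L2_norm_square L1_norm_def)
    have nsf: "(L2_norm (\<lambda>y. ?s y * f y))\<^sup>2 = ?g x"
      by (simp add: L2_norm_square power_mult_distrib)
    have "\<bar>conv K f x\<bar> \<le> (\<integral>y. \<bar>K (x - y) * f y\<bar> \<partial>lborel)"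
      using integral_norm_bound[of lborel "\<lambda>y. K (x - y) * f y"] by (simp add: conv_def)
    also have "\<dots> = (\<integral>y. \<bar>?s y * (?s y * f y)\<bar> \<partial>lborel)"
      by (simp add: abs_mult mult.assoc[symmetric])
    also have "\<dots> \<le> L2_norm ?s * L2_norm (\<lambda>y. ?s y * f y)"
      by (rule Cauchy_Schwarz_L2[OF s sf])
    finally have "\<bar>conv K f x\<bar>\<^sup>2 \<le> (L2_norm ?s * L2_norm (\<lambda>y. ?s y * f y))\<^sup>2"
      by (rule power_mono) simp
    then show ?thesis by (simp add: power_mult_distrib ns nsf)
  qed
  have cm: "conv K f \<in> borel_measurable borel" by (rule conv_measurable[OF K fm])
  have gi: "integrable lborel (\<lambda>x. L1_norm K * ?g x)" using g(1) by simp
  have i: "integrable lborel (\<lambda>x. (conv K f x)\<^sup>2)"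
    by (rule Bochner_Integration.integrable_bound[OF gi])
      (use cm in \<open>auto intro!: AE_I2 order_trans[OF pt]\<close>)
  then show "conv K f \<in> L2_space" using cm by (simp add: L2_space_def)
  have "(L2_norm (conv K f))\<^sup>2 \<le> (\<integral>x. L1_norm K * ?g x \<partial>lborel)"
    unfolding L2_norm_square by (rule integral_mono[OF i gi pt])
  also have "\<dots> = (L1_norm K * L2_norm f)\<^sup>2"
    using g(2) by (simp add: L2_norm_square power_mult_distrib) (simp add: L1_norm_def power2_eq_square)
  finally show "L2_norm (conv K f) \<le> L1_norm K * L2_norm f"
    by (rule power2_le_imp_le) simp
qed

lemma conv_add:
  assumes "kernel K" "f \<in> L2_space" "g \<in> L2_space"
  shows "conv K (\<lambda>x. f x + g x) = (\<lambda>x. conv K f x + conv K g x)"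
  using assms by (auto simp: conv_def fun_eq_iff distrib_left integrable_conv_integrand)

lemma conv_diff:
  assumes "kernel K" "f \<in> L2_space" "g \<in> L2_space"
  shows "conv K (\<lambda>x. f x - g x) = (\<lambda>x. conv K f x - conv K g x)"
  using assms by (auto simp: conv_def fun_eq_iff right_diff_distrib integrable_conv_integrand)

lemma conv_cmult: "conv K (\<lambda>x. c * f x) = (\<lambda>x. c * conv K f x)"
proof
  fix x
  have "(\<lambda>y. K (x - y) * (c * f y)) = (\<lambda>y. c * (K (x - y) * f y))" by auto
  then show "conv K (\<lambda>x. c * f x) x = c * conv K f x" by (simp add: conv_def)
qed

lemma abs_conv_form_le:
  assumes "kernel K" "f \<in> L2_space" "g \<in> L2_space"
  shows "\<bar>conv_form K f g\<bar> \<le> L1_norm K * L2_norm f * L2_norm g"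
proof -
  have "\<bar>conv_form K f g\<bar> \<le> L2_norm f * L2_norm (conv K g)"
    unfolding conv_form_def using assms by (intro abs_inner_L2_le conv_L2)
  also have "\<dots> \<le> L2_norm f * (L1_norm K * L2_norm g)"
    using assms by (intro mult_left_mono conv_L2) auto
  finally show ?thesis by (simp add: ac_simps)
qed

lemma conv_form_add_left:
  assumes "kernel K" "f \<in> L2_space" "h \<in> L2_space" "g \<in> L2_space"
  shows "conv_form K (\<lambda>x. f x + h x) g = conv_form K f g + conv_form K h g"
  using assms by (auto simp: conv_form_def distrib_right integrable_mult_L2 conv_L2)

lemma conv_form_diff_left:
  assumes "kernel K" "f \<in> L2_space" "h \<in> L2_space" "g \<in> L2_space"
  shows "conv_form K (\<lambda>x. f x - h x) g = conv_form K f g - conv_form K h g"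
  using assms by (auto simp: conv_form_def left_diff_distrib integrable_mult_L2 conv_L2)

lemma conv_form_diff_right:
  assumes "kernel K" "f \<in> L2_space" "h \<in> L2_space" "g \<in> L2_space"
  shows "conv_form K g (\<lambda>x. f x - h x) = conv_form K g f - conv_form K g h"
  using assms by (auto simp: conv_form_def conv_diff right_diff_distrib integrable_mult_L2 conv_L2)

lemma conv_form_add_right:
  assumes "kernel K" "f \<in> L2_space" "h \<in> L2_space" "g \<in> L2_space"
  shows "conv_form K g (\<lambda>x. f x + h x) = conv_form K g f + conv_form K g h"
  using assms by (auto simp: conv_form_def conv_add distrib_left integrable_mult_L2 conv_L2)

lemma conv_form_cmult_right: "conv_form K g (\<lambda>x. c * f x) = c * conv_form K g f"
  by (simp add: conv_form_def conv_cmult mult.left_commute)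

lemma conv_form_uminus_kernel: "conv_form (\<lambda>x. - K x) f g = - conv_form K f g"
  by (simp add: conv_form_def conv_def)

lemma integrable_pair_conv_form:
  assumes K: "kernel K" and f: "f \<in> L2_space" and g: "g \<in> L2_space"
  shows "integrable (lborel \<Otimes>\<^sub>M lborel) (\<lambda>(x, y). f x * (K (x - y) * g y))"
proof -
  have [measurable]: "K \<in> borel_measurable borel" "f \<in> borel_measurable borel" "g \<in> borel_measurable borel"
    using kernel_measurable[OF K] f g by (auto intro: borel_measurable_L2)
  note Kr = kernel_abs[OF kernel_reflect[OF K]]
  have 1: "integrable (lborel \<Otimes>\<^sub>M lborel) (\<lambda>(x, y). \<bar>K (x - y)\<bar> * (f x)\<^sup>2)"
    using integrable_pair_conv_L1[OF Kr integrable_square_L2[OF f]] by simp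
  have 2: "integrable (lborel \<Otimes>\<^sub>M lborel) (\<lambda>(x, y). \<bar>K (x - y)\<bar> * (g y)\<^sup>2)"
    using lborel_pair.integrable_product_swap[OF integrable_pair_conv_L1[OF kernel_abs[OF K] integrable_square_L2[OF g]]]
    by simp
  show ?thesis
  proof (rule Bochner_Integration.integrable_bound[OF Bochner_Integration.integrable_add[OF 1 2]])
    show "(\<lambda>(x, y). f x * (K (x - y) * g y)) \<in> borel_measurable (lborel \<Otimes>\<^sub>M lborel)"
      by measurable
    have "\<bar>f x * (K (x - y) * g y)\<bar> \<le> \<bar>K (x - y)\<bar> * (f x)\<^sup>2 + \<bar>K (x - y)\<bar> * (g y)\<^sup>2" for x y
    proof -
      have "0 \<le> (\<bar>f x\<bar> - \<bar>g y\<bar>)\<^sup>2" by simp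
      then have "2 * (\<bar>f x\<bar> * \<bar>g y\<bar>) \<le> (f x)\<^sup>2 + (g y)\<^sup>2"
        by (simp add: power2_diff)
      moreover have "0 \<le> \<bar>f x\<bar> * \<bar>g y\<bar>" by simp
      ultimately have "\<bar>f x\<bar> * \<bar>g y\<bar> \<le> (f x)\<^sup>2 + (g y)\<^sup>2" by linarith
      then have "\<bar>K (x - y)\<bar> * (\<bar>f x\<bar> * \<bar>g y\<bar>) \<le> \<bar>K (x - y)\<bar> * ((f x)\<^sup>2 + (g y)\<^sup>2)"
        by (rule mult_left_mono) simp
      then show ?thesis by (simp add: abs_mult algebra_simps)
    qed
    then show "AE p in lborel \<Otimes>\<^sub>M lborel. norm (case p of (x, y) \<Rightarrow> f x * (K (x - y) * g y))
      \<le> norm ((case p of (x, y) \<Rightarrow> \<bar>K (x - y)\<bar> * (f x)\<^sup>2) + (case p of (x, y) \<Rightarrow> \<bar>K (x - y)\<bar> * (g y)\<^sup>2))"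
      by (intro AE_I2) (force intro: order_trans)
  qed
qed

text \<open>
  For even \<open>K\<close> this makes the form symmetric, for odd \<open>K\<close> antisymmetric.
\<close>

lemma conv_form_swap:
  assumes K: "kernel K" and f: "f \<in> L2_space" and g: "g \<in> L2_space"
  shows "conv_form K f g = conv_form (\<lambda>z. K (- z)) g f"
proof -
  have "conv_form K f g = (\<integral>x. (\<integral>y. f x * (K (x - y) * g y) \<partial>lborel) \<partial>lborel)"
    by (simp add: conv_form_def conv_def)
  also have "\<dots> = (\<integral>y. (\<integral>x. f x * (K (x - y) * g y) \<partial>lborel) \<partial>lborel)"
    by (rule lborel_pair.Fubini_integral[symmetric]) (rule integrable_pair_conv_form[OF assms])
  also have "\<dots> = (\<integral>y. g y * (\<integral>x. K (- (y - x)) * f x \<partial>lborel) \<partial>lborel)"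
    by (intro Bochner_Integration.integral_cong refl, subst Bochner_Integration.integral_mult_right_zero[symmetric])
      (simp add: mult.left_commute mult.commute)
  finally show ?thesis by (simp add: conv_form_def conv_def)
qed

lemma conv_form_odd_kernel:
  assumes K: "kernel K" and odd: "\<And>z. K (- z) = - K z" and f: "f \<in> L2_space"
  shows "conv_form K f f = 0"
  using conv_form_swap[OF K f f] by (simp add: odd conv_form_uminus_kernel)

text \<open>
  The commutator estimate behind the energy bound for a transport term \<open>a \<partial>\<^sub>x g\<close>.
  Since the kernel is odd, exchanging \<open>x\<close> and \<open>y\<close> replaces the coefficient \<open>a x\<close> by
  \<open>(a x - a y) / 2\<close>, and the Lipschitz bound supplies a factor \<open>\<bar>x - y\<bar>\<close> that compensates the
  derivative contained in the kernel. The null set is there because weakly differentiable coefficients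
  are Lipschitz only after a change on such a set.
\<close>

lemma conv_form_odd_commutator:
  assumes K: "kernel K" and odd: "\<And>z. K (- z) = - K z" and g: "g \<in> L2_space"
    and a: "a \<in> borel_measurable borel" and bd: "AE x in lborel. \<bar>a x\<bar> \<le> B" and L: "0 \<le> L"
    and N: "N \<in> null_sets lborel"
    and lip: "\<And>x y. x \<notin> N \<Longrightarrow> y \<notin> N \<Longrightarrow> \<bar>a x - a y\<bar> \<le> L * \<bar>x - y\<bar>"
  shows "\<bar>conv_form K (\<lambda>x. a x * g x) g\<bar> \<le> L * L1_norm (\<lambda>z. z * K z) * (L2_norm g)\<^sup>2"
proof -
  define ag where "ag = (\<lambda>x. a x * g x)"
  have ag: "ag \<in> L2_space" unfolding ag_def by (rule L2_mult_bounded[OF g a bd])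
  have [measurable]: "K \<in> borel_measurable borel" "g \<in> borel_measurable borel" "a \<in> borel_measurable borel"
    using kernel_measurable[OF K] g a by (auto intro: borel_measurable_L2)
  define Z where "Z = (\<lambda>z. \<bar>z * K z\<bar>)"
  have Z: "kernel Z" unfolding Z_def by (intro kernel_abs kernel_mult K continuous_intros)
  note gabs = L2_abs[OF g]
  have i1: "integrable (lborel \<Otimes>\<^sub>M lborel) (\<lambda>(x, y). ag x * (K (x - y) * g y))"
    by (rule integrable_pair_conv_form[OF K ag g])
  have i2: "integrable (lborel \<Otimes>\<^sub>M lborel) (\<lambda>(x, y). g x * (K (x - y) * ag y))"
    by (rule integrable_pair_conv_form[OF K g ag])
  have iz: "integrable (lborel \<Otimes>\<^sub>M lborel) (\<lambda>(x, y). \<bar>g x\<bar> * (Z (x - y) * \<bar>g y\<bar>))"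
    by (rule integrable_pair_conv_form[OF Z gabs gabs])
  have e1: "conv_form K ag g = (\<integral>p. (case p of (x, y) \<Rightarrow> ag x * (K (x - y) * g y)) \<partial>(lborel \<Otimes>\<^sub>M lborel))"
    using lborel_pair.integral_fst[OF i1] by (simp add: conv_form_def conv_def)
  have e2: "conv_form K g ag = (\<integral>p. (case p of (x, y) \<Rightarrow> g x * (K (x - y) * ag y)) \<partial>(lborel \<Otimes>\<^sub>M lborel))"
    using lborel_pair.integral_fst[OF i2] by (simp add: conv_form_def conv_def)
  have ez: "conv_form Z (\<lambda>x. \<bar>g x\<bar>) (\<lambda>x. \<bar>g x\<bar>) =
      (\<integral>p. (case p of (x, y) \<Rightarrow> \<bar>g x\<bar> * (Z (x - y) * \<bar>g y\<bar>)) \<partial>(lborel \<Otimes>\<^sub>M lborel))"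
    using lborel_pair.integral_fst[OF iz] by (simp add: conv_form_def conv_def)
  have sw: "conv_form K ag g = - conv_form K g ag"
    using conv_form_swap[OF K ag g] by (simp add: odd conv_form_uminus_kernel)
  have AEN: "AE x in lborel. x \<notin> N" by (rule AE_not_in[OF N])
  have AE1: "AE p in lborel \<Otimes>\<^sub>M lborel. fst p \<notin> N \<and> snd p \<notin> N"
  proof (rule lborel_pair.AE_pair_measure)
    have [measurable]: "N \<in> sets borel" using N by auto
    show "{p \<in> space (lborel \<Otimes>\<^sub>M lborel). fst p \<notin> N \<and> snd p \<notin> N} \<in> sets (lborel \<Otimes>\<^sub>M lborel)"
      by measurable
    show "AE x in lborel. AE y in lborel. fst (x, y) \<notin> N \<and> snd (x, y) \<notin> N"
      using AEN
    proof eventually_elim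
      case (elim x)
      show ?case using AEN by eventually_elim (use elim in simp)
    qed
  qed
  have "2 * conv_form K ag g = conv_form K ag g - conv_form K g ag"
    using sw by simp
  also have "\<dots> = (\<integral>p. (case p of (x, y) \<Rightarrow> ag x * (K (x - y) * g y)) -
      (case p of (x, y) \<Rightarrow> g x * (K (x - y) * ag y)) \<partial>(lborel \<Otimes>\<^sub>M lborel))"
    unfolding e1 e2 by (rule Bochner_Integration.integral_diff[OF i1 i2, symmetric])
  finally have eq: "2 * conv_form K ag g = \<dots>" .
  have "\<bar>2 * conv_form K ag g\<bar> \<le> (\<integral>p. norm ((case p of (x, y) \<Rightarrow> ag x * (K (x - y) * g y)) -
      (case p of (x, y) \<Rightarrow> g x * (K (x - y) * ag y))) \<partial>(lborel \<Otimes>\<^sub>M lborel))"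
    unfolding eq real_norm_def[symmetric] by (rule integral_norm_bound)
  also have "\<dots> \<le> (\<integral>p. L * (case p of (x, y) \<Rightarrow> \<bar>g x\<bar> * (Z (x - y) * \<bar>g y\<bar>)) \<partial>(lborel \<Otimes>\<^sub>M lborel))"
  proof (rule integral_mono_AE)
    show "AE p in lborel \<Otimes>\<^sub>M lborel. norm ((case p of (x, y) \<Rightarrow> ag x * (K (x - y) * g y)) -
        (case p of (x, y) \<Rightarrow> g x * (K (x - y) * ag y)))
        \<le> L * (case p of (x, y) \<Rightarrow> \<bar>g x\<bar> * (Z (x - y) * \<bar>g y\<bar>))"
      using AE1
    proof eventually_elim
      case (elim p)
      obtain x y where p: "p = (x, y)" by (cases p)
      have "ag x * (K (x - y) * g y) - g x * (K (x - y) * ag y) = (a x - a y) * (g x * K (x - y) * g y)"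
        by (simp add: ag_def algebra_simps)
      then have "\<bar>ag x * (K (x - y) * g y) - g x * (K (x - y) * ag y)\<bar>
          = \<bar>a x - a y\<bar> * (\<bar>g x\<bar> * \<bar>K (x - y)\<bar> * \<bar>g y\<bar>)"
        by (simp add: abs_mult)
      also have "\<dots> \<le> (L * \<bar>x - y\<bar>) * (\<bar>g x\<bar> * \<bar>K (x - y)\<bar> * \<bar>g y\<bar>)"
        using lip[of x y] elim by (intro mult_right_mono) (auto simp: p)
      finally show ?case by (simp add: p Z_def abs_mult ac_simps)
    qed
  qed (rule integrable_norm[OF Bochner_Integration.integrable_diff[OF i1 i2]], use iz in simp)
  also have "\<dots> = L * conv_form Z (\<lambda>x. \<bar>g x\<bar>) (\<lambda>x. \<bar>g x\<bar>)"
    unfolding ez by simp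
  also have "\<dots> \<le> L * (L1_norm Z * L2_norm (\<lambda>x. \<bar>g x\<bar>) * L2_norm (\<lambda>x. \<bar>g x\<bar>))"
    using abs_conv_form_le[OF Z gabs gabs] L by (intro mult_left_mono) auto
  also have "\<dots> = L * L1_norm (\<lambda>z. z * K z) * (L2_norm g)\<^sup>2"
    by (simp add: Z_def L1_norm_def L2_norm_abs power2_eq_square)
  finally have "2 * \<bar>conv_form K ag g\<bar> \<le> L * L1_norm (\<lambda>z. z * K z) * (L2_norm g)\<^sup>2" by simp
  then show ?thesis unfolding ag_def by linarith
qed

section \<open>Test functions\<close>

lemma test_functions_iff:
  "\<phi> \<in> test_functions \<longleftrightarrow>
    (\<forall>n x. (deriv ^^ n) \<phi> field_differentiable (at x)) \<and> (\<exists>R. \<forall>x. R < \<bar>x\<bar> \<longrightarrow> \<phi> x = 0)"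
proof -
  have "bounded {x. \<phi> x \<noteq> 0} \<longleftrightarrow> (\<exists>R. \<forall>x. R < \<bar>x\<bar> \<longrightarrow> \<phi> x = 0)"
    unfolding bounded_iff using not_le by auto
  then show ?thesis by (simp add: test_functions_def)
qed

lemma funpow_deriv_eq:
  assumes "\<And>n x. (D n has_real_derivative D (Suc n) x) (at x)"
  shows "(deriv ^^ n) (D 0) = D n"
proof (induction n)
  case (Suc n)
  have "deriv (D n) = D (Suc n)" using assms by (auto intro!: DERIV_imp_deriv)
  then show ?case using Suc by simp
qed simp

text \<open>
  Giving all derivatives at once replaces the induction over iterated derivatives in the examples
  below: rescaled functions, convolutions and the bump function.
\<close>

lemma test_functionI:
  assumes D: "\<And>n x. (D n has_real_derivative D (Suc n) x) (at x)"
    and "\<And>x. R < \<bar>x\<bar> \<Longrightarrow> D 0 x = 0"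
  shows "D 0 \<in> test_functions"
proof -
  have "(deriv ^^ n) (D 0) field_differentiable (at x)" for n x
    unfolding funpow_deriv_eq[of D, OF D] using D by (auto simp: field_differentiable_def)
  then show ?thesis using assms(2) by (auto simp: test_functions_iff)
qed

lemma DERIV_test_function:
  "\<phi> \<in> test_functions \<Longrightarrow> ((deriv ^^ n) \<phi> has_real_derivative (deriv ^^ Suc n) \<phi> x) (at x)"
  by (simp add: test_functions_iff DERIV_deriv_iff_field_differentiable)

lemma test_function_deriv_support:
  assumes "\<phi> \<in> test_functions"
  shows "\<exists>R>0. \<forall>n x. R < \<bar>x\<bar> \<longrightarrow> (deriv ^^ n) \<phi> x = 0"
proof -
  obtain R0 where R0: "\<And>x. R0 < \<bar>x\<bar> \<Longrightarrow> \<phi> x = 0" using assms by (auto simp: test_functions_iff)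
  define R where "R = max R0 1"
  have "\<forall>x. R < \<bar>x\<bar> \<longrightarrow> (deriv ^^ n) \<phi> x = 0" for n
  proof (induction n)
    case 0 then show ?case using R0 by (auto simp: R_def)
  next
    case (Suc n)
    show ?case
    proof (intro allI impI)
      fix x :: real assume x: "R < \<bar>x\<bar>"
      have "open {y. R < \<bar>y\<bar>}" by (intro open_Collect_less continuous_intros)
      then have "eventually (\<lambda>y. (deriv ^^ n) \<phi> y = 0) (nhds x)"
        using Suc x by (auto simp: eventually_nhds)
      then have "deriv ((deriv ^^ n) \<phi>) x = deriv (\<lambda>_. 0) x"
        by (intro deriv_cong_ev refl)
      then show "(deriv ^^ Suc n) \<phi> x = 0" by simp
    qed
  qed
  then show ?thesis by (intro exI[of _ R]) (simp add: R_def)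
qed

lemma test_function_deriv:
  assumes "\<phi> \<in> test_functions" shows "(deriv ^^ n) \<phi> \<in> test_functions"
proof -
  obtain R where "\<And>n x. R < \<bar>x\<bar> \<Longrightarrow> (deriv ^^ n) \<phi> x = 0"
    using test_function_deriv_support[OF assms] by auto
  moreover have "((\<lambda>x. (deriv ^^ (m + n)) \<phi> x) has_real_derivative (deriv ^^ (Suc m + n)) \<phi> x) (at x)" for m x
    using DERIV_test_function[OF assms, of "m + n" x] by simp
  ultimately show ?thesis
    using test_functionI[of "\<lambda>m. (deriv ^^ (m + n)) \<phi>" R] by simp
qed

lemma test_function_deriv1: "\<phi> \<in> test_functions \<Longrightarrow> deriv \<phi> \<in> test_functions"
  using test_function_deriv[of \<phi> 1] by simp

lemma kernel_test_function: "\<phi> \<in> test_functions \<Longrightarrow> kernel \<phi>"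
proof -
  assume \<phi>: "\<phi> \<in> test_functions"
  have "continuous_on UNIV \<phi>"
    by (rule DERIV_continuous_on) (use DERIV_test_function[OF \<phi>, of 0] in auto)
  then show "kernel \<phi>" using \<phi> by (simp add: kernel_def test_functions_iff)
qed

lemmas kernel_deriv_test_function = kernel_test_function[OF test_function_deriv]

lemma
  assumes "\<phi> \<in> test_functions"
  shows test_function_reflect_shift: "(\<lambda>y. \<phi> (x - y)) \<in> test_functions"
    and deriv_reflect_shift: "(deriv ^^ n) (\<lambda>y. \<phi> (x - y)) = (\<lambda>y. (-1) ^ n * (deriv ^^ n) \<phi> (x - y))"
proof -
  define D where "D n = (\<lambda>y. (-1) ^ n * (deriv ^^ n) \<phi> (x - y))" for n
  have D: "(D n has_real_derivative D (Suc n) y) (at y)" for n y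
  proof -
    have "((\<lambda>y. (deriv ^^ n) \<phi> (x - y)) has_real_derivative (deriv ^^ Suc n) \<phi> (x - y) * (-1)) (at y)"
      by (rule DERIV_chain2[OF DERIV_test_function[OF assms]]) (auto intro!: derivative_eq_intros)
    from DERIV_cmult[OF this, of "(-1) ^ n"] show ?thesis by (simp add: D_def)
  qed
  have D0: "D 0 = (\<lambda>y. \<phi> (x - y))" by (simp add: D_def)
  obtain R where R: "\<And>n x. R < \<bar>x\<bar> \<Longrightarrow> (deriv ^^ n) \<phi> x = 0"
    using test_function_deriv_support[OF assms] by auto
  have "D 0 \<in> test_functions"
  proof (rule test_functionI[of D "R + \<bar>x\<bar>", OF D])
    fix y assume "R + \<bar>x\<bar> < \<bar>y\<bar>"
    then have "R < \<bar>x - y\<bar>" by linarith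
    then show "D 0 y = 0" using R[of "x - y" 0] by (simp add: D0)
  qed
  then show "(\<lambda>y. \<phi> (x - y)) \<in> test_functions" by (simp add: D0)
  show "(deriv ^^ n) (\<lambda>y. \<phi> (x - y)) = (\<lambda>y. (-1) ^ n * (deriv ^^ n) \<phi> (x - y))"
    using funpow_deriv_eq[of D, OF D, of n] unfolding D0 by (simp add: D_def)
qed

lemma deriv_parity:
  assumes "\<phi> \<in> test_functions" and even: "\<And>x. \<phi> (- x) = \<phi> x"
  shows "(deriv ^^ n) \<phi> (- x) = (-1) ^ n * (deriv ^^ n) \<phi> x"
proof -
  have "(\<lambda>y. \<phi> (0 - y)) = \<phi>" using even by simp
  then have "(deriv ^^ n) \<phi> (- x) = (-1) ^ n * (deriv ^^ n) \<phi> (0 - (- x))"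
    using deriv_reflect_shift[OF assms(1), of n 0] by metis
  then show ?thesis by simp
qed

lemma
  assumes "\<phi> \<in> test_functions" and "r > 0"
  shows test_function_scale: "(\<lambda>y. r * \<phi> (r * y)) \<in> test_functions"
    and deriv_scale: "(deriv ^^ n) (\<lambda>y. r * \<phi> (r * y)) = (\<lambda>y. r ^ Suc n * (deriv ^^ n) \<phi> (r * y))"
proof -
  define D where "D n = (\<lambda>y. r ^ Suc n * (deriv ^^ n) \<phi> (r * y))" for n
  have D: "(D n has_real_derivative D (Suc n) y) (at y)" for n y
  proof -
    have "((\<lambda>y. (deriv ^^ n) \<phi> (r * y)) has_real_derivative (deriv ^^ Suc n) \<phi> (r * y) * r) (at y)"
      by (rule DERIV_chain2[OF DERIV_test_function[OF assms(1)]]) (auto intro!: derivative_eq_intros)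
    from DERIV_cmult[OF this, of "r ^ Suc n"] show ?thesis by (simp add: D_def ac_simps)
  qed
  have D0: "D 0 = (\<lambda>y. r * \<phi> (r * y))" by (simp add: D_def)
  obtain R where R: "\<And>n x. R < \<bar>x\<bar> \<Longrightarrow> (deriv ^^ n) \<phi> x = 0"
    using test_function_deriv_support[OF assms(1)] by auto
  have "D 0 \<in> test_functions"
  proof (rule test_functionI[of D "R / r", OF D])
    fix x assume "R / r < \<bar>x\<bar>"
    then have "R < \<bar>r * x\<bar>" using assms(2) by (simp add: abs_mult field_simps)
    then show "D 0 x = 0" using R[of "r * x" 0] by (simp add: D0)
  qed
  then show "(\<lambda>y. r * \<phi> (r * y)) \<in> test_functions" by (simp add: D0)
  show "(deriv ^^ n) (\<lambda>y. r * \<phi> (r * y)) = (\<lambda>y. r ^ Suc n * (deriv ^^ n) \<phi> (r * y))"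
    using funpow_deriv_eq[of D, OF D, of n] unfolding D0 by (simp add: D_def)
qed

lemma DERIV_if_quadratic_bound:
  fixes F :: "real \<Rightarrow> real"
  assumes d: "d > 0" and bd: "\<And>h. \<bar>h\<bar> < d \<Longrightarrow> \<bar>F (x + h) - F x - h * D\<bar> \<le> C * h\<^sup>2"
  shows "(F has_real_derivative D) (at x)"
proof -
  have "((\<lambda>h. (F (x + h) - F x) / h - D) \<longlongrightarrow> 0) (at 0)"
  proof (rule tendsto_0_le[where K = 1])
    show "((\<lambda>h. C * h) \<longlongrightarrow> 0) (at 0)"
      by (auto intro!: tendsto_eq_intros)
    have "\<bar>(F (x + h) - F x) / h - D\<bar> \<le> \<bar>C * h\<bar>" if "h \<noteq> 0" "\<bar>h\<bar> < d" for h
    proof -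
      have "\<bar>(F (x + h) - F x) / h - D\<bar> = \<bar>F (x + h) - F x - h * D\<bar> / \<bar>h\<bar>"
        using that by (simp add: divide_simps flip: abs_divide) (simp add: algebra_simps)
      also have "\<dots> \<le> C * h\<^sup>2 / \<bar>h\<bar>" by (intro divide_right_mono bd that) simp
      also have "\<dots> = C * \<bar>h\<bar>"
      proof -
        have "C * h\<^sup>2 / \<bar>h\<bar> = C * (\<bar>h\<bar> * \<bar>h\<bar>) / \<bar>h\<bar>" by (simp add: power2_eq_square)
        also have "\<dots> = C * \<bar>h\<bar>" using that by (simp del: abs_mult_self_eq)
        finally show ?thesis .
      qed
      also have "\<dots> \<le> \<bar>C * h\<bar>" by (simp add: abs_mult mult_right_mono)
      finally show ?thesis .
    qed
    then show "\<forall>\<^sub>F h in at 0. norm ((F (x + h) - F x) / h - D) \<le> norm (C * h) * 1"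
      using d by (auto simp: eventually_at intro!: exI[of _ d])
  qed
  then show ?thesis
    by (subst DERIV_def) (simp add: LIM_zero_iff)
qed

lemma test_function_Lipschitz:
  assumes "\<phi> \<in> test_functions" and B: "\<And>x. \<bar>deriv \<phi> x\<bar> \<le> B"
  shows "\<bar>\<phi> x - \<phi> y\<bar> \<le> B * \<bar>x - y\<bar>"
  using field_differentiable_bound[of UNIV \<phi> "deriv \<phi>" B x y]
    DERIV_test_function[OF assms(1), of 0] B by simp

text \<open>
  For increments of size less than one, the first order Taylor remainder of \<open>K\<close> is quadratically small
  and vanishes outside a fixed bounded window, on which \<open>f\<close> is integrable.
\<close>

lemma DERIV_conv:
  assumes K: "K \<in> test_functions" and f: "f \<in> L2_space"
  shows "(conv K f has_real_derivative conv (deriv K) f x) (at x)"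
proof -
  obtain R where R: "R > 0" "\<And>n x. R < \<bar>x\<bar> \<Longrightarrow> (deriv ^^ n) K x = 0"
    using test_function_deriv_support[OF K] by auto
  note K1 = test_function_deriv1[OF K] and K2 = test_function_deriv1[OF test_function_deriv1[OF K]]
  obtain B where B: "B > 0" "\<And>x. \<bar>deriv (deriv K) x\<bar> \<le> B"
    using kernel_bounded[OF kernel_test_function[OF K2]] by blast
  have taylor: "\<bar>K (z + h) - K z - h * deriv K z\<bar> \<le> B * h\<^sup>2" for z h
  proof -
    let ?S = "{z - \<bar>h\<bar>..z + \<bar>h\<bar>}"
    have d: "((\<lambda>y. K y - y * deriv K z) has_field_derivative deriv K y - deriv K z) (at y within ?S)" for y
    proof -
      have "(K has_field_derivative deriv K y) (at y within ?S)"
        using DERIV_test_function[OF K, of 0 y] by (auto intro: has_field_derivative_at_within)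
      from DERIV_diff[OF this DERIV_cmult_right[OF DERIV_ident, where c = "deriv K z"]]
      show ?thesis by simp
    qed
    have b: "norm (deriv K y - deriv K z) \<le> B * \<bar>h\<bar>" if y: "y \<in> ?S" for y
    proof -
      have "\<bar>deriv K y - deriv K z\<bar> \<le> B * \<bar>y - z\<bar>"
        using test_function_Lipschitz[OF K1 B(2)] .
      also have "\<dots> \<le> B * \<bar>h\<bar>" using y B(1) by (intro mult_left_mono) auto
      finally show ?thesis by simp
    qed
    have S: "z + h \<in> ?S" "z \<in> ?S" "convex ?S" by auto
    have "norm ((K (z + h) - (z + h) * deriv K z) - (K z - z * deriv K z)) \<le> (B * \<bar>h\<bar>) * norm ((z + h) - z)"
      by (rule field_differentiable_bound[OF S(3) d b S(1) S(2)])
    then show ?thesis by (simp add: algebra_simps power2_eq_square)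
  qed
  let ?I = "indicator {x - (R + 1)..x + (R + 1)} :: real \<Rightarrow> real"
  have fi: "integrable lborel (\<lambda>y. ?I y * \<bar>f y\<bar>)"
    using integrable_indicator_L2[OF L2_abs[OF f]] by (simp add: set_integrable_def)
  show ?thesis
  proof (rule DERIV_if_quadratic_bound[of 1])
    fix h :: real assume h: "\<bar>h\<bar> < 1"
    let ?E = "\<lambda>y. K (x + h - y) - K (x - y) - h * deriv K (x - y)"
    have i: "integrable lborel (\<lambda>y. K (x + h - y) * f y)" "integrable lborel (\<lambda>y. K (x - y) * f y)"
       "integrable lborel (\<lambda>y. deriv K (x - y) * f y)"
      using K K1 f by (auto intro!: integrable_conv_integrand kernel_test_function)
    have "integrable lborel (\<lambda>y. K (x + h - y) * f y - K (x - y) * f y - h * (deriv K (x - y) * f y))"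
      by (intro Bochner_Integration.integrable_diff i Bochner_Integration.integrable_mult_right)
    then have iE: "integrable lborel (\<lambda>y. ?E y * f y)"
      by (simp only: left_diff_distrib mult.assoc)
    have eq: "conv K f (x + h) - conv K f x - h * conv (deriv K) f x = (\<integral>y. ?E y * f y \<partial>lborel)"
      using i by (simp add: conv_def left_diff_distrib mult.assoc)
    have "\<bar>conv K f (x + h) - conv K f x - h * conv (deriv K) f x\<bar> \<le> (\<integral>y. \<bar>?E y * f y\<bar> \<partial>lborel)"
      unfolding eq real_norm_def[symmetric] by (rule integral_norm_bound)
    also have "\<dots> \<le> (\<integral>y. (B * h\<^sup>2) * (?I y * \<bar>f y\<bar>) \<partial>lborel)"
    proof (rule integral_mono)
      show "integrable lborel (\<lambda>y. \<bar>?E y * f y\<bar>)" by (rule integrable_abs[OF iE])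
      show "integrable lborel (\<lambda>y. (B * h\<^sup>2) * (?I y * \<bar>f y\<bar>))" using fi by simp
      fix y
      show "\<bar>?E y * f y\<bar> \<le> (B * h\<^sup>2) * (?I y * \<bar>f y\<bar>)"
      proof (cases "y \<in> {x - (R + 1)..x + (R + 1)}")
        case True
        have "\<bar>?E y\<bar> \<le> B * h\<^sup>2" using taylor[of "x - y" h] by (simp add: algebra_simps)
        then have "\<bar>?E y\<bar> * \<bar>f y\<bar> \<le> (B * h\<^sup>2) * \<bar>f y\<bar>" by (rule mult_right_mono) simp
        then show ?thesis using True by (simp add: abs_mult)
      next
        case False
        then have "R < \<bar>x - y\<bar>" "R < \<bar>x + h - y\<bar>" using h by auto
        then have "K (x - y) = 0" "K (x + h - y) = 0" "deriv K (x - y) = 0"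
          using R(2)[of "x - y" 0] R(2)[of "x - y" 1] R(2)[of "x + h - y" 0] by auto
        then show ?thesis using B(1) by simp
      qed
    qed
    also have "\<dots> = (B * (\<integral>y. ?I y * \<bar>f y\<bar> \<partial>lborel)) * h\<^sup>2" by simp
    finally show "\<bar>conv K f (x + h) - conv K f x - h * conv (deriv K) f x\<bar>
        \<le> (B * (\<integral>y. ?I y * \<bar>f y\<bar> \<partial>lborel)) * h\<^sup>2" .
  qed simp
qed

lemma
  assumes K: "K \<in> test_functions" and f: "f \<in> L2_space"
  shows deriv_conv: "(deriv ^^ n) (conv K f) = conv ((deriv ^^ n) K) f"
    and test_function_conv: "(\<And>x. S < \<bar>x\<bar> \<Longrightarrow> f x = 0) \<Longrightarrow> conv K f \<in> test_functions"
proof -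
  define D where "D n = conv ((deriv ^^ n) K) f" for n
  have D: "(D n has_real_derivative D (Suc n) x) (at x)" for n x
    using DERIV_conv[OF test_function_deriv[OF K] f] by (simp add: D_def)
  have D0: "D 0 = conv K f" by (simp add: D_def)
  show "(deriv ^^ n) (conv K f) = conv ((deriv ^^ n) K) f"
    using funpow_deriv_eq[of D, OF D, of n] unfolding D0 by (simp add: D_def)
  assume S: "\<And>x. S < \<bar>x\<bar> \<Longrightarrow> f x = 0"
  obtain R where R: "\<And>n x. R < \<bar>x\<bar> \<Longrightarrow> (deriv ^^ n) K x = 0"
    using test_function_deriv_support[OF K] by auto
  have "D 0 \<in> test_functions"
  proof (rule test_functionI[of D "R + S", OF D])
    fix x assume x: "R + S < \<bar>x\<bar>"
    have "K (x - y) * f y = 0" for y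
    proof (cases "S < \<bar>y\<bar>")
      case False
      then have "R < \<bar>x - y\<bar>" using x by linarith
      then show ?thesis using R[of "x - y" 0] by simp
    qed (simp add: S)
    then have "(\<lambda>y. K (x - y) * f y) = (\<lambda>_. 0)" by (rule ext)
    then show "D 0 x = 0" by (simp add: D0 conv_def)
  qed
  then show "conv K f \<in> test_functions" by (simp add: D0)
qed

section \<open>A smooth bump function and its rescalings\<close>

text \<open>
  The derivatives of \<open>exp (- 1 / (1 - x\<^sup>2))\<close> are no longer of that form, but with a
  polynomial factor and a power of \<open>1 / (1 - x\<^sup>2)\<close> the family is closed under differentiation.
\<close>

definition bump_fun :: "real poly \<Rightarrow> nat \<Rightarrow> real \<Rightarrow> real" where
  "bump_fun p m x =
    (if \<bar>x\<bar> < 1 then poly p x * inverse (1 - x\<^sup>2) ^ m * exp (- inverse (1 - x\<^sup>2)) else 0)"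

definition bump_deriv_poly :: "real poly \<Rightarrow> nat \<Rightarrow> real poly" where
  "bump_deriv_poly p m = pderiv p * [:1, 0, -1:] ^ 2
     + smult (2 * real m) ([:0, 1:] * p * [:1, 0, -1:]) - smult 2 ([:0, 1:] * p)"

lemma one_minus_square_pos: "\<bar>x\<bar> < 1 \<Longrightarrow> 0 < 1 - (x::real)\<^sup>2"
  using abs_square_less_1[of x] by simp

text \<open>
  The exponential decay beats any power of \<open>1 / (1 - x\<^sup>2)\<close>, so the function vanishes quadratically at
  \<open>\<plusminus>1\<close>; in particular its derivative there is zero.
\<close>

lemma bump_fun_boundary_bound:
  assumes a: "\<bar>a\<bar> = (1::real)"
  obtains C where "\<And>x. \<bar>bump_fun p m x\<bar> \<le> C * (x - a)\<^sup>2"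
proof -
  have "compact (poly p ` {-1..1})"
    by (intro compact_continuous_image continuous_intros) auto
  then obtain P where P: "P > 0" "\<And>x. x \<in> {-1..1} \<Longrightarrow> \<bar>poly p x\<bar> \<le> P"
    by (auto dest!: compact_imp_bounded simp: bounded_pos)
  have "\<bar>bump_fun p m x\<bar> \<le> (P * fact (m + 2) * 4) * (x - a)\<^sup>2" for x
  proof (cases "\<bar>x\<bar> < 1")
    case True
    define y where "y = 1 - x\<^sup>2"
    have y: "y > 0" using one_minus_square_pos[OF True] by (simp add: y_def)
    define I where "I = inverse y"
    have I: "I > 0" using y by (simp add: I_def)
    have "I ^ (m + 2) / fact (m + 2) \<le> exp I"
      using I sum_le_suminf[OF summable_exp_generic[of I], of "{m + 2}"]
      by (auto simp: exp_def divide_inverse scaleR_conv_of_real ac_simps simp del: fact_Suc power_Suc)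
    then have "I ^ (m + 2) \<le> fact (m + 2) * exp I"
      by (simp add: divide_le_eq mult.commute del: fact_Suc power_Suc)
    then have "I ^ (m + 2) * exp (- I) \<le> fact (m + 2) * exp I * exp (- I)"
      by (rule mult_right_mono) simp
    then have "I ^ (m + 2) * exp (- I) \<le> fact (m + 2)"
      by (simp add: mult.assoc exp_add[symmetric] del: fact_Suc power_Suc)
    then have 0: "I ^ (m + 2) * exp (- I) * y\<^sup>2 \<le> fact (m + 2) * y\<^sup>2"
      by (rule mult_right_mono) simp
    have "I ^ (m + 2) * y\<^sup>2 = I ^ m"
    proof -
      have "I ^ (m + 2) * y\<^sup>2 = I ^ m * (I * y)\<^sup>2" by (simp add: power_add power_mult_distrib power2_eq_square)
      then show ?thesis using y by (simp add: I_def)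
    qed
    then have "I ^ m * exp (- I) = I ^ (m + 2) * exp (- I) * y\<^sup>2"
      by (simp only: mult.commute mult.left_commute)
    with 0 have 1: "I ^ m * exp (- I) \<le> fact (m + 2) * y\<^sup>2" by (simp only:)
    have "y = \<bar>x - a\<bar> * \<bar>x + a\<bar>"
    proof -
      have "a\<^sup>2 = 1" using a by (metis power2_abs one_power2)
      then have "\<bar>x - a\<bar> * \<bar>x + a\<bar> = \<bar>x\<^sup>2 - 1\<bar>"
        by (simp add: abs_mult[symmetric] algebra_simps power2_eq_square)
      then show ?thesis using y by (simp add: y_def)
    qed
    also have "\<dots> \<le> \<bar>x - a\<bar> * 2" using True a by (intro mult_left_mono) auto
    finally have "y\<^sup>2 \<le> (\<bar>x - a\<bar> * 2)\<^sup>2" using y by (intro power_mono) auto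
    then have 2: "y\<^sup>2 \<le> 4 * (x - a)\<^sup>2" by (simp add: power_mult_distrib)
    have "\<bar>bump_fun p m x\<bar> = \<bar>poly p x\<bar> * (I ^ m * exp (- I))"
      using True I by (simp add: bump_fun_def I_def y_def abs_mult power_abs)
    also have "\<dots> \<le> P * (fact (m + 2) * y\<^sup>2)"
      using P(1) P(2)[of x] True I by (intro mult_mono[OF _ 1]) (auto simp: abs_less_iff)
    also have "\<dots> \<le> P * (fact (m + 2) * (4 * (x - a)\<^sup>2))"
      using P by (intro mult_left_mono 2) auto
    finally show ?thesis by (simp add: ac_simps del: fact_Suc)
  next
    case False
    then show ?thesis using P by (simp add: bump_fun_def del: fact_Suc)
  qed
  then show ?thesis by (rule that)
qed

lemma DERIV_bump_fun:
  "(bump_fun p m has_real_derivative bump_fun (bump_deriv_poly p m) (m + 2) x) (at x)"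
proof -
  consider "\<bar>x\<bar> < 1" | "\<bar>x\<bar> = 1" | "\<bar>x\<bar> > 1" by linarith
  then show ?thesis
  proof cases
    case 1
    define Y where "Y = 1 - x\<^sup>2"
    have Y: "Y > 0" using one_minus_square_pos[OF 1] by (simp add: Y_def)
    have Y0: "1 - x\<^sup>2 \<noteq> 0" using Y by (simp add: Y_def)
    let ?F = "\<lambda>x. poly p x * inverse (1 - x\<^sup>2) ^ m * exp (- inverse (1 - x\<^sup>2))"
    have dI: "((\<lambda>x. inverse (1 - x\<^sup>2)) has_real_derivative 2 * x * (inverse Y)\<^sup>2) (at x)"
      using Y0 by (auto intro!: derivative_eq_intros simp: Y_def power2_eq_square)
    have dIm: "((\<lambda>x. inverse (1 - x\<^sup>2) ^ m) has_real_derivative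
        real m * (2 * x) * inverse Y ^ (m + 1)) (at x)"
    proof -
      have eq: "real m * (2 * x * (inverse Y)\<^sup>2 * inverse Y ^ (m - Suc 0)) = real m * (2 * x) * inverse Y ^ (m + 1)"
        by (cases m) (simp_all add: power2_eq_square)
      show ?thesis using DERIV_power[OF dI, of m] unfolding Y_def[symmetric] eq .
    qed
    have dE: "((\<lambda>x. exp (- inverse (1 - x\<^sup>2))) has_real_derivative
        - (2 * x * (inverse Y)\<^sup>2) * exp (- inverse Y)) (at x)"
      using DERIV_chain2[OF DERIV_exp DERIV_minus[OF dI]] by (simp add: Y_def ac_simps)
    have "(?F has_real_derivative
        (poly (pderiv p) x * inverse Y ^ m + real m * (2 * x) * inverse Y ^ (m + 1) * poly p x) * exp (- inverse Y)
        + - (2 * x * (inverse Y)\<^sup>2) * exp (- inverse Y) * (poly p x * inverse Y ^ m)) (at x)"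
      using DERIV_mult[OF DERIV_mult[OF poly_DERIV dIm] dE] unfolding Y_def .
    also have "(poly (pderiv p) x * inverse Y ^ m + real m * (2 * x) * inverse Y ^ (m + 1) * poly p x) * exp (- inverse Y)
        + - (2 * x * (inverse Y)\<^sup>2) * exp (- inverse Y) * (poly p x * inverse Y ^ m)
        = bump_fun (bump_deriv_poly p m) (m + 2) x"
    proof -
      have P: "poly (bump_deriv_poly p m) x
          = poly (pderiv p) x * Y\<^sup>2 + 2 * real m * x * poly p x * Y - 2 * x * poly p x"
        by (simp add: bump_deriv_poly_def Y_def power2_eq_square algebra_simps)
      have key: "(p' * W + c * (2 * x) * (Z * W) * q) * e + - (2 * x * Z\<^sup>2) * e * (q * W)
          = (p' * Y\<^sup>2 + 2 * c * x * q * Y - 2 * x * q) * (W * (Z * Z)) * e"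
        if "Y * Z = 1" for p' W c Z q e :: real
        using that by algebra
      have YZ: "Y * inverse Y = 1" using Y by simp
      show ?thesis
        using key[OF YZ, of "poly (pderiv p) x" "inverse Y ^ m" "real m" "poly p x" "exp (- inverse Y)"] 1
        unfolding bump_fun_def P Y_def[symmetric] by (simp add: power_add)
    qed
    finally have F: "(?F has_real_derivative bump_fun (bump_deriv_poly p m) (m + 2) x) (at x)" .
    show ?thesis
      by (rule has_field_derivative_transform_within_open[OF F, of "{-1<..<1}"])
        (use 1 in \<open>auto simp: bump_fun_def abs_less_iff\<close>)
  next
    case 2
    obtain C where C: "\<And>y. \<bar>bump_fun p m y\<bar> \<le> C * (y - x)\<^sup>2"
      using bump_fun_boundary_bound[OF 2] by blast
    have "(bump_fun p m has_real_derivative 0) (at x)"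
      by (rule DERIV_if_quadratic_bound[of 1 _ _ _ C])
        (use 2 C[of "x + _"] in \<open>auto simp: bump_fun_def[of p m x]\<close>)
    then show ?thesis using 2 by (simp add: bump_fun_def)
  next
    case 3
    have op: "open {y::real. 1 < \<bar>y\<bar>}" by (intro open_Collect_less continuous_intros)
    have "((\<lambda>_. 0) has_real_derivative 0) (at x)" by simp
    from has_field_derivative_transform_within_open[OF this op, of "bump_fun p m"] 3
    show ?thesis by (simp add: bump_fun_def)
  qed
qed

definition bump :: "real \<Rightarrow> real" where
  "bump x = bump_fun 1 0 x / (\<integral>y. bump_fun 1 0 y \<partial>lborel)"

lemma test_function_bump_fun: "bump_fun 1 0 \<in> test_functions"
proof -
  define s where "s = rec_nat (1 :: real poly, 0 :: nat) (\<lambda>_ (p, m). (bump_deriv_poly p m, m + 2))"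
  define D where "D n = bump_fun (fst (s n)) (snd (s n))" for n
  have "(D n has_real_derivative D (Suc n) x) (at x)" for n x
    using DERIV_bump_fun by (simp add: D_def s_def split_beta)
  then have "D 0 \<in> test_functions"
    by (rule test_functionI[where R = 1]) (simp add: D_def bump_fun_def)
  then show ?thesis by (simp add: D_def s_def)
qed

lemma integral_bump_fun_pos: "0 < (\<integral>y. bump_fun 1 0 y \<partial>lborel)"
proof -
  have "0 < (\<integral>y. exp (- 4 / 3 :: real) * indicator {-1/2..1/2::real} y \<partial>lborel)" by simp
  also have "\<dots> \<le> (\<integral>y. bump_fun 1 0 y \<partial>lborel)"
  proof (rule integral_mono)
    show "integrable lborel (bump_fun 1 0)"
      by (intro kernel_integrable kernel_test_function test_function_bump_fun)
    fix y :: real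
    show "exp (- 4 / 3) * indicator {-1/2..1/2} y \<le> bump_fun 1 0 y"
    proof (cases "y \<in> {-1/2..1/2}")
      case True
      then have y: "\<bar>y\<bar> \<le> 1/2" by auto
      then have "\<bar>y\<bar>\<^sup>2 \<le> (1/2)\<^sup>2" by (intro power_mono) auto
      then have "3/4 \<le> 1 - y\<^sup>2" by (simp add: power2_eq_square)
      then have "inverse (1 - y\<^sup>2) \<le> inverse (3/4)" by (intro le_imp_inverse_le) auto
      then show ?thesis using True y by (simp add: bump_fun_def)
    next
      case False
      then show ?thesis by (simp add: bump_fun_def)
    qed
  qed simp
  finally show ?thesis .
qed

definition mollifier :: "real \<Rightarrow> real \<Rightarrow> real" where
  "mollifier r x = r * bump (r * x)"

lemma test_function_bump: "bump \<in> test_functions"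
proof -
  define c where "c = inverse (\<integral>y. bump_fun 1 0 y \<partial>lborel)"
  define D where "D n = (\<lambda>x. c * (deriv ^^ n) (bump_fun 1 0) x)" for n
  have D: "(D n has_real_derivative D (Suc n) x) (at x)" for n x
    unfolding D_def by (intro DERIV_cmult DERIV_test_function test_function_bump_fun)
  have "D 0 = bump" by (simp add: D_def bump_def fun_eq_iff c_def divide_inverse)
  moreover have "D 0 \<in> test_functions"
    by (rule test_functionI[of D 1, OF D]) (simp add: D_def bump_fun_def)
  ultimately show ?thesis by simp
qed

lemma bump_nonneg: "0 \<le> bump x"
  using integral_bump_fun_pos by (simp add: bump_def bump_fun_def)

lemma integral_bump: "(\<integral>x. bump x \<partial>lborel) = 1"
  using integral_bump_fun_pos by (simp add: bump_def[abs_def])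

lemma bump_support: "1 \<le> \<bar>x\<bar> \<Longrightarrow> bump x = 0"
  by (simp add: bump_def bump_fun_def)

lemma test_function_mollifier: "r > 0 \<Longrightarrow> mollifier r \<in> test_functions"
  using test_function_scale[OF test_function_bump, of r] by (simp add: mollifier_def[abs_def])

lemma kernel_mollifier: "r > 0 \<Longrightarrow> kernel (mollifier r)"
  by (rule kernel_test_function[OF test_function_mollifier])

lemma mollifier_even: "mollifier r (- x) = mollifier r x"
  by (simp add: mollifier_def bump_def bump_fun_def)

lemma mollifier_nonneg: "r > 0 \<Longrightarrow> 0 \<le> mollifier r x"
  by (simp add: mollifier_def bump_nonneg)

lemma mollifier_support: "r > 0 \<Longrightarrow> 1 / r \<le> \<bar>x\<bar> \<Longrightarrow> mollifier r x = 0"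
  by (simp add: mollifier_def bump_support abs_mult field_simps)

lemma integral_scale: "r > 0 \<Longrightarrow> (\<integral>x. r * f (r * x) \<partial>lborel) = (\<integral>x. f x \<partial>lborel)" for f :: "real \<Rightarrow> real"
  using lborel_integral_real_affine[of r f 0] by simp

lemma integral_mollifier: "r > 0 \<Longrightarrow> (\<integral>x. mollifier r x \<partial>lborel) = 1"
  using integral_scale[of r bump] by (simp add: mollifier_def[abs_def] integral_bump)

lemma L1_norm_mollifier: "r > 0 \<Longrightarrow> L1_norm (mollifier r) = 1"
  by (simp add: L1_norm_def mollifier_nonneg integral_mollifier)

text \<open>
  The first moment of the derivative is what the commutator estimate sees of the kernel. Its scale
  invariance makes that estimate uniform as the mollifier concentrates.
\<close>

lemma L1_norm_moment_deriv_mollifier: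
  assumes "r > 0"
  shows "L1_norm (\<lambda>z. z * deriv (mollifier r) z) = L1_norm (\<lambda>z. z * deriv bump z)"
proof -
  have "deriv (mollifier r) = (\<lambda>z. r\<^sup>2 * deriv bump (r * z))"
    using deriv_scale[OF test_function_bump assms, of 1]
    by (simp add: mollifier_def[abs_def] power2_eq_square)
  then have "L1_norm (\<lambda>z. z * deriv (mollifier r) z) = (\<integral>z. r * \<bar>(r * z) * deriv bump (r * z)\<bar> \<partial>lborel)"
    using assms by (simp add: L1_norm_def abs_mult power2_eq_square ac_simps)
  also have "\<dots> = L1_norm (\<lambda>z. z * deriv bump z)"
    using integral_scale[OF assms, of "\<lambda>z. \<bar>z * deriv bump z\<bar>"] by (simp add: L1_norm_def)
  finally show ?thesis .
qed

section \<open>Mollification in \<open>L\<^sup>2\<close>\<close>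

lemma L2_dominated_convergence:
  assumes f: "\<And>n. f n \<in> borel_measurable borel" and g: "g \<in> borel_measurable borel"
    and h: "h \<in> L2_space" and lim: "AE x in lborel. (\<lambda>n. f n x) \<longlonglongrightarrow> g x"
    and bd: "\<And>n. AE x in lborel. \<bar>f n x - g x\<bar> \<le> h x"
  shows "(\<lambda>n. L2_norm (\<lambda>x. f n x - g x)) \<longlonglongrightarrow> 0"
proof -
  have "(\<lambda>n. \<integral>x. (f n x - g x)\<^sup>2 \<partial>lborel) \<longlonglongrightarrow> (\<integral>(x::real). (0 :: real) \<partial>lborel)"
  proof (rule integral_dominated_convergence[where w = "\<lambda>x. (h x)\<^sup>2"])
    show "integrable lborel (\<lambda>x. (h x)\<^sup>2)" using h by (rule integrable_square_L2)
    show "AE x in lborel. (\<lambda>n. (f n x - g x)\<^sup>2) \<longlonglongrightarrow> 0"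
      using lim
    proof eventually_elim
      case (elim x)
      then have "(\<lambda>n. f n x - g x) \<longlonglongrightarrow> 0" by (simp add: LIM_zero)
      from tendsto_power[OF this, of 2] show ?case by simp
    qed
    show "AE x in lborel. norm ((f n x - g x)\<^sup>2) \<le> (h x)\<^sup>2" for n
      using bd[of n]
    proof eventually_elim
      case (elim x)
      then have "\<bar>f n x - g x\<bar>\<^sup>2 \<le> (h x)\<^sup>2" by (intro power_mono) auto
      then show ?case by simp
    qed
  qed (use f g in auto)
  then have "(\<lambda>n. sqrt (\<integral>x. (f n x - g x)\<^sup>2 \<partial>lborel)) \<longlonglongrightarrow> sqrt 0"
    by (intro tendsto_real_sqrt) simp
  then show ?thesis by (simp add: L2_norm_def)
qed

lemma L2_tendsto_AE_subseq:
  assumes f: "\<And>n. f n \<in> L2_space" and g: "g \<in> L2_space"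
    and lim: "(\<lambda>n. L2_norm (\<lambda>x. f n x - g x)) \<longlonglongrightarrow> 0"
  obtains r :: "nat \<Rightarrow> nat" where "strict_mono r" "AE x in lborel. (\<lambda>n. f (r n) x) \<longlonglongrightarrow> g x"
proof -
  have i: "integrable lborel (\<lambda>x. (f n x - g x)\<^sup>2)" for n
    by (intro integrable_square_L2 L2_diff f g)
  have "(\<lambda>n. (L2_norm (\<lambda>x. f n x - g x))\<^sup>2) \<longlonglongrightarrow> 0\<^sup>2"
    by (intro tendsto_power lim)
  then have "(\<lambda>n. \<integral>x. norm ((f n x - g x)\<^sup>2) \<partial>lborel) \<longlonglongrightarrow> 0"
    by (simp add: L2_norm_square)
  from tendsto_L1_AE_subseq[OF i this] obtain r :: "nat \<Rightarrow> nat" where r: "strict_mono r"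
    and ae: "AE x in lborel. (\<lambda>n. (f (r n) x - g x)\<^sup>2) \<longlonglongrightarrow> 0" by blast
  have "AE x in lborel. (\<lambda>n. f (r n) x) \<longlonglongrightarrow> g x"
    using ae
  proof eventually_elim
    case (elim x)
    have "(\<lambda>n. sqrt ((f (r n) x - g x)\<^sup>2)) \<longlonglongrightarrow> sqrt 0" by (intro tendsto_real_sqrt elim)
    then have "(\<lambda>n. \<bar>f (r n) x - g x\<bar>) \<longlonglongrightarrow> 0" by simp
    then show ?case by (simp add: LIM_zero_iff tendsto_rabs_zero_iff)
  qed
  with r show ?thesis by (rule that)
qed

definition cutoff :: "real \<Rightarrow> real \<Rightarrow> real" where
  "cutoff M x = max 0 (min 1 (M + 1 - \<bar>x\<bar>))"

definition clamp_abs :: "real \<Rightarrow> real \<Rightarrow> real" where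
  "clamp_abs M y = max (- M) (min M y)"

lemma kernel_cutoff: "kernel (cutoff M)"
proof -
  have "continuous_on UNIV (cutoff M)" unfolding cutoff_def[abs_def] by (intro continuous_intros)
  moreover have "\<forall>x. M + 1 < \<bar>x\<bar> \<longrightarrow> cutoff M x = 0" by (auto simp: cutoff_def)
  ultimately show ?thesis by (auto simp: kernel_def)
qed

lemma cutoff_bounds: "0 \<le> cutoff M x" "cutoff M x \<le> 1" by (auto simp: cutoff_def)

text \<open>
  A measurable function is almost everywhere a limit of continuous functions. Bounding values and support,
  first of the limit and then of the approximants, makes dominated convergence applicable.
\<close>

lemma L2_dense_kernel:
  assumes f: "f \<in> L2_space" and e: "e > 0"
  obtains g where "kernel g" "L2_norm (\<lambda>x. f x - g x) < e"
proof -
  have fm: "f \<in> borel_measurable borel" using f by (rule borel_measurable_L2)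
  have "f \<in> borel_measurable lebesgue" using fm by (simp add: measurable_completion)
  then have "f measurable_on UNIV" by (intro lebesgue_measurable_imp_measurable_on_real) auto
  then obtain N g where N: "negligible N" and g: "\<And>n. continuous_on UNIV (g n :: real \<Rightarrow> real)"
    and lim: "\<And>x. x \<notin> N \<Longrightarrow> (\<lambda>n. g n x) \<longlonglongrightarrow> f x"
    by (auto simp: measurable_on_def)
  have clamp_cont: "continuous_on UNIV (clamp_abs M)" for M
    unfolding clamp_abs_def[abs_def] by (intro continuous_intros)
  have cm: "clamp_abs M \<in> borel_measurable borel" "cutoff M \<in> borel_measurable borel" for M
    using clamp_cont kernel_measurable[OF kernel_cutoff] by (auto intro: borel_measurable_continuous_onI)
  define F where "F n = (\<lambda>x. cutoff (real n) x * clamp_abs (real n) (f x))" for n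
  have Fm: "F n \<in> borel_measurable borel" for n
    unfolding F_def using fm cm(1)[of "real n"] cm(2)[of "real n"] by measurable
  have "(\<lambda>n. L2_norm (\<lambda>x. F n x - f x)) \<longlonglongrightarrow> 0"
  proof (rule L2_dominated_convergence[OF Fm fm])
    show "(\<lambda>x. 2 * \<bar>f x\<bar>) \<in> L2_space" by (intro L2_cmult L2_abs f)
    have "(\<lambda>n. F n x) \<longlonglongrightarrow> f x" for x
    proof (rule tendsto_eventually)
      obtain M :: nat where M: "\<bar>x\<bar> + \<bar>f x\<bar> \<le> real M" using real_arch_simple by blast
      show "eventually (\<lambda>n. F n x = f x) sequentially"
        using eventually_ge_at_top[of M]
      proof eventually_elim
        case (elim n)
        then have "\<bar>x\<bar> \<le> real n" "\<bar>f x\<bar> \<le> real n" using M by linarith+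
        then show ?case by (auto simp: F_def cutoff_def clamp_abs_def max_def min_def)
      qed
    qed
    then show "AE x in lborel. (\<lambda>n. F n x) \<longlonglongrightarrow> f x" by simp
    have "\<bar>F n x - f x\<bar> \<le> 2 * \<bar>f x\<bar>" for n x
    proof -
      have "\<bar>clamp_abs (real n) (f x)\<bar> \<le> \<bar>f x\<bar>" by (auto simp: clamp_abs_def)
      then have "cutoff (real n) x * \<bar>clamp_abs (real n) (f x)\<bar> \<le> 1 * \<bar>f x\<bar>"
        by (intro mult_mono) (auto simp: cutoff_bounds)
      then have "\<bar>F n x\<bar> \<le> \<bar>f x\<bar>" by (simp add: F_def abs_mult cutoff_bounds)
      then show ?thesis by linarith
    qed
    then show "AE x in lborel. \<bar>F n x - f x\<bar> \<le> 2 * \<bar>f x\<bar>" for n by simp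
  qed
  then have "eventually (\<lambda>n. L2_norm (\<lambda>x. F n x - f x) < e / 2) sequentially"
    using e by (intro order_tendstoD) auto
  then obtain M where M: "L2_norm (\<lambda>x. F M x - f x) < e / 2"
    by (auto simp: eventually_sequentially)
  define G where "G n = (\<lambda>x. clamp_abs (real M) (g n x) * cutoff (real M) x)" for n
  have Gk: "kernel (G n)" for n
    unfolding G_def by (intro kernel_mult kernel_cutoff continuous_on_compose2[OF clamp_cont g]) auto
  have FM: "F M \<in> L2_space"
    unfolding F_def
    by (subst mult.commute, rule L2_mult_bounded(1)[where B = "real M"])
      (use kernel_L2[OF kernel_cutoff] cm fm in \<open>auto simp: clamp_abs_def\<close>)
  have "(\<lambda>n. L2_norm (\<lambda>x. G n x - F M x)) \<longlonglongrightarrow> 0"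
  proof (rule L2_dominated_convergence[OF kernel_measurable[OF Gk] Fm])
    show "(\<lambda>x. (2 * real M) * cutoff (real M) x) \<in> L2_space"
      by (intro L2_cmult kernel_L2 kernel_cutoff)
    have "N \<in> null_sets lebesgue" using N by (simp add: negligible_iff_null_sets)
    then have ae: "AE x in lborel. x \<notin> N"
      using AE_not_in[of N lebesgue] by (simp add: AE_completion_iff)
    show "AE x in lborel. (\<lambda>n. G n x) \<longlonglongrightarrow> F M x"
      using ae
    proof eventually_elim
      case (elim x)
      have "isCont (clamp_abs (real M)) (f x)"
        using clamp_cont by (simp add: continuous_on_eq_continuous_at)
      from isCont_tendsto_compose[OF this lim[OF elim]]
      show ?case unfolding G_def F_def by (subst mult.commute) (intro tendsto_intros)
    qed
    have "\<bar>G n x - F M x\<bar> \<le> (2 * real M) * cutoff (real M) x" for n x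
    proof -
      have "\<bar>clamp_abs (real M) (g n x) - clamp_abs (real M) (f x)\<bar> \<le> 2 * real M"
        by (auto simp: clamp_abs_def)
      then have "\<bar>clamp_abs (real M) (g n x) - clamp_abs (real M) (f x)\<bar> * cutoff (real M) x
          \<le> (2 * real M) * cutoff (real M) x"
        by (rule mult_right_mono) (rule cutoff_bounds)
      moreover have "G n x - F M x = (clamp_abs (real M) (g n x) - clamp_abs (real M) (f x)) * cutoff (real M) x"
        by (simp add: G_def F_def algebra_simps)
      ultimately show ?thesis by (simp add: abs_mult cutoff_bounds)
    qed
    then show "AE x in lborel. \<bar>G n x - F M x\<bar> \<le> (2 * real M) * cutoff (real M) x" for n by simp
  qed
  then have "eventually (\<lambda>n. L2_norm (\<lambda>x. G n x - F M x) < e / 2) sequentially"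
    using e by (intro order_tendstoD) auto
  then obtain n where n: "L2_norm (\<lambda>x. G n x - F M x) < e / 2"
    by (auto simp: eventually_sequentially)
  have "L2_norm (\<lambda>x. f x - G n x) \<le> L2_norm (\<lambda>x. f x - F M x) + L2_norm (\<lambda>x. F M x - G n x)"
    by (intro L2_norm_triangle_diff f FM kernel_L2 Gk)
  also have "\<dots> < e" using M n L2_norm_commute[of f "F M"] L2_norm_commute[of "F M" "G n"] by linarith
  finally show ?thesis by (rule that[OF Gk])
qed

definition mollify :: "nat \<Rightarrow> (real \<Rightarrow> real) \<Rightarrow> real \<Rightarrow> real" where
  "mollify n = conv (mollifier (real (Suc n)))"

lemma mollify_L2:
  assumes "f \<in> L2_space" shows "mollify n f \<in> L2_space" "L2_norm (mollify n f) \<le> L2_norm f"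
  using conv_L2[OF kernel_mollifier[of "real (Suc n)"] assms] L1_norm_mollifier[of "real (Suc n)"]
  by (auto simp: mollify_def)

lemma integrable_mollifier_shift: "r > 0 \<Longrightarrow> integrable lborel (\<lambda>y. mollifier r (x - y))"
  by (intro kernel_integrable kernel_reflect_shift kernel_mollifier)

lemma integral_mollifier_shift: "r > 0 \<Longrightarrow> (\<integral>y. mollifier r (x - y) \<partial>lborel) = 1"
  using integral_reflect_shift[of "mollifier r" x] by (simp add: integral_mollifier)

lemma abs_conv_mollifier_le:
  assumes r: "r > 0" and f: "f \<in> L2_space" and bd: "AE y in lborel. \<bar>f y\<bar> \<le> B"
  shows "\<bar>conv (mollifier r) f x\<bar> \<le> B"
proof -
  have i: "integrable lborel (\<lambda>y. mollifier r (x - y) * f y)"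
    by (intro integrable_conv_integrand kernel_mollifier r f)
  have "\<bar>conv (mollifier r) f x\<bar> \<le> (\<integral>y. \<bar>mollifier r (x - y) * f y\<bar> \<partial>lborel)"
    unfolding conv_def real_norm_def[symmetric] by (rule integral_norm_bound)
  also have "\<dots> \<le> (\<integral>y. mollifier r (x - y) * B \<partial>lborel)"
  proof (rule integral_mono_AE)
    show "AE y in lborel. \<bar>mollifier r (x - y) * f y\<bar> \<le> mollifier r (x - y) * B"
      using bd by eventually_elim (use r in \<open>simp add: abs_mult mollifier_nonneg mult_left_mono\<close>)
  qed (use i r in \<open>auto intro: integrable_mollifier_shift\<close>)
  also have "\<dots> = B" using r by (simp add: integral_mollifier_shift)
  finally show ?thesis .
qed

lemma mollify_tendsto_pointwise:
  assumes g: "kernel g" shows "(\<lambda>n. mollify n g x) \<longlonglongrightarrow> g x"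
proof (rule LIMSEQ_I)
  fix e :: real assume e: "0 < e"
  have "isCont g x" using g by (simp add: kernel_def continuous_on_eq_continuous_at)
  then obtain d where d: "d > 0" "\<And>y. dist y x < d \<Longrightarrow> dist (g y) (g x) < e / 2"
    unfolding continuous_at_eps_delta using e by (metis half_gt_zero)
  obtain n0 :: nat where n0: "1 / d < real n0" using reals_Archimedean2 by blast
  have "norm (mollify n g x - g x) < e" if n: "n \<ge> n0" for n
  proof -
    let ?r = "real (Suc n)"
    have r: "?r > 0" by simp
    have rd: "1 / ?r < d"
    proof -
      have "1 / d < ?r" using n0 n by linarith
      then show ?thesis using d by (simp add: field_simps)
    qed
    note im = integrable_mollifier_shift[OF r, of x]
    have ic: "integrable lborel (\<lambda>y. mollifier ?r (x - y) * g y)"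
      by (intro integrable_conv_integrand kernel_mollifier kernel_L2 r g)
    have eq: "mollify n g x - g x = (\<integral>y. mollifier ?r (x - y) * (g y - g x) \<partial>lborel)"
      using ic im integral_mollifier_shift[OF r, of x]
      by (simp add: mollify_def conv_def right_diff_distrib del: of_nat_Suc)
    have "\<bar>mollify n g x - g x\<bar> \<le> (\<integral>y. \<bar>mollifier ?r (x - y) * (g y - g x)\<bar> \<partial>lborel)"
      unfolding eq real_norm_def[symmetric] by (rule integral_norm_bound)
    also have "\<dots> \<le> (\<integral>y. mollifier ?r (x - y) * (e / 2) \<partial>lborel)"
    proof (rule integral_mono)
      have "integrable lborel (\<lambda>y. mollifier ?r (x - y) * g y - mollifier ?r (x - y) * g x)"
        by (intro Bochner_Integration.integrable_diff ic integrable_mult_left im)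
      then show "integrable lborel (\<lambda>y. \<bar>mollifier ?r (x - y) * (g y - g x)\<bar>)"
        by (intro integrable_abs) (simp only: right_diff_distrib)
      show "integrable lborel (\<lambda>y. mollifier ?r (x - y) * (e / 2))"
        by (intro integrable_mult_left im)
      fix y
      show "\<bar>mollifier ?r (x - y) * (g y - g x)\<bar> \<le> mollifier ?r (x - y) * (e / 2)"
      proof (cases "1 / ?r \<le> \<bar>x - y\<bar>")
        case True then show ?thesis using mollifier_support[OF r, of "x - y"] by simp
      next
        case False
        then have "dist y x < d" using rd by (simp add: dist_real_def abs_minus_commute)
        then have "\<bar>g y - g x\<bar> \<le> e / 2" using d(2)[of y] by (simp add: dist_real_def)
        then show ?thesis using mollifier_nonneg[OF r, of "x - y"]
          by (simp only: abs_mult abs_of_nonneg mult_left_mono)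
      qed
    qed
    also have "\<dots> = e / 2" using integral_mollifier_shift[OF r, of x] by simp
    finally show ?thesis using e by simp
  qed
  then show "\<exists>no. \<forall>n\<ge>no. norm (mollify n g x - g x) < e" by blast
qed

lemma mollify_tendsto_kernel:
  assumes g: "kernel g" shows "(\<lambda>n. L2_norm (\<lambda>x. mollify n g x - g x)) \<longlonglongrightarrow> 0"
proof -
  obtain R where R: "R > 0" "\<And>x. R < \<bar>x\<bar> \<Longrightarrow> g x = 0" using kernel_support[OF g] by blast
  obtain B where B: "B > 0" "\<And>x. \<bar>g x\<bar> \<le> B" using kernel_bounded[OF g] by blast
  have g2: "g \<in> L2_space" by (rule kernel_L2[OF g])
  show ?thesis
  proof (rule L2_dominated_convergence)
    show "mollify n g \<in> borel_measurable borel" for n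
      using mollify_L2(1)[OF g2] by (rule borel_measurable_L2)
    show "g \<in> borel_measurable borel" by (rule kernel_measurable[OF g])
    show "(\<lambda>x. (2 * B) * cutoff (R + 1) x) \<in> L2_space" by (intro L2_cmult kernel_L2 kernel_cutoff)
    show "AE x in lborel. (\<lambda>n. mollify n g x) \<longlonglongrightarrow> g x"
      using mollify_tendsto_pointwise[OF g] by simp
    have "\<bar>mollify n g x - g x\<bar> \<le> (2 * B) * cutoff (R + 1) x" for n x
    proof (cases "\<bar>x\<bar> \<le> R + 1")
      case True
      have "\<bar>mollify n g x\<bar> \<le> B"
        unfolding mollify_def by (rule abs_conv_mollifier_le[OF _ g2]) (use B in auto)
      then have "\<bar>mollify n g x - g x\<bar> \<le> 2 * B" using B(2)[of x] by linarith
      moreover have "cutoff (R + 1) x = 1" using True by (simp add: cutoff_def)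
      ultimately show ?thesis by simp
    next
      case False
      have "mollifier (real (Suc n)) (x - y) * g y = 0" for y
      proof (cases "R < \<bar>y\<bar>")
        case False
        then have "1 \<le> \<bar>x - y\<bar>" using \<open>\<not> \<bar>x\<bar> \<le> R + 1\<close> by linarith
        moreover have "1 / real (Suc n) \<le> 1" by simp
        ultimately have "1 / real (Suc n) \<le> \<bar>x - y\<bar>" by linarith
        then show ?thesis by (subst mollifier_support) auto
      qed (simp add: R)
      then have "(\<lambda>y. mollifier (real (Suc n)) (x - y) * g y) = (\<lambda>_. 0)" by (rule ext)
      then have "mollify n g x = 0" unfolding mollify_def conv_def by simp
      then show ?thesis using R(2)[of x] False B(1) by (simp add: cutoff_bounds)
    qed
    then show "AE x in lborel. \<bar>mollify n g x - g x\<bar> \<le> (2 * B) * cutoff (R + 1) x" for n by simp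
  qed
qed

lemma mollify_tendsto_L2:
  assumes f: "f \<in> L2_space" shows "(\<lambda>n. L2_norm (\<lambda>x. mollify n f x - f x)) \<longlonglongrightarrow> 0"
proof (rule LIMSEQ_I)
  fix e :: real assume e: "0 < e"
  obtain g where g: "kernel g" "L2_norm (\<lambda>x. f x - g x) < e / 3"
    using L2_dense_kernel[OF f, of "e / 3"] e by auto
  have g2: "g \<in> L2_space" by (rule kernel_L2[OF g(1)])
  obtain n0 where n0: "\<And>n. n \<ge> n0 \<Longrightarrow> L2_norm (\<lambda>x. mollify n g x - g x) < e / 3"
    using LIMSEQ_D[OF mollify_tendsto_kernel[OF g(1)], of "e / 3"] e by auto
  have "L2_norm (\<lambda>x. mollify n f x - f x) < e" if "n \<ge> n0" for n
  proof -
    have mf: "mollify n f \<in> L2_space" and mg: "mollify n g \<in> L2_space"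
      by (auto intro: mollify_L2 f g2)
    have "L2_norm (\<lambda>x. mollify n f x - f x)
        \<le> L2_norm (\<lambda>x. mollify n f x - mollify n g x) + L2_norm (\<lambda>x. mollify n g x - f x)"
      by (intro L2_norm_triangle_diff mf mg f)
    moreover have "L2_norm (\<lambda>x. mollify n g x - f x)
        \<le> L2_norm (\<lambda>x. mollify n g x - g x) + L2_norm (\<lambda>x. g x - f x)"
      by (intro L2_norm_triangle_diff mg g2 f)
    moreover have "L2_norm (\<lambda>x. mollify n f x - mollify n g x) \<le> L2_norm (\<lambda>x. f x - g x)"
      using mollify_L2(2)[OF L2_diff[OF f g2], of n] conv_diff[OF kernel_mollifier[of "real (Suc n)"] f g2]
      by (simp add: mollify_def)
    ultimately show ?thesis using g(2) n0[OF that] L2_norm_commute[of g f] by linarith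
  qed
  then show "\<exists>no. \<forall>n\<ge>no. norm (L2_norm (\<lambda>x. mollify n f x - f x) - 0) < e" by auto
qed

lemma conv_form_mollifier_tendsto:
  assumes f: "f \<in> L2_space"
  shows "(\<lambda>n. conv_form (mollifier (real (Suc n))) f f) \<longlonglongrightarrow> (L2_norm f)\<^sup>2"
proof -
  have "(\<lambda>n. conv_form (mollifier (real (Suc n))) f f - (L2_norm f)\<^sup>2) \<longlonglongrightarrow> 0"
  proof (rule tendsto_0_le[where K = "L2_norm f"])
    show "(\<lambda>n. L2_norm (\<lambda>x. mollify n f x - f x)) \<longlonglongrightarrow> 0" by (rule mollify_tendsto_L2[OF f])
    have "\<bar>conv_form (mollifier (real (Suc n))) f f - (L2_norm f)\<^sup>2\<bar>
        \<le> L2_norm f * L2_norm (\<lambda>x. mollify n f x - f x)" for n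
    proof -
      have "conv_form (mollifier (real (Suc n))) f f - (L2_norm f)\<^sup>2
          = (\<integral>x. f x * mollify n f x \<partial>lborel) - (\<integral>x. f x * f x \<partial>lborel)"
        using L2_norm_square[of f] by (simp add: conv_form_def mollify_def power2_eq_square)
      also have "\<dots> = (\<integral>x. f x * (mollify n f x - f x) \<partial>lborel)"
        using f by (simp add: right_diff_distrib integrable_mult_L2 mollify_L2)
      finally have eq: "conv_form (mollifier (real (Suc n))) f f - (L2_norm f)\<^sup>2
          = (\<integral>x. f x * (mollify n f x - f x) \<partial>lborel)" .
      show ?thesis unfolding eq by (intro abs_inner_L2_le L2_diff mollify_L2 f)
    qed
    then show "\<forall>\<^sub>F n in sequentially. norm (conv_form (mollifier (real (Suc n))) f f - (L2_norm f)\<^sup>2)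
        \<le> norm (L2_norm (\<lambda>x. mollify n f x - f x)) * L2_norm f"
      by (simp add: mult.commute)
  qed
  then show ?thesis by (simp add: LIM_zero_iff)
qed

lemma test_function_mollify:
  assumes "f \<in> L2_space" "\<And>x. S < \<bar>x\<bar> \<Longrightarrow> f x = 0"
  shows "mollify n f \<in> test_functions"
  unfolding mollify_def by (rule test_function_conv[OF test_function_mollifier]) (use assms in auto)

text \<open>
  Mollifications of the sign of \<open>g\<close>, cut off to an interval, are bounded test functions with
  uniformly bounded support. Testing against them gives in the limit that the integral of \<open>\<bar>g\<bar>\<close> over the
  interval is zero.
\<close>

lemma AE_zero_if_test_integrals_zero:
  assumes g: "locally_integrable g"
    and z: "\<And>\<phi>. \<phi> \<in> test_functions \<Longrightarrow> (\<integral>x. g x * \<phi> x \<partial>lborel) = 0"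
  shows "AE x in lborel. g x = 0"
proof -
  have gm: "g \<in> borel_measurable borel" by (rule borel_measurable_locally_integrable[OF g])
  have "AE x in lborel. x \<in> {- real m..real m} \<longrightarrow> g x = 0" for m :: nat
  proof -
    let ?I = "indicator {- real m..real m} :: real \<Rightarrow> real"
    let ?J = "indicator {- real m - 1..real m + 1} :: real \<Rightarrow> real"
    define s where "s x = ?I x * sgn (g x)" for x
    have I: "?I \<in> L2_space"
      unfolding L2_space_def
      by (auto simp: power2_eq_square indicator_inter_arith[symmetric] emeasure_lborel_Icc_eq)
    have sm: "s \<in> borel_measurable borel" unfolding s_def[abs_def] using gm by measurable
    have sb: "\<bar>s x\<bar> \<le> 1" for x by (auto simp: s_def indicator_def sgn_if)
    have s2: "s \<in> L2_space"
      by (rule L2_norm_mono_AE(1)[OF I sm]) (auto simp: s_def indicator_def sgn_if)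
    have ss: "s x = 0" if "real m < \<bar>x\<bar>" for x using that by (auto simp: s_def indicator_def)
    obtain r :: "nat \<Rightarrow> nat" where r: "strict_mono r"
      and ae: "AE x in lborel. (\<lambda>n. mollify (r n) s x) \<longlonglongrightarrow> s x"
      using L2_tendsto_AE_subseq[OF mollify_L2(1)[OF s2] s2 mollify_tendsto_L2[OF s2]] by blast
    have Jg: "integrable lborel (\<lambda>x. ?J x * \<bar>g x\<bar>)"
    proof -
      have "set_integrable lborel {- real m - 1..real m + 1} g"
        using g by (simp add: locally_integrable_def)
      then have "integrable lborel (\<lambda>x. \<bar>?J x * g x\<bar>)"
        by (intro integrable_abs) (simp add: set_integrable_def)
      then show ?thesis by (simp add: abs_mult)
    qed
    have mb: "\<bar>mollify n s x\<bar> \<le> ?J x" for n x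
    proof (cases "x \<in> {- real m - 1..real m + 1}")
      case True
      have "\<bar>mollify n s x\<bar> \<le> 1"
        unfolding mollify_def by (rule abs_conv_mollifier_le[OF _ s2]) (use sb in auto)
      then show ?thesis using True by simp
    next
      case False
      have "mollifier (real (Suc n)) (x - y) * s y = 0" for y
      proof (cases "real m < \<bar>y\<bar>")
        case False
        then have "1 \<le> \<bar>x - y\<bar>" using \<open>x \<notin> _\<close> by auto
        moreover have "1 / real (Suc n) \<le> 1" by simp
        ultimately have "1 / real (Suc n) \<le> \<bar>x - y\<bar>" by linarith
        then show ?thesis by (subst mollifier_support) auto
      qed (simp add: ss)
      then have "(\<lambda>y. mollifier (real (Suc n)) (x - y) * s y) = (\<lambda>_. 0)" by (rule ext)
      then have "mollify n s x = 0" unfolding mollify_def conv_def by simp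
      then show ?thesis by simp
    qed
    have "(\<lambda>n. \<integral>x. g x * mollify (r n) s x \<partial>lborel) \<longlonglongrightarrow> (\<integral>x. g x * s x \<partial>lborel)"
    proof (rule integral_dominated_convergence[OF _ _ Jg])
      show "AE x in lborel. (\<lambda>n. g x * mollify (r n) s x) \<longlonglongrightarrow> g x * s x"
        using ae by eventually_elim (intro tendsto_intros)
      show "AE x in lborel. norm (g x * mollify (r n) s x) \<le> ?J x * \<bar>g x\<bar>" for n
        using mult_left_mono[OF mb, of "\<bar>g _\<bar>" "r n"] by (auto simp: abs_mult mult.commute)
      show "(\<lambda>x. g x * mollify (r n) s x) \<in> borel_measurable lborel" for n
        using gm borel_measurable_L2[OF mollify_L2(1)[OF s2, of "r n"]] by simp
    qed (use gm sm in simp)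
    moreover have "(\<integral>x. g x * mollify (r n) s x \<partial>lborel) = 0" for n
      by (intro z test_function_mollify[OF s2 ss])
    ultimately have "(\<integral>x. g x * s x \<partial>lborel) = 0" by (simp add: LIMSEQ_const_iff)
    moreover have "g x * s x = ?I x * \<bar>g x\<bar>" for x by (simp add: s_def abs_sgn)
    ultimately have "(\<integral>x. ?I x * \<bar>g x\<bar> \<partial>lborel) = 0" by simp
    moreover have "integrable lborel (\<lambda>x. ?I x * \<bar>g x\<bar>)"
    proof -
      have "set_integrable lborel {- real m..real m} g"
        using g by (simp add: locally_integrable_def)
      then have "integrable lborel (\<lambda>x. \<bar>?I x * g x\<bar>)"
        by (intro integrable_abs) (simp add: set_integrable_def)
      then show ?thesis by (simp add: abs_mult)
    qed
    ultimately have "AE x in lborel. ?I x * \<bar>g x\<bar> = 0"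
      by (subst (asm) integral_nonneg_eq_0_iff_AE) auto
    then show ?thesis by eventually_elim (auto simp: indicator_def)
  qed
  then have "AE x in lborel. \<forall>m. x \<in> {- real m..real m} \<longrightarrow> g x = 0"
    unfolding AE_all_countable by blast
  then show ?thesis
  proof eventually_elim
    case (elim x)
    obtain m :: nat where "\<bar>x\<bar> \<le> real m" using real_arch_simple by blast
    then show ?case using elim by (auto simp: abs_le_iff)
  qed
qed

section \<open>Weak derivatives in \<open>L\<^sup>2\<close>\<close>

lemma integrable_locally_integrable_mult_test:
  assumes g: "locally_integrable g" and \<phi>: "\<phi> \<in> test_functions"
  shows "integrable lborel (\<lambda>x. g x * \<phi> x)"
proof -
  obtain R where R: "R > 0" "\<And>x. R < \<bar>x\<bar> \<Longrightarrow> \<phi> x = 0"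
    using kernel_support[OF kernel_test_function[OF \<phi>]] by blast
  obtain B where B: "B > 0" "\<And>x. \<bar>\<phi> x\<bar> \<le> B"
    using kernel_bounded[OF kernel_test_function[OF \<phi>]] by blast
  have gm: "g \<in> borel_measurable borel" by (rule borel_measurable_locally_integrable[OF g])
  have i: "integrable lborel (\<lambda>x. B * (indicator {-R..R} x * g x))"
    using g by (auto simp: locally_integrable_def set_integrable_def)
  have "norm (g x * \<phi> x) \<le> norm (B * (indicator {-R..R} x * g x))" for x
  proof (cases "x \<in> {-R..R}")
    case True
    then show ?thesis using mult_left_mono[OF B(2)[of x], of "\<bar>g x\<bar>"] B(1)
      by (simp add: abs_mult mult.commute)
  next
    case False
    then have "R < \<bar>x\<bar>" by auto
    then show ?thesis using R(2)[of x] B(1) by simp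
  qed
  then show ?thesis
    using gm kernel_measurable[OF kernel_test_function[OF \<phi>]]
    by (intro Bochner_Integration.integrable_bound[OF i]) auto
qed

lemma weak_deriv_AE_unique:
  assumes g: "has_weak_deriv j f g" and h: "has_weak_deriv j f h"
  shows "AE x in lborel. g x = h x"
proof -
  have lg: "locally_integrable g" and lh: "locally_integrable h"
    using assms by (auto simp: has_weak_deriv_def)
  have "locally_integrable (\<lambda>x. g x - h x)"
    using lg lh by (auto simp: locally_integrable_def set_integral_diff)
  moreover have "(\<integral>x. (g x - h x) * \<phi> x \<partial>lborel) = 0" if \<phi>: "\<phi> \<in> test_functions" for \<phi>
  proof -
    have "(-1) ^ j * (\<integral>x. g x * \<phi> x \<partial>lborel) = (-1) ^ j * (\<integral>x. h x * \<phi> x \<partial>lborel)"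
      using g h \<phi> by (auto simp: has_weak_deriv_def)
    then have "(\<integral>x. g x * \<phi> x \<partial>lborel) = (\<integral>x. h x * \<phi> x \<partial>lborel)" by simp
    then show ?thesis
      using integrable_locally_integrable_mult_test[OF lg \<phi>] integrable_locally_integrable_mult_test[OF lh \<phi>]
      by (simp add: left_diff_distrib)
  qed
  ultimately have "AE x in lborel. g x - h x = 0" by (rule AE_zero_if_test_integrals_zero)
  then show ?thesis by simp
qed

text \<open>
  Order one is enough: higher derivatives are handled as chains of such steps, which suits induction
  better than \<open>has_weak_deriv\<close> with its order as a parameter.
\<close>

definition L2_deriv :: "(real \<Rightarrow> real) \<Rightarrow> (real \<Rightarrow> real) \<Rightarrow> bool" where
  "L2_deriv f g \<longleftrightarrow> f \<in> L2_space \<and> g \<in> L2_space \<and>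
     (\<forall>\<phi>\<in>test_functions. (\<integral>x. f x * deriv \<phi> x \<partial>lborel) = - (\<integral>x. g x * \<phi> x \<partial>lborel))"

lemma L2_derivD: "L2_deriv f g \<Longrightarrow> f \<in> L2_space" "L2_deriv f g \<Longrightarrow> g \<in> L2_space"
  by (auto simp: L2_deriv_def)

lemma L2_deriv_add:
  assumes "L2_deriv f f'" "L2_deriv g g'" shows "L2_deriv (\<lambda>x. f x + g x) (\<lambda>x. f' x + g' x)"
  unfolding L2_deriv_def
proof (intro conjI ballI)
  show "(\<lambda>x. f x + g x) \<in> L2_space" "(\<lambda>x. f' x + g' x) \<in> L2_space"
    using assms by (auto intro: L2_add dest: L2_derivD)
  fix \<phi> assume \<phi>: "\<phi> \<in> test_functions"
  have k: "\<phi> \<in> L2_space" "deriv \<phi> \<in> L2_space"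
    using \<phi> by (auto intro: kernel_L2 kernel_test_function test_function_deriv1)
  show "(\<integral>x. (f x + g x) * deriv \<phi> x \<partial>lborel) = - (\<integral>x. (f' x + g' x) * \<phi> x \<partial>lborel)"
    using assms \<phi> k by (auto simp: L2_deriv_def distrib_right integrable_mult_L2)
qed

lemma L2_deriv_cmult:
  assumes "L2_deriv f f'" shows "L2_deriv (\<lambda>x. c * f x) (\<lambda>x. c * f' x)"
  using assms by (auto simp: L2_deriv_def mult.assoc intro: L2_cmult)

lemma L2_deriv_diff:
  assumes "L2_deriv f f'" "L2_deriv g g'" shows "L2_deriv (\<lambda>x. f x - g x) (\<lambda>x. f' x - g' x)"
  using L2_deriv_add[OF assms(1) L2_deriv_cmult[OF assms(2), of "-1"]] by simp

text \<open>
  The defining identity of the weak derivative, tested with \<open>y \<mapsto> K (x - y)\<close>.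
\<close>

lemma conv_deriv_eq:
  assumes fg: "L2_deriv f g" and K: "K \<in> test_functions"
  shows "conv (deriv K) f = conv K g"
proof
  fix x
  have "deriv (\<lambda>y. K (x - y)) = (\<lambda>y. - deriv K (x - y))"
    using deriv_reflect_shift[OF K, of 1 x] by simp
  then have "(\<integral>y. f y * - deriv K (x - y) \<partial>lborel) = - (\<integral>y. g y * K (x - y) \<partial>lborel)"
    using fg test_function_reflect_shift[OF K, of x] by (auto simp: L2_deriv_def)
  then show "conv (deriv K) f x = conv K g x"
    by (simp add: conv_def mult.commute)
qed

lemma conv_form_deriv_right:
  assumes "L2_deriv f f'" and "K \<in> test_functions"
  shows "conv_form (deriv K) g f = conv_form K g f'"
  using conv_deriv_eq[OF assms] by (simp add: conv_form_def)

lemma conv_form_deriv_left: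
  assumes f: "L2_deriv f f'" and K: "K \<in> test_functions" and g: "g \<in> L2_space"
  shows "conv_form (deriv K) f g = - conv_form K f' g"
proof -
  note f2 = L2_derivD[OF f]
  have Kr: "(\<lambda>z. K (- z)) \<in> test_functions" using test_function_reflect_shift[OF K, of 0] by simp
  have dr: "deriv (\<lambda>z. K (- z)) = (\<lambda>z. - deriv K (- z))"
    using deriv_reflect_shift[OF K, of 1 0] by simp
  have "conv_form (deriv K) f g = conv_form (\<lambda>z. deriv K (- z)) g f"
    by (rule conv_form_swap[OF kernel_test_function[OF test_function_deriv1[OF K]] f2(1) g])
  also have "\<dots> = - conv_form (deriv (\<lambda>z. K (- z))) g f"
    unfolding dr conv_form_uminus_kernel by simp
  also have "\<dots> = - conv_form (\<lambda>z. K (- z)) g f'"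
    by (simp add: conv_form_deriv_right[OF f Kr])
  also have "\<dots> = - conv_form K f' g"
    using conv_form_swap[OF kernel_test_function[OF K] f2(2) g] by simp
  finally show ?thesis .
qed

lemma mollify_DERIV:
  assumes "L2_deriv f g" shows "(mollify n f has_real_derivative mollify n g x) (at x)"
  using DERIV_conv[OF test_function_mollifier[of "real (Suc n)"] L2_derivD(1)[OF assms], of x]
    conv_deriv_eq[OF assms test_function_mollifier[of "real (Suc n)"]]
  by (simp add: mollify_def)

lemma mollify_continuous: "f \<in> L2_space \<Longrightarrow> continuous_on S (mollify n f)"
proof -
  assume f: "f \<in> L2_space"
  let ?K = "mollifier (real (Suc n))"
  have "(conv ?K f has_real_derivative conv (deriv ?K) f x) (at x within UNIV)" for x
    using DERIV_conv[OF test_function_mollifier f, of "real (Suc n)"] by simp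
  then have "continuous_on UNIV (conv ?K f)" by (rule DERIV_continuous_on)
  then show "continuous_on S (mollify n f)"
    unfolding mollify_def by (rule continuous_on_subset) simp
qed

lemma indicator_Icc_L2:
  "indicator {a..b} \<in> L2_space" "a \<le> b \<Longrightarrow> L2_norm (indicator {a..b}) = sqrt (b - a)"
  by (auto simp: L2_space_def L2_norm_def power2_eq_square indicator_inter_arith[symmetric]
      emeasure_lborel_Icc_eq)

text \<open>
  On the interval \<open>[x, x + 1]\<close> the function varies by at most the integral of \<open>\<bar>F'\<bar>\<close>; averaging
  \<open>\<bar>F x\<bar> \<le> \<bar>F y\<bar> + \<integral>\<bar>F'\<bar>\<close> over \<open>y\<close> in that interval leaves integrals over a set of measure one.
\<close>

lemma C1_sup_bound:
  fixes F :: "real \<Rightarrow> real"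
  assumes F: "F \<in> L2_space" and F': "F' \<in> L2_space"
    and d: "\<And>x. (F has_real_derivative F' x) (at x)" and c: "continuous_on UNIV F'"
  shows "\<bar>F x\<bar> \<le> L2_norm F + L2_norm F'"
proof -
  let ?I = "indicator {x..x + 1} :: real \<Rightarrow> real"
  have I: "?I \<in> L2_space" "L2_norm ?I = 1" using indicator_Icc_L2[of x "x + 1"] by auto
  have iF': "integrable lborel (\<lambda>z. \<bar>?I z * F' z\<bar>)"
    by (intro integrable_abs integrable_mult_L2 I F')
  have cont_F: "continuous_on UNIV F" using d by (intro DERIV_continuous_on) auto
  have step: "\<bar>F x\<bar> \<le> \<bar>F y\<bar> + L2_norm F'" if y: "y \<in> {x..x + 1}" for y
  proof -
    have "(\<integral>z. indicator {x..y} z *\<^sub>R F' z \<partial>lborel) = F y - F x"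
      using y by (intro integral_FTC_atLeastAtMost)
        (auto intro: continuous_on_subset[OF c] has_field_derivative_at_within d
          simp flip: has_real_derivative_iff_has_vector_derivative)
    then have eq: "F y - F x = (\<integral>z. indicator {x..y} z * F' z \<partial>lborel)" by simp
    have "\<bar>F y - F x\<bar> \<le> (\<integral>z. \<bar>indicator {x..y} z * F' z\<bar> \<partial>lborel)"
      unfolding eq real_norm_def[symmetric] by (rule integral_norm_bound)
    also have "\<dots> \<le> (\<integral>z. \<bar>?I z * F' z\<bar> \<partial>lborel)"
      using y by (intro integral_mono iF' integrable_abs integrable_mult_L2 F' indicator_Icc_L2)
        (auto simp: indicator_def)
    also have "\<dots> \<le> L2_norm ?I * L2_norm F'" by (rule Cauchy_Schwarz_L2[OF I(1) F'])
    finally show ?thesis using I by simp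
  qed
  have "\<bar>F x\<bar> = (\<integral>y. ?I y * \<bar>F x\<bar> \<partial>lborel)" by simp
  also have "\<dots> \<le> (\<integral>y. \<bar>?I y * F y\<bar> + ?I y * L2_norm F' \<partial>lborel)"
  proof (rule integral_mono)
    show "integrable lborel (\<lambda>y. \<bar>?I y * F y\<bar> + ?I y * L2_norm F')"
      by (intro Bochner_Integration.integrable_add integrable_abs integrable_mult_L2 I F integrable_mult_left) simp
    show "?I y * \<bar>F x\<bar> \<le> \<bar>?I y * F y\<bar> + ?I y * L2_norm F'" for y
      using step[of y] by (auto simp: indicator_def)
  qed simp
  also have "\<dots> = (\<integral>y. \<bar>?I y * F y\<bar> \<partial>lborel) + L2_norm F'"
  proof -
    have "integrable lborel (\<lambda>y. \<bar>?I y * F y\<bar>)" by (intro integrable_abs integrable_mult_L2 I F)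
    moreover have "integrable lborel (\<lambda>y. ?I y * L2_norm F')" by simp
    ultimately have "(\<integral>y. \<bar>?I y * F y\<bar> + ?I y * L2_norm F' \<partial>lborel)
        = (\<integral>y. \<bar>?I y * F y\<bar> \<partial>lborel) + (\<integral>y. ?I y * L2_norm F' \<partial>lborel)"
      by (rule Bochner_Integration.integral_add)
    then show ?thesis by simp
  qed
  also have "\<dots> \<le> L2_norm ?I * L2_norm F + L2_norm F'"
    using Cauchy_Schwarz_L2[OF I(1) F] by simp
  finally show ?thesis using I by simp
qed

text \<open>
  The one-dimensional Sobolev embedding. The bound passes from the mollifications to \<open>f\<close> along a subsequence
  that converges almost everywhere.
\<close>

lemma L2_deriv_sup_bound:
  assumes fg: "L2_deriv f g"
  shows "AE x in lborel. \<bar>f x\<bar> \<le> L2_norm f + L2_norm g"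
proof -
  note f2 = L2_derivD[OF fg]
  obtain r :: "nat \<Rightarrow> nat" where ae: "AE x in lborel. (\<lambda>n. mollify (r n) f x) \<longlonglongrightarrow> f x"
    using L2_tendsto_AE_subseq[OF mollify_L2(1)[OF f2(1)] f2(1) mollify_tendsto_L2[OF f2(1)]] by blast
  have bd: "\<bar>mollify n f x\<bar> \<le> L2_norm f + L2_norm g" for n x
  proof -
    have "\<bar>mollify n f x\<bar> \<le> L2_norm (mollify n f) + L2_norm (mollify n g)"
      by (intro C1_sup_bound mollify_L2 f2 mollify_DERIV fg mollify_continuous)
    then show ?thesis using mollify_L2(2)[OF f2(1), of n] mollify_L2(2)[OF f2(2), of n] by linarith
  qed
  show ?thesis
    using ae
  proof eventually_elim
    case (elim x)
    show ?case by (rule LIMSEQ_le_const2[OF tendsto_rabs[OF elim]]) (use bd in auto)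
  qed
qed

lemma L2_deriv_Lipschitz:
  assumes fg: "L2_deriv f g" and bd: "AE x in lborel. \<bar>g x\<bar> \<le> B"
  obtains N where "N \<in> null_sets lborel"
    "\<And>x y. x \<notin> N \<Longrightarrow> y \<notin> N \<Longrightarrow> \<bar>f x - f y\<bar> \<le> B * \<bar>x - y\<bar>"
proof -
  note f2 = L2_derivD[OF fg]
  obtain r :: "nat \<Rightarrow> nat" where ae: "AE x in lborel. (\<lambda>n. mollify (r n) f x) \<longlonglongrightarrow> f x"
    using L2_tendsto_AE_subseq[OF mollify_L2(1)[OF f2(1)] f2(1) mollify_tendsto_L2[OF f2(1)]] by blast
  obtain N where N: "N \<in> null_sets lborel"
    and lim: "\<And>x. x \<notin> N \<Longrightarrow> (\<lambda>n. mollify (r n) f x) \<longlonglongrightarrow> f x"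
    using AE_E3[OF ae] by auto
  have lip: "\<bar>mollify n f x - mollify n f y\<bar> \<le> B * \<bar>x - y\<bar>" for n x y
  proof -
    have "norm (mollify n g z) \<le> B" for z
      unfolding mollify_def real_norm_def by (rule abs_conv_mollifier_le[OF _ f2(2) bd]) simp
    from field_differentiable_bound[OF convex_UNIV mollify_DERIV[OF fg, of n] this, of x y]
    show ?thesis by simp
  qed
  show ?thesis
  proof (rule that[OF N])
    fix x y assume "x \<notin> N" "y \<notin> N"
    then have "(\<lambda>n. \<bar>mollify (r n) f x - mollify (r n) f y\<bar>) \<longlonglongrightarrow> \<bar>f x - f y\<bar>"
      by (intro tendsto_intros lim)
    then show "\<bar>f x - f y\<bar> \<le> B * \<bar>x - y\<bar>"
      by (rule LIMSEQ_le_const2) (use lip in auto)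
  qed
qed

lemma integral_deriv_compact_support:
  assumes P: "kernel P" and P': "kernel P'" and d: "\<And>x. (P has_real_derivative P' x) (at x)"
  shows "(\<integral>x. P' x \<partial>lborel) = 0"
proof -
  obtain R where R: "R > 0" "\<And>x. R < \<bar>x\<bar> \<Longrightarrow> P x = 0" using kernel_support[OF P] by blast
  obtain R' where R': "R' > 0" "\<And>x. R' < \<bar>x\<bar> \<Longrightarrow> P' x = 0" using kernel_support[OF P'] by blast
  let ?S = "max R R' + 1"
  have "(\<integral>x. indicator {-?S..?S} x *\<^sub>R P' x \<partial>lborel) = P ?S - P (-?S)"
    using R R' P' by (intro integral_FTC_atLeastAtMost)
      (auto intro: continuous_on_subset has_field_derivative_at_within d
        simp: kernel_def simp flip: has_real_derivative_iff_has_vector_derivative)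
  also have "(\<lambda>x. indicator {-?S..?S} x *\<^sub>R P' x) = P'"
  proof
    fix x show "indicator {-?S..?S} x *\<^sub>R P' x = P' x"
      using R'(2)[of x] by (cases "x \<in> {-?S..?S}") auto
  qed
  finally show ?thesis using R(2)[of ?S] R(2)[of "-?S"] R(1) by simp
qed

lemma integral_product_tendsto:
  assumes a: "\<And>n. a n \<in> L2_space" "A \<in> L2_space" "(\<lambda>n. L2_norm (\<lambda>x. a n x - A x)) \<longlonglongrightarrow> 0"
    and b: "\<And>n. b n \<in> L2_space" "B \<in> L2_space" "(\<lambda>n. L2_norm (\<lambda>x. b n x - B x)) \<longlonglongrightarrow> 0"
    and \<phi>: "kernel \<phi>"
  shows "(\<lambda>n. \<integral>x. a n x * b n x * \<phi> x \<partial>lborel) \<longlonglongrightarrow> (\<integral>x. A x * B x * \<phi> x \<partial>lborel)"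
proof -
  obtain C where C: "C > 0" "\<And>x. \<bar>\<phi> x\<bar> \<le> C" using kernel_bounded[OF \<phi>] by blast
  have \<phi>m: "\<phi> \<in> borel_measurable borel" by (rule kernel_measurable[OF \<phi>])
  have p: "(\<lambda>x. \<phi> x * f x) \<in> L2_space" "L2_norm (\<lambda>x. \<phi> x * f x) \<le> C * L2_norm f" if "f \<in> L2_space" for f
    using L2_mult_bounded[OF that \<phi>m, of C] C by auto
  have bn: "L2_norm (b n) \<le> L2_norm (\<lambda>x. b n x - B x) + L2_norm B" for n
    using L2_norm_triangle[OF L2_diff[OF b(1)[of n] b(2)] b(2)] by simp
  have diff: "\<bar>(\<integral>x. a n x * b n x * \<phi> x \<partial>lborel) - (\<integral>x. A x * B x * \<phi> x \<partial>lborel)\<bar>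
      \<le> C * (L2_norm (\<lambda>x. a n x - A x) * (L2_norm (\<lambda>x. b n x - B x) + L2_norm B)
         + L2_norm A * L2_norm (\<lambda>x. b n x - B x))" for n
  proof -
    have i1: "integrable lborel (\<lambda>x. a n x * b n x * \<phi> x)"
      using integrable_mult_L2[OF a(1)[of n] p(1)[OF b(1)[of n]]] by (simp add: ac_simps)
    have i2: "integrable lborel (\<lambda>x. A x * B x * \<phi> x)"
      using integrable_mult_L2[OF a(2) p(1)[OF b(2)]] by (simp add: ac_simps)
    have j1: "integrable lborel (\<lambda>x. (a n x - A x) * (\<phi> x * b n x))"
      by (intro integrable_mult_L2 L2_diff p a b)
    have j2: "integrable lborel (\<lambda>x. A x * (\<phi> x * (b n x - B x)))"
      by (intro integrable_mult_L2 L2_diff p a b)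
    have "(\<integral>x. a n x * b n x * \<phi> x \<partial>lborel) - (\<integral>x. A x * B x * \<phi> x \<partial>lborel)
        = (\<integral>x. a n x * b n x * \<phi> x - A x * B x * \<phi> x \<partial>lborel)"
      using i1 i2 by simp
    also have "(\<lambda>x. a n x * b n x * \<phi> x - A x * B x * \<phi> x)
        = (\<lambda>x. (a n x - A x) * (\<phi> x * b n x) + A x * (\<phi> x * (b n x - B x)))"
      by (auto simp: algebra_simps)
    also have "(\<integral>x. (a n x - A x) * (\<phi> x * b n x) + A x * (\<phi> x * (b n x - B x)) \<partial>lborel)
        = (\<integral>x. (a n x - A x) * (\<phi> x * b n x) \<partial>lborel) + (\<integral>x. A x * (\<phi> x * (b n x - B x)) \<partial>lborel)"
      by (rule Bochner_Integration.integral_add[OF j1 j2])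
    finally have eq: "(\<integral>x. a n x * b n x * \<phi> x \<partial>lborel) - (\<integral>x. A x * B x * \<phi> x \<partial>lborel) = \<dots>" .
    have "\<bar>\<integral>x. (a n x - A x) * (\<phi> x * b n x) \<partial>lborel\<bar>
        \<le> L2_norm (\<lambda>x. a n x - A x) * L2_norm (\<lambda>x. \<phi> x * b n x)"
      by (intro abs_inner_L2_le L2_diff p a b)
    also have "\<dots> \<le> L2_norm (\<lambda>x. a n x - A x) * (C * (L2_norm (\<lambda>x. b n x - B x) + L2_norm B))"
      using C bn[of n] by (intro mult_left_mono order_trans[OF p(2)[OF b(1)]]) auto
    finally have 1: "\<bar>\<integral>x. (a n x - A x) * (\<phi> x * b n x) \<partial>lborel\<bar> \<le> \<dots>" .
    have "\<bar>\<integral>x. A x * (\<phi> x * (b n x - B x)) \<partial>lborel\<bar> \<le> L2_norm A * L2_norm (\<lambda>x. \<phi> x * (b n x - B x))"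
      by (intro abs_inner_L2_le L2_diff p a b)
    also have "\<dots> \<le> L2_norm A * (C * L2_norm (\<lambda>x. b n x - B x))"
      by (intro mult_left_mono p L2_diff b) auto
    finally have 2: "\<bar>\<integral>x. A x * (\<phi> x * (b n x - B x)) \<partial>lborel\<bar> \<le> \<dots>" .
    show ?thesis unfolding eq using 1 2 by (simp add: algebra_simps)
  qed
  have "(\<lambda>n. C * (L2_norm (\<lambda>x. a n x - A x) * (L2_norm (\<lambda>x. b n x - B x) + L2_norm B)
         + L2_norm A * L2_norm (\<lambda>x. b n x - B x))) \<longlonglongrightarrow> C * (0 * (0 + L2_norm B) + L2_norm A * 0)"
    by (intro tendsto_intros a b)
  then have lim: "(\<lambda>n. C * (L2_norm (\<lambda>x. a n x - A x) * (L2_norm (\<lambda>x. b n x - B x) + L2_norm B)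
         + L2_norm A * L2_norm (\<lambda>x. b n x - B x))) \<longlonglongrightarrow> 0" by simp
  have "(\<lambda>n. (\<integral>x. a n x * b n x * \<phi> x \<partial>lborel) - (\<integral>x. A x * B x * \<phi> x \<partial>lborel)) \<longlonglongrightarrow> 0"
    by (rule tendsto_0_le[OF lim, where K = 1])
      (use diff in \<open>auto intro!: always_eventually order_trans[OF diff]\<close>)
  then show ?thesis by (simp add: LIM_zero_iff)
qed

text \<open>
  The classical product rule holds for the mollified factors; tested against a fixed function, every term is
  continuous under \<open>L\<^sup>2\<close> convergence of both factors. That the product lies in \<open>L\<^sup>2\<close> again is due to the
  sup bound.
\<close>

lemma L2_deriv_mult:
  assumes f: "L2_deriv f f'" and g: "L2_deriv g g'"
  shows "L2_deriv (\<lambda>x. f x * g x) (\<lambda>x. f' x * g x + f x * g' x)"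
  unfolding L2_deriv_def
proof (intro conjI ballI)
  note f2 = L2_derivD[OF f] and g2 = L2_derivD[OF g]
  note fm = borel_measurable_L2[OF f2(1)] and gm = borel_measurable_L2[OF g2(1)]
  show "(\<lambda>x. f x * g x) \<in> L2_space"
    by (rule L2_mult_bounded(1)[OF g2(1) fm L2_deriv_sup_bound[OF f]])
  have "(\<lambda>x. g x * f' x) \<in> L2_space"
    by (rule L2_mult_bounded(1)[OF f2(2) gm L2_deriv_sup_bound[OF g]])
  moreover have "(\<lambda>x. f x * g' x) \<in> L2_space"
    by (rule L2_mult_bounded(1)[OF g2(2) fm L2_deriv_sup_bound[OF f]])
  ultimately have "(\<lambda>x. g x * f' x + f x * g' x) \<in> L2_space" by (rule L2_add)
  then show "(\<lambda>x. f' x * g x + f x * g' x) \<in> L2_space" by (simp add: mult.commute)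
  fix \<phi> assume \<phi>: "\<phi> \<in> test_functions"
  have k: "kernel \<phi>" "kernel (deriv \<phi>)"
    using \<phi> by (auto intro: kernel_test_function test_function_deriv1)
  let ?T = "\<lambda>a b \<psi>. \<integral>x. a x * b x * \<psi> x \<partial>lborel"
  have zero: "?T (mollify n f) (mollify n g) (deriv \<phi>)
      + (?T (mollify n f') (mollify n g) \<phi> + ?T (mollify n f) (mollify n g') \<phi>) = 0" for n
  proof -
    have c: "continuous_on UNIV (mollify n h)" if "h \<in> L2_space" for h
      using mollify_continuous[OF that] .
    have ks: "kernel (\<lambda>x. mollify n a x * mollify n b x * \<psi> x)"
      if "a \<in> L2_space" "b \<in> L2_space" "kernel \<psi>" for a b \<psi>
      using that by (intro kernel_mult continuous_intros c)
    have i: "integrable lborel (\<lambda>x. mollify n a x * mollify n b x * \<psi> x)"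
      if "a \<in> L2_space" "b \<in> L2_space" "kernel \<psi>" for a b \<psi>
      by (intro kernel_integrable ks that)
    let ?P = "\<lambda>x. mollify n f x * mollify n g x * \<phi> x"
    let ?P' = "\<lambda>x. mollify n f x * mollify n g x * deriv \<phi> x
      + (mollify n f' x * mollify n g x * \<phi> x + mollify n f x * mollify n g' x * \<phi> x)"
    have "(\<integral>x. ?P' x \<partial>lborel) = 0"
    proof (rule integral_deriv_compact_support)
      show "kernel ?P" by (intro ks f2 g2 k)
      show "kernel ?P'" by (intro kernel_add ks f2 g2 k)
      fix x
      have "(\<phi> has_real_derivative deriv \<phi> x) (at x)" using DERIV_test_function[OF \<phi>, of 0 x] by simp
      from DERIV_mult[OF DERIV_mult[OF mollify_DERIV[OF f, of n x] mollify_DERIV[OF g, of n x]] this]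
      show "(?P has_real_derivative ?P' x) (at x)"
        by (rule DERIV_cong) (simp add: algebra_simps)
    qed
    then show ?thesis
      using i[OF f2(1) g2(1) k(2)] i[OF f2(2) g2(1) k(1)] i[OF f2(1) g2(2) k(1)] by simp
  qed
  note m = mollify_L2(1) mollify_tendsto_L2
  have "(\<lambda>n. ?T (mollify n f) (mollify n g) (deriv \<phi>)
      + (?T (mollify n f') (mollify n g) \<phi> + ?T (mollify n f) (mollify n g') \<phi>))
      \<longlonglongrightarrow> ?T f g (deriv \<phi>) + (?T f' g \<phi> + ?T f g' \<phi>)"
    by (intro tendsto_add integral_product_tendsto m f2 g2 k)
  then have lim0: "?T f g (deriv \<phi>) + (?T f' g \<phi> + ?T f g' \<phi>) = 0"
    unfolding zero by (simp add: LIMSEQ_const_iff)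
  have i: "integrable lborel (\<lambda>x. a x * b x * \<phi> x)" if ab: "a \<in> L2_space" "b \<in> L2_space" for a b
  proof -
    obtain C where C: "\<And>x. \<bar>\<phi> x\<bar> \<le> C" using kernel_bounded[OF k(1)] by blast
    have "(\<lambda>x. \<phi> x * b x) \<in> L2_space"
      by (rule L2_mult_bounded(1)[OF ab(2) kernel_measurable[OF k(1)], of C]) (use C in auto)
    from integrable_mult_L2[OF ab(1) this] show ?thesis by (simp add: ac_simps)
  qed
  have "(\<integral>x. (f' x * g x + f x * g' x) * \<phi> x \<partial>lborel) = ?T f' g \<phi> + ?T f g' \<phi>"
    using i[OF f2(2) g2(1)] i[OF f2(1) g2(2)] by (simp add: distrib_right)
  then show "(\<integral>x. f x * g x * deriv \<phi> x \<partial>lborel) = - (\<integral>x. (f' x * g x + f x * g' x) * \<phi> x \<partial>lborel)"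
    using lim0 by linarith
qed

section \<open>Sobolev spaces as chains of weak derivatives\<close>

text \<open>
  Since \<open>weak_deriv\<close> picks some representative, it does not commute pointwise with sums or
  products. A chain records a choice of representatives that can be prescribed.
\<close>

definition deriv_chain :: "nat \<Rightarrow> (nat \<Rightarrow> real \<Rightarrow> real) \<Rightarrow> bool" where
  "deriv_chain m D \<longleftrightarrow> (\<forall>j\<le>m. D j \<in> L2_space) \<and> (\<forall>j<m. L2_deriv (D j) (D (Suc j)))"

text \<open>
  A bound on the largest \<open>L\<^sup>2\<close> norm among the derivatives, equivalent to \<open>H_norm\<close>; bounds of this kind
  behave better under products.
\<close>

definition Sobolev_le :: "nat \<Rightarrow> (real \<Rightarrow> real) \<Rightarrow> real \<Rightarrow> bool" where
  "Sobolev_le m f B \<longleftrightarrow> (\<exists>D. D 0 = f \<and> deriv_chain m D \<and> (\<forall>j\<le>m. L2_norm (D j) \<le> B))"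

lemma deriv_chain_tail: "deriv_chain (Suc m) D \<Longrightarrow> deriv_chain m (\<lambda>j. D (Suc j))"
  by (auto simp: deriv_chain_def)

lemma deriv_chain_mono: "deriv_chain m D \<Longrightarrow> n \<le> m \<Longrightarrow> deriv_chain n D"
  by (auto simp: deriv_chain_def)

lemma deriv_chain_Cons:
  assumes "L2_deriv f (D 0)" "deriv_chain m D"
  shows "deriv_chain (Suc m) (case_nat f D)"
  using assms L2_derivD[OF assms(1)] by (auto simp: deriv_chain_def split: nat.split)

lemma deriv_chain_diff:
  "deriv_chain m D \<Longrightarrow> deriv_chain m E \<Longrightarrow> deriv_chain m (\<lambda>j x. D j x - E j x)"
  by (auto simp: deriv_chain_def intro: L2_diff L2_deriv_diff)

lemma Sobolev_le_0: "Sobolev_le 0 f B \<longleftrightarrow> f \<in> L2_space \<and> L2_norm f \<le> B"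
  by (auto simp: Sobolev_le_def deriv_chain_def intro: exI[of _ "\<lambda>_. f"])

lemma Sobolev_le_Suc:
  "Sobolev_le (Suc m) f B \<longleftrightarrow> L2_norm f \<le> B \<and> (\<exists>g. L2_deriv f g \<and> Sobolev_le m g B)"
proof
  assume "Sobolev_le (Suc m) f B"
  then obtain D where D: "D 0 = f" "deriv_chain (Suc m) D" "\<forall>j\<le>Suc m. L2_norm (D j) \<le> B"
    by (auto simp: Sobolev_le_def)
  have "Sobolev_le m (D 1) B"
    unfolding Sobolev_le_def using deriv_chain_tail[OF D(2)] D(3)
    by (intro exI[of _ "\<lambda>j. D (Suc j)"]) auto
  moreover have "L2_deriv f (D 1)" using D(1,2) by (auto simp: deriv_chain_def)
  ultimately show "L2_norm f \<le> B \<and> (\<exists>g. L2_deriv f g \<and> Sobolev_le m g B)"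
    using D(1,3) by auto
next
  assume "L2_norm f \<le> B \<and> (\<exists>g. L2_deriv f g \<and> Sobolev_le m g B)"
  then obtain D where D: "L2_norm f \<le> B" "L2_deriv f (D 0)" "deriv_chain m D" "\<forall>j\<le>m. L2_norm (D j) \<le> B"
    by (auto simp: Sobolev_le_def)
  have "\<forall>j\<le>Suc m. L2_norm (case_nat f D j) \<le> B" using D by (auto split: nat.split)
  then show "Sobolev_le (Suc m) f B"
    unfolding Sobolev_le_def using deriv_chain_Cons[of f D m] D by (intro exI[of _ "case_nat f D"]) auto
qed

lemma Sobolev_leD:
  assumes "Sobolev_le m f B" shows "f \<in> L2_space" "L2_norm f \<le> B" "0 \<le> B"
proof -
  show "f \<in> L2_space" "L2_norm f \<le> B" using assms by (auto simp: Sobolev_le_def deriv_chain_def)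
  then show "0 \<le> B" using L2_norm_nonneg[of f] by linarith
qed

lemma Sobolev_le_mono: "Sobolev_le m f B \<Longrightarrow> n \<le> m \<Longrightarrow> B \<le> C \<Longrightarrow> Sobolev_le n f C"
  unfolding Sobolev_le_def
proof (elim exE conjE)
  fix D assume D: "D 0 = f" "deriv_chain m D" "\<forall>j\<le>m. L2_norm (D j) \<le> B" and le: "n \<le> m" "B \<le> C"
  have "\<forall>j\<le>n. L2_norm (D j) \<le> C" using D(3) le by (auto intro: order_trans)
  then show "\<exists>D. D 0 = f \<and> deriv_chain n D \<and> (\<forall>j\<le>n. L2_norm (D j) \<le> C)"
    using D deriv_chain_mono[OF D(2) le(1)] by blast
qed

lemma Sobolev_le_add:
  assumes f: "Sobolev_le m f A" and g: "Sobolev_le m g B"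
  shows "Sobolev_le m (\<lambda>x. f x + g x) (A + B)"
proof -
  obtain D where D: "D 0 = f" "deriv_chain m D" "\<forall>j\<le>m. L2_norm (D j) \<le> A"
    using f by (auto simp: Sobolev_le_def)
  obtain E where E: "E 0 = g" "deriv_chain m E" "\<forall>j\<le>m. L2_norm (E j) \<le> B"
    using g by (auto simp: Sobolev_le_def)
  have "deriv_chain m (\<lambda>j x. D j x + E j x)"
    using D(2) E(2) by (auto simp: deriv_chain_def intro: L2_add L2_deriv_add)
  moreover have "L2_norm (\<lambda>x. D j x + E j x) \<le> A + B" if "j \<le> m" for j
  proof -
    have "L2_norm (\<lambda>x. D j x + E j x) \<le> L2_norm (D j) + L2_norm (E j)"
      using D(2) E(2) that by (intro L2_norm_triangle) (auto simp: deriv_chain_def)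
    also have "\<dots> \<le> A + B" using D(3) E(3) that by (intro add_mono) auto
    finally show ?thesis .
  qed
  ultimately show ?thesis
    unfolding Sobolev_le_def using D(1) E(1) by (intro exI[of _ "\<lambda>j x. D j x + E j x"]) auto
qed

lemma Sobolev_le_sup_bound:
  assumes "Sobolev_le m f A" "1 \<le> m" shows "AE x in lborel. \<bar>f x\<bar> \<le> 2 * A"
proof -
  have "Sobolev_le (Suc 0) f A" using Sobolev_le_mono[OF assms(1), of "Suc 0" A] assms(2) by simp
  then obtain g where g: "L2_deriv f g" "L2_norm f \<le> A" "L2_norm g \<le> A"
    by (auto simp: Sobolev_le_Suc Sobolev_le_0)
  show ?thesis using L2_deriv_sup_bound[OF g(1)] by eventually_elim (use g in linarith)
qed

lemma L2_mult_Sobolev: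
  assumes f: "Sobolev_le 1 f A" and g: "g \<in> L2_space" "L2_norm g \<le> B"
  shows "(\<lambda>x. f x * g x) \<in> L2_space" "L2_norm (\<lambda>x. f x * g x) \<le> 2 * A * B"
proof -
  note fA = Sobolev_leD[OF f]
  note b = L2_mult_bounded[OF g(1) borel_measurable_L2[OF fA(1)] Sobolev_le_sup_bound[OF f order_refl]]
  show "(\<lambda>x. f x * g x) \<in> L2_space" by (rule b(1))
  have "2 * A * L2_norm g \<le> 2 * A * B" using g(2) fA(3) by (intro mult_left_mono) auto
  then show "L2_norm (\<lambda>x. f x * g x) \<le> 2 * A * B" using b(2) by linarith
qed

lemma two_le_four_power: "(2::real) \<le> 4 ^ Suc n"
proof -
  have "(1::real) \<le> 4 ^ n" by (rule one_le_power) simp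
  then show ?thesis unfolding power_Suc by linarith
qed

text \<open>
  \<open>H\<^sup>n\<close> is an algebra for \<open>n \<ge> 1\<close>. In \<open>(f g)' = f' g + f g'\<close> each product has a factor in \<open>H\<^sup>n\<close> and one in
  \<open>H\<^sup>n\<^sup>-\<^sup>1\<close>. For \<open>n = 1\<close> the better factor is bounded, for larger \<open>n\<close> induction applies.
\<close>

lemma Sobolev_le_mult:
  assumes "Sobolev_le (Suc m) f A" "Sobolev_le (Suc m) g B"
  shows "Sobolev_le (Suc m) (\<lambda>x. f x * g x) (4 ^ Suc m * (A * B))"
  using assms
proof (induction m arbitrary: f g)
  case 0
  obtain f' where f': "L2_deriv f f'" "f' \<in> L2_space" "L2_norm f' \<le> A"
    using 0(1) by (auto simp: Sobolev_le_Suc Sobolev_le_0)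
  obtain g' where g': "L2_deriv g g'" "g' \<in> L2_space" "L2_norm g' \<le> B"
    using 0(2) by (auto simp: Sobolev_le_Suc Sobolev_le_0)
  have f1: "Sobolev_le 1 f A" and g1: "Sobolev_le 1 g B" using 0 by auto
  note fA = Sobolev_leD[OF f1] and gB = Sobolev_leD[OF g1]
  note 1 = L2_mult_Sobolev[OF f1 gB(1,2)] and 2 = L2_mult_Sobolev[OF f1 g'(2,3)]
    and 3 = L2_mult_Sobolev[OF g1 f'(2,3)]
  have AB: "0 \<le> A * B" using fA gB by simp
  have "(\<lambda>x. f' x * g x) \<in> L2_space" using 3(1) by (simp add: mult.commute)
  from L2_norm_triangle[OF this 2(1)]
  have "L2_norm (\<lambda>x. f' x * g x + f x * g' x) \<le> L2_norm (\<lambda>x. f' x * g x) + L2_norm (\<lambda>x. f x * g' x)" .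
  moreover have "L2_norm (\<lambda>x. f' x * g x) \<le> 2 * (A * B)" using 3(2) by (simp add: ac_simps)
  moreover have "L2_norm (\<lambda>x. f x * g' x) \<le> 2 * (A * B)" using 2(2) by (simp add: ac_simps)
  ultimately have 4: "L2_norm (\<lambda>x. f' x * g x + f x * g' x) \<le> 4 * (A * B)" by linarith
  have "(\<lambda>x. f' x * g x + f x * g' x) \<in> L2_space"
    using L2_deriv_mult[OF f'(1) g'(1)] by (rule L2_derivD)
  then show ?case
    using L2_deriv_mult[OF f'(1) g'(1)] 1(2) 4 AB
    by (auto simp: Sobolev_le_Suc Sobolev_le_0 intro!: exI[of _ "\<lambda>x. f' x * g x + f x * g' x"])
next
  case (Suc m)
  obtain f' where f': "L2_deriv f f'" "Sobolev_le (Suc m) f' A"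
    using Suc.prems(1) by (subst (asm) Sobolev_le_Suc) auto
  obtain g' where g': "L2_deriv g g'" "Sobolev_le (Suc m) g' B"
    using Suc.prems(2) by (subst (asm) Sobolev_le_Suc) auto
  have f1: "Sobolev_le (Suc m) f A" "Sobolev_le 1 f A"
    by (rule Sobolev_le_mono[OF Suc.prems(1)]; simp)+
  have g1: "Sobolev_le (Suc m) g B" "Sobolev_le 1 g B"
    by (rule Sobolev_le_mono[OF Suc.prems(2)]; simp)+
  note fA = Sobolev_leD[OF f1(2)] and gB = Sobolev_leD[OF g1(2)]
  have AB: "0 \<le> A * B" using fA gB by simp
  have "Sobolev_le (Suc m) (\<lambda>x. f' x * g x + f x * g' x) (4 ^ Suc m * (A * B) + 4 ^ Suc m * (A * B))"
    by (intro Sobolev_le_add Suc.IH f' g' f1 g1)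
  moreover have "4 ^ Suc m * (A * B) + 4 ^ Suc m * (A * B) \<le> 4 ^ Suc (Suc m) * (A * B)"
  proof -
    have "0 \<le> 4 ^ Suc m * (A * B)" by (rule mult_nonneg_nonneg[OF _ AB]) simp
    then show ?thesis by (simp only: power_Suc[of 4 "Suc m"] mult.assoc)
  qed
  ultimately have 1: "Sobolev_le (Suc m) (\<lambda>x. f' x * g x + f x * g' x) (4 ^ Suc (Suc m) * (A * B))"
    by (rule Sobolev_le_mono[OF _ order_refl])
  have "L2_norm (\<lambda>x. f x * g x) \<le> 2 * (A * B)"
    using L2_mult_Sobolev(2)[OF f1(2) gB(1,2)] by simp
  also have "\<dots> \<le> 4 ^ Suc (Suc m) * (A * B)"
  by (rule mult_right_mono[OF two_le_four_power AB])
  finally show ?case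
    using 1 L2_deriv_mult[OF f'(1) g'(1)] by (subst Sobolev_le_Suc) blast
qed

lemma Sobolev_le_power:
  assumes "Sobolev_le (Suc m) f A"
  shows "Sobolev_le (Suc m) (\<lambda>x. f x ^ Suc k) ((4 ^ Suc m) ^ k * A ^ Suc k)"
proof (induction k)
  case (Suc k)
  show ?case using Sobolev_le_mult[OF assms Suc] by (simp add: ac_simps)
qed (use assms in simp)

text \<open>
  Leibniz rule with the top order term split off: \<open>\<partial>\<^sup>m (a b) = a \<partial>\<^sup>m b + R\<close>, where the remainder \<open>R\<close>
  is one derivative better than \<open>\<partial>\<^sup>m b\<close>. From \<open>(a b)' = a' b + a b'\<close> the remainder of order \<open>m + 1\<close>
  for \<open>b\<close> is \<open>\<partial>\<^sup>m (a' b)\<close>, which is in \<open>H\<^sup>1\<close> by the algebra property, plus the remainder of order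
  \<open>m\<close> for \<open>b'\<close>.
\<close>

lemma Leibniz_top_order:
  assumes "Sobolev_le (Suc m) a A" "deriv_chain m D" "\<And>j. j \<le> m \<Longrightarrow> L2_norm (D j) \<le> B"
  shows "\<exists>E R. E 0 = (\<lambda>x. a x * D 0 x) \<and> deriv_chain m E \<and> (\<forall>j\<le>m. L2_norm (E j) \<le> 4 ^ Suc m * (A * B))
    \<and> E m = (\<lambda>x. a x * D m x + R x) \<and> Sobolev_le 1 R (4 ^ Suc m * (A * B))"
  using assms
proof (induction m arbitrary: D)
  case 0
  have a1: "Sobolev_le 1 a A" using 0(1) by simp
  have D0: "D 0 \<in> L2_space" "L2_norm (D 0) \<le> B" using 0 by (auto simp: deriv_chain_def)
  have "0 \<le> A" using Sobolev_leD[OF a1] by simp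
  moreover have "0 \<le> B" using D0(2) L2_norm_nonneg[of "D 0"] by linarith
  ultimately have AB: "0 \<le> A * B" by simp
  note p = L2_mult_Sobolev[OF a1 D0]
  have "L2_deriv (\<lambda>x. 0) (\<lambda>x. 0)" by (simp add: L2_deriv_def L2_zero)
  moreover have "L2_norm (\<lambda>x. 0) = 0" by (simp add: L2_norm_def)
  ultimately have "Sobolev_le 1 (\<lambda>x. 0) (4 * (A * B))"
    using AB by (auto simp: Sobolev_le_Suc Sobolev_le_0 L2_zero intro!: exI[of _ "\<lambda>x. 0"])
  then show ?case
    using p AB by (intro exI[of _ "\<lambda>j x. a x * D 0 x"] exI[of _ "\<lambda>x. 0"]) (auto simp: deriv_chain_def)
next
  case (Suc m)
  obtain a' where a': "L2_deriv a a'" "Sobolev_le (Suc m) a' A"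
    using Suc.prems(1) by (subst (asm) Sobolev_le_Suc) auto
  have a1: "Sobolev_le (Suc m) a A" "Sobolev_le 1 a A"
    by (rule Sobolev_le_mono[OF Suc.prems(1)]; simp)+
  have D0: "D 0 \<in> L2_space" "L2_norm (D 0) \<le> B" "L2_deriv (D 0) (D 1)"
    using Suc.prems by (auto simp: deriv_chain_def)
  have b: "Sobolev_le (Suc m) (D 0) B"
    unfolding Sobolev_le_def using Suc.prems by auto
  have "0 \<le> A" using Sobolev_leD[OF a1(1)] by simp
  moreover have "0 \<le> B" using Sobolev_leD[OF b] by simp
  ultimately have AB: "0 \<le> A * B" by simp
  obtain E1 R1 where E1: "E1 0 = (\<lambda>x. a x * D (Suc 0) x)" "deriv_chain m E1"
      "\<forall>j\<le>m. L2_norm (E1 j) \<le> 4 ^ Suc m * (A * B)"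
      "E1 m = (\<lambda>x. a x * D (Suc m) x + R1 x)" and R1: "Sobolev_le 1 R1 (4 ^ Suc m * (A * B))"
    using Suc.IH[OF a1(1) deriv_chain_tail[OF Suc.prems(2)]] Suc.prems(3) by auto
  obtain E2 where E2: "E2 0 = (\<lambda>x. a' x * D 0 x)" "deriv_chain (Suc m) E2"
      "\<forall>j\<le>Suc m. L2_norm (E2 j) \<le> 4 ^ Suc m * (A * B)"
    using Sobolev_le_mult[OF a'(2) b] by (auto simp: Sobolev_le_def)
  define E where "E = case_nat (\<lambda>x. a x * D 0 x) (\<lambda>j x. E2 j x + E1 j x)"
  have "L2_deriv (\<lambda>x. a x * D 0 x) (\<lambda>x. E2 0 x + E1 0 x)"
    using L2_deriv_mult[OF a'(1) D0(3)] unfolding E1 E2 by simp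
  moreover have "deriv_chain m (\<lambda>j x. E2 j x + E1 j x)"
    using E1(2) E2(2) by (auto simp: deriv_chain_def intro: L2_add L2_deriv_add)
  ultimately have chain: "deriv_chain (Suc m) E"
    unfolding E_def by (rule deriv_chain_Cons)
  have "0 \<le> 4 ^ Suc m * (A * B)" by (rule mult_nonneg_nonneg[OF _ AB]) simp
  then have four: "4 ^ Suc m * (A * B) + 4 ^ Suc m * (A * B) \<le> 4 ^ Suc (Suc m) * (A * B)"
    by (simp only: power_Suc[of 4 "Suc m"] mult.assoc)
  have bd: "L2_norm (E j) \<le> 4 ^ Suc (Suc m) * (A * B)" if j: "j \<le> Suc m" for j
  proof (cases j)
    case 0
    have "L2_norm (\<lambda>x. a x * D 0 x) \<le> 2 * (A * B)"
      using L2_mult_Sobolev(2)[OF a1(2) D0(1,2)] by simp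
    also have "\<dots> \<le> 4 ^ Suc (Suc m) * (A * B)"
  by (rule mult_right_mono[OF two_le_four_power AB])
    finally show ?thesis by (simp add: 0 E_def)
  next
    case (Suc i)
    then have i: "i \<le> m" using j by simp
    have "L2_norm (\<lambda>x. E2 i x + E1 i x) \<le> L2_norm (E2 i) + L2_norm (E1 i)"
      using E1(2) E2(2) i by (intro L2_norm_triangle) (auto simp: deriv_chain_def)
    also have "\<dots> \<le> 4 ^ Suc m * (A * B) + 4 ^ Suc m * (A * B)"
      using E1(3) E2(3) i by (intro add_mono) auto
    also have "\<dots> \<le> 4 ^ Suc (Suc m) * (A * B)" by (rule four)
    finally show ?thesis by (simp add: Suc E_def)
  qed
  have "Sobolev_le 1 (E2 m) (4 ^ Suc m * (A * B))"
    using E2(2,3) by (auto simp: Sobolev_le_Suc Sobolev_le_0 deriv_chain_def intro!: exI[of _ "E2 (Suc m)"])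
  from Sobolev_le_mono[OF Sobolev_le_add[OF this R1] order_refl four]
  have R: "Sobolev_le 1 (\<lambda>x. E2 m x + R1 x) (4 ^ Suc (Suc m) * (A * B))" .
  have top: "E (Suc m) = (\<lambda>x. a x * D (Suc m) x + (E2 m x + R1 x))"
    by (auto simp: E_def E1)
  have bot: "E 0 = (\<lambda>x. a x * D 0 x)" by (simp add: E_def)
  show ?case
    by (intro exI[of _ E] exI[of _ "\<lambda>x. E2 m x + R1 x"] conjI allI impI bot chain bd top R)
qed

lemma deriv_chain_has_weak_deriv:
  assumes "deriv_chain m D" "j \<le> m"
  shows "has_weak_deriv j (D 0) (D j)"
  using assms(2)
proof (induction j)
  case 0
  then show ?case using assms(1) by (auto simp: has_weak_deriv_def deriv_chain_def intro: locally_integrable_L2)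
next
  case (Suc j)
  then have IH: "has_weak_deriv j (D 0) (D j)" by simp
  have d: "L2_deriv (D j) (D (Suc j))" using assms(1) Suc.prems by (auto simp: deriv_chain_def)
  have "(\<integral>x. D 0 x * (deriv ^^ Suc j) \<phi> x \<partial>lborel) = (-1) ^ Suc j * (\<integral>x. D (Suc j) x * \<phi> x \<partial>lborel)"
    if \<phi>: "\<phi> \<in> test_functions" for \<phi>
  proof -
    have "(\<integral>x. D 0 x * (deriv ^^ j) (deriv \<phi>) x \<partial>lborel) = (-1) ^ j * (\<integral>x. D j x * deriv \<phi> x \<partial>lborel)"
      using IH test_function_deriv1[OF \<phi>] by (auto simp: has_weak_deriv_def)
    moreover have "(deriv ^^ j) (deriv \<phi>) = (deriv ^^ Suc j) \<phi>" by (simp add: funpow_swap1)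
    moreover have "(\<integral>x. D j x * deriv \<phi> x \<partial>lborel) = - (\<integral>x. D (Suc j) x * \<phi> x \<partial>lborel)"
      using d \<phi> by (auto simp: L2_deriv_def)
    ultimately show ?thesis by simp
  qed
  then show ?case
    using locally_integrable_L2[OF L2_derivD(2)[OF d]] IH by (simp add: has_weak_deriv_def)
qed

lemma weak_deriv_AE_eq:
  assumes "has_weak_deriv j f g"
  shows "has_weak_deriv j f (weak_deriv j f)" "AE x in lborel. weak_deriv j f x = g x"
proof -
  show 1: "has_weak_deriv j f (weak_deriv j f)"
    unfolding weak_deriv_def by (rule someI[of "has_weak_deriv j f", OF assms])
  show "AE x in lborel. weak_deriv j f x = g x" by (rule weak_deriv_AE_unique[OF 1 assms])
qed

lemma weak_deriv_measurable:
  assumes "has_weak_deriv j f g" shows "weak_deriv j f \<in> borel_measurable borel"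
  by (rule borel_measurable_locally_integrable)
    (use weak_deriv_AE_eq(1)[OF assms] in \<open>simp add: has_weak_deriv_def\<close>)

lemma L2_norm_weak_deriv:
  assumes "has_weak_deriv j f g" "g \<in> L2_space"
  shows "weak_deriv j f \<in> L2_space" "L2_norm (weak_deriv j f) = L2_norm g"
proof -
  note ae = weak_deriv_AE_eq(2)[OF assms(1)] and m = weak_deriv_measurable[OF assms(1)]
  show "L2_norm (weak_deriv j f) = L2_norm g"
    by (rule L2_norm_cong_AE[OF m borel_measurable_L2[OF assms(2)] ae])
  show "weak_deriv j f \<in> L2_space"
    by (rule L2_norm_mono_AE(1)[OF assms(2) m]) (use ae in \<open>auto elim!: eventually_mono\<close>)
qed

lemma H_norm_deriv_chain:
  assumes "deriv_chain m D" shows "H_norm m (D 0) = sqrt (\<Sum>j\<le>m. (L2_norm (D j))\<^sup>2)"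
proof -
  have "L2_norm (weak_deriv j (D 0)) = L2_norm (D j)" if "j \<le> m" for j
    using assms that by (intro L2_norm_weak_deriv deriv_chain_has_weak_deriv) (auto simp: deriv_chain_def)
  then show ?thesis by (simp add: H_norm_def)
qed

text \<open>
  The function \<open>weak_deriv 0 f\<close> agrees with \<open>f\<close> only almost everywhere, so \<open>f\<close> itself is put at the
  head of the chain.
\<close>

definition derivs :: "(real \<Rightarrow> real) \<Rightarrow> nat \<Rightarrow> real \<Rightarrow> real" where
  "derivs f j = (if j = 0 then f else weak_deriv j f)"

lemma derivs_simps [simp]: "derivs f 0 = f" "derivs f (Suc j) = weak_deriv (Suc j) f"
  by (simp_all add: derivs_def)

lemma deriv_chain_derivs:
  assumes f: "f \<in> H_space m" shows "deriv_chain m (derivs f)"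
proof -
  have f2: "f \<in> L2_space" using f by (simp add: H_space_def)
  have w: "has_weak_deriv j f (derivs f j)" "derivs f j \<in> L2_space" if j: "j \<le> m" for j
  proof -
    obtain g where g: "g \<in> L2_space" "has_weak_deriv j f g" using f j by (auto simp: H_space_def)
    show "derivs f j \<in> L2_space" using L2_norm_weak_deriv(1)[OF g(2,1)] f2 by (simp add: derivs_def)
    show "has_weak_deriv j f (derivs f j)"
    proof (cases "j = 0")
      case True
      then show ?thesis using locally_integrable_L2[OF f2] by (simp add: has_weak_deriv_def)
    next
      case False
      then show ?thesis using weak_deriv_AE_eq(1)[OF g(2)] by (simp add: derivs_def)
    qed
  qed
  have "L2_deriv (derivs f j) (derivs f (Suc j))" if j: "j < m" for j
    unfolding L2_deriv_def
  proof (intro conjI ballI)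
    show "derivs f j \<in> L2_space" "derivs f (Suc j) \<in> L2_space" by (rule w(2), use j in simp)+
    fix \<phi> assume \<phi>: "\<phi> \<in> test_functions"
    have "(\<integral>x. f x * (deriv ^^ j) (deriv \<phi>) x \<partial>lborel) = (-1) ^ j * (\<integral>x. derivs f j x * deriv \<phi> x \<partial>lborel)"
      using w(1)[of j] j test_function_deriv1[OF \<phi>] by (auto simp: has_weak_deriv_def)
    moreover have "(\<integral>x. f x * (deriv ^^ Suc j) \<phi> x \<partial>lborel)
        = (-1) ^ Suc j * (\<integral>x. derivs f (Suc j) x * \<phi> x \<partial>lborel)"
      using w(1)[of "Suc j"] j \<phi> unfolding has_weak_deriv_def by simp
    moreover have "(deriv ^^ j) (deriv \<phi>) = (deriv ^^ Suc j) \<phi>" by (simp add: funpow_swap1)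
    ultimately have "(-1) ^ j * (\<integral>x. derivs f j x * deriv \<phi> x \<partial>lborel)
        = (-1) ^ j * (- (\<integral>x. derivs f (Suc j) x * \<phi> x \<partial>lborel))" by simp
    then show "(\<integral>x. derivs f j x * deriv \<phi> x \<partial>lborel) = - (\<integral>x. derivs f (Suc j) x * \<phi> x \<partial>lborel)"
      unfolding mult_cancel_left by simp
  qed
  then show ?thesis using w by (simp add: deriv_chain_def)
qed

lemma H_norm_nonneg [simp]: "0 \<le> H_norm m f"
  by (simp add: H_norm_def sum_nonneg)

lemma L2_norm_le_H_norm:
  assumes "deriv_chain m D" "j \<le> m" shows "L2_norm (D j) \<le> H_norm m (D 0)"
proof -
  have "(L2_norm (D j))\<^sup>2 \<le> (\<Sum>j\<le>m. (L2_norm (D j))\<^sup>2)"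
    using assms(2) by (intro member_le_sum) auto
  then show ?thesis unfolding H_norm_deriv_chain[OF assms(1)] by (rule real_le_rsqrt)
qed

lemma H_norm_le_sum:
  assumes "deriv_chain m D" shows "H_norm m (D 0) \<le> (\<Sum>j\<le>m. L2_norm (D j))"
  unfolding H_norm_deriv_chain[OF assms] by (intro L2_set_le_sum[unfolded L2_set_def]) auto

lemma locally_integrable_cong_AE:
  assumes m: "f \<in> borel_measurable borel" "g \<in> borel_measurable borel" and ae: "AE x in lborel. f x = g x"
  shows "locally_integrable f \<longleftrightarrow> locally_integrable g"
proof -
  have "set_integrable lborel {a..b} f \<longleftrightarrow> set_integrable lborel {a..b} g" for a b
    unfolding set_integrable_def using m ae by (intro integrable_cong_AE) (auto elim!: eventually_mono)
  then show ?thesis by (simp add: locally_integrable_def)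
qed

lemma H_norm_cong_AE:
  assumes m: "f \<in> borel_measurable borel" "g \<in> borel_measurable borel" and ae: "AE x in lborel. f x = g x"
  shows "H_norm s f = H_norm s g"
proof -
  have "(\<integral>x. f x * (deriv ^^ j) \<phi> x \<partial>lborel) = (\<integral>x. g x * (deriv ^^ j) \<phi> x \<partial>lborel)"
    if "\<phi> \<in> test_functions" for j \<phi>
    using m ae kernel_measurable[OF kernel_deriv_test_function[OF that, of j]]
    by (intro integral_cong_AE) (auto elim!: eventually_mono)
  then have "has_weak_deriv j f = has_weak_deriv j g" for j
    using locally_integrable_cong_AE[OF assms] by (auto simp: has_weak_deriv_def fun_eq_iff)
  then show ?thesis by (simp add: H_norm_def weak_deriv_def)
qed

section \<open>Energy growth for dispersive evolutions\<close>

lemma Lipschitz_bound_if_locally: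
  fixes F :: "real \<Rightarrow> real"
  assumes loc: "\<And>t e. t \<in> {0..T} \<Longrightarrow> e > 0 \<Longrightarrow>
      \<exists>d>0. \<forall>s\<in>{0..T}. \<bar>s - t\<bar> < d \<longrightarrow> \<bar>F s - F t\<bar> \<le> (A + e) * \<bar>s - t\<bar>"
    and t: "t \<in> {0..T}"
  shows "\<bar>F t - F 0\<bar> \<le> A * t"
proof (rule field_le_epsilon)
  fix e :: real assume e: "0 < e"
  define e' where "e' = e / (t + 1)"
  have e': "e' > 0" using e t by (simp add: e'_def)
  define P where "P a b \<longleftrightarrow> (0 \<le> a \<and> b \<le> T \<longrightarrow> \<bar>F b - F a\<bar> \<le> (A + e') * (b - a))" for a b
  have "P 0 t"
  proof (rule Bolzano)
    show "0 \<le> t" using t by simp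
  next
    fix a b c assume trans: "P a b" "P b c" "a \<le> b" "b \<le> c"
    show "P a c"
      unfolding P_def
    proof
      assume "0 \<le> a \<and> c \<le> T"
      then have "\<bar>F b - F a\<bar> \<le> (A + e') * (b - a)" "\<bar>F c - F b\<bar> \<le> (A + e') * (c - b)"
        using trans by (auto simp: P_def)
      then have "\<bar>F c - F a\<bar> \<le> (A + e') * (b - a) + (A + e') * (c - b)" by linarith
      then show "\<bar>F c - F a\<bar> \<le> (A + e') * (c - a)" by (simp add: algebra_simps)
    qed
  next
    fix x assume "0 \<le> x" "x \<le> t"
    then have "x \<in> {0..T}" using t by auto
    from loc[OF this e'] obtain d where d: "d > 0"
      and D: "\<And>s. s \<in> {0..T} \<Longrightarrow> \<bar>s - x\<bar> < d \<Longrightarrow> \<bar>F s - F x\<bar> \<le> (A + e') * \<bar>s - x\<bar>" by blast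
    show "\<exists>d>0. \<forall>a b. a \<le> x \<and> x \<le> b \<and> b - a < d \<longrightarrow> P a b"
      unfolding P_def
    proof (intro exI[of _ d] conjI d allI impI; elim conjE)
      fix a b assume ab: "a \<le> x" "x \<le> b" "b - a < d" and r: "0 \<le> a" "b \<le> T"
      have "\<bar>F a - F x\<bar> \<le> (A + e') * (x - a)" "\<bar>F b - F x\<bar> \<le> (A + e') * (b - x)"
        using D[of a] D[of b] ab r by auto
      then have "\<bar>F b - F a\<bar> \<le> (A + e') * (x - a) + (A + e') * (b - x)" by linarith
      then show "\<bar>F b - F a\<bar> \<le> (A + e') * (b - a)" by (simp add: algebra_simps)
    qed
  qed
  then have "\<bar>F t - F 0\<bar> \<le> A * t + e' * t" using t by (simp add: P_def algebra_simps)
  moreover have "e' * t \<le> e" using e t by (simp add: e'_def field_simps)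
  ultimately show "\<bar>F t - F 0\<bar> \<le> A * t + e" by linarith
qed

lemma mvt_two_points:
  fixes h :: "real \<Rightarrow> real"
  assumes d: "\<And>\<tau>. \<tau> \<in> {0..T} \<Longrightarrow> (h has_real_derivative h' \<tau>) (at \<tau> within {0..T})"
    and st: "s \<in> {0..T}" "t \<in> {0..T}"
  shows "\<exists>\<tau>\<in>{0..T}. \<bar>\<tau> - t\<bar> \<le> \<bar>s - t\<bar> \<and> h s - h t = (s - t) * h' \<tau>"
proof -
  have *: "\<exists>\<tau>\<in>{0..T}. a \<le> \<tau> \<and> \<tau> \<le> b \<and> h b - h a = (b - a) * h' \<tau>"
    if ab: "a < b" "a \<in> {0..T}" "b \<in> {0..T}" for a b
  proof -
    have "\<exists>\<tau>\<in>{a<..<b}. h b - h a = (\<lambda>x. h' \<tau> * x) (b - a)"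
    proof (rule mvt_simple[OF ab(1)])
      fix x assume "a \<le> x" "x \<le> b"
      then have "(h has_real_derivative h' x) (at x within {0..T})" using ab by (intro d) auto
      then have "(h has_real_derivative h' x) (at x within {a..b})"
        by (rule DERIV_subset) (use ab in auto)
      then show "(h has_derivative (\<lambda>y. h' x * y)) (at x within {a..b})"
        by (simp add: has_field_derivative_def)
    qed
    then obtain \<tau> where "\<tau> \<in> {a<..<b}" "h b - h a = h' \<tau> * (b - a)" by auto
    then show ?thesis using ab by (intro bexI[of _ \<tau>]) auto
  qed
  consider "s = t" | "s < t" | "t < s" by linarith
  then show ?thesis
  proof cases
    case 1 then show ?thesis using st by (intro bexI[of _ t]) auto
  next
    case 2
    from *[OF 2 st] obtain \<tau> where "\<tau> \<in> {0..T}" "s \<le> \<tau>" "\<tau> \<le> t" "h t - h s = (t - s) * h' \<tau>" by blast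
    then show ?thesis by (intro bexI[of _ \<tau>]) (auto simp: algebra_simps)
  next
    case 3
    from *[OF 3 st(2,1)] obtain \<tau> where "\<tau> \<in> {0..T}" "t \<le> \<tau>" "\<tau> \<le> s" "h s - h t = (s - t) * h' \<tau>" by blast
    then show ?thesis by (intro bexI[of _ \<tau>]) auto
  qed
qed

lemma L2_truncate:
  assumes f: "f \<in> L2_space" and e: "e > 0"
  obtains g S where "g \<in> L2_space" "\<And>x. S < \<bar>x\<bar> \<Longrightarrow> g x = 0" "L2_norm (\<lambda>x. f x - g x) < e"
proof -
  obtain g where g: "kernel g" "L2_norm (\<lambda>x. f x - g x) < e"
    using L2_dense_kernel[OF f e] by blast
  obtain S where "\<And>x. S < \<bar>x\<bar> \<Longrightarrow> g x = 0" using kernel_support[OF g(1)] by blast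
  with g show ?thesis by (intro that[of g S] kernel_L2) auto
qed

text \<open>
  The equation \<open>v\<^sub>t + v\<^sub>x\<^sub>x\<^sub>x + N = 0\<close> in the sense of distributions in space, at each time. The source is
  merely bounded in \<open>L\<^sup>2\<close>. Solutions of the generalised KdV equation
  and differences of two of them are both of this kind.
\<close>

locale dispersive_evolution =
  fixes T :: real and v N :: "real \<Rightarrow> real \<Rightarrow> real" and M :: real
  assumes v: "\<And>t. t \<in> {0..T} \<Longrightarrow> v t \<in> L2_space"
    and N: "\<And>t. t \<in> {0..T} \<Longrightarrow> N t \<in> L2_space" "\<And>t. t \<in> {0..T} \<Longrightarrow> L2_norm (N t) \<le> M"
    and cont: "\<And>t. t \<in> {0..T} \<Longrightarrow>
      ((\<lambda>\<tau>. L2_norm (\<lambda>x. v \<tau> x - v t x)) \<longlongrightarrow> 0) (at t within {0..T})"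
    and evol: "\<And>\<phi> t. \<phi> \<in> test_functions \<Longrightarrow> t \<in> {0..T} \<Longrightarrow>
      ((\<lambda>\<tau>. \<integral>x. v \<tau> x * \<phi> x \<partial>lborel) has_real_derivative
        (\<integral>x. v t x * (deriv ^^ 3) \<phi> x \<partial>lborel) - (\<integral>x. N t x * \<phi> x \<partial>lborel)) (at t within {0..T})"
begin

text \<open>
  By symmetry of the form, the increment of the energy between \<open>t\<close> and \<open>s\<close> is the pairing of
  \<open>v s - v t\<close> with the smooth function \<open>K * (v s + v t)\<close>. The mean value theorem, applied with this
  function held fixed, evaluates the equation at an intermediate time \<open>\<tau>\<close>, where \<open>v s + v t\<close> is close to
  \<open>2 v \<tau>\<close>. With \<open>2 v \<tau>\<close> in its place the dispersive term vanishes, because \<open>K'''\<close> is odd, and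
  the source contributes at most \<open>2 A \<bar>s - t\<bar>\<close>.
\<close>

lemma conv_form_increment_bound:
  assumes K: "K \<in> test_functions" and even: "\<And>z. K (- z) = K z"
    and A: "\<And>t. t \<in> {0..T} \<Longrightarrow> \<bar>conv_form K (N t) (v t)\<bar> \<le> A"
    and t: "t \<in> {0..T}" and s: "s \<in> {0..T}"
    and \<delta>: "0 < \<delta>" "\<delta> \<le> 1"
    and close: "\<And>\<tau>. \<tau> \<in> {0..T} \<Longrightarrow> \<bar>\<tau> - t\<bar> \<le> \<bar>s - t\<bar> \<Longrightarrow> L2_norm (\<lambda>x. v \<tau> x - v t x) \<le> \<delta>"
    and \<eta>: "0 < \<eta>" "\<eta> \<le> \<delta>"
  shows "\<bar>conv_form K (v s) (v s) - conv_form K (v t) (v t)\<bar>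
    \<le> \<bar>s - t\<bar> * (2 * A + 4 * \<delta> * (L1_norm ((deriv ^^ 3) K) * (L2_norm (v t) + 1) + L1_norm K * M))
      + L1_norm K * \<eta>"
proof -
  let ?K3 = "(deriv ^^ 3) K"
  have k: "kernel K" by (rule kernel_test_function[OF K])
  have k3: "kernel ?K3" by (rule kernel_deriv_test_function[OF K])
  have odd3: "?K3 (- z) = - ?K3 z" for z using deriv_parity[OF K even, of 3 z] by simp
  note vs = v[OF s] and vt = v[OF t]
  define f where "f = (\<lambda>x. v t x + v s x)"
  have f: "f \<in> L2_space" unfolding f_def by (intro L2_add vs vt)
  \<comment> \<open>A bounded support of \<open>g\<close> is needed for \<open>K * g\<close> to be a test function; \<open>\<eta>\<close> bounds the error.\<close>
  obtain g S where g: "g \<in> L2_space" and S: "\<And>x. S < \<bar>x\<bar> \<Longrightarrow> g x = 0"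
    and fg: "L2_norm (\<lambda>x. f x - g x) < \<eta>"
    using L2_truncate[OF f \<eta>(1)] by blast
  define w where "w = (\<lambda>x. v s x - v t x)"
  have w: "w \<in> L2_space" unfolding w_def by (intro L2_diff vs vt)
  have ws: "L2_norm w \<le> \<delta>" unfolding w_def using close[OF s] by simp
  have sym: "conv_form K (v s) (v t) = conv_form K (v t) (v s)"
    using conv_form_swap[OF k vs vt] by (simp add: even)
  have "conv_form K (v s) (v s) - conv_form K (v t) (v t) = conv_form K w f"
    unfolding w_def f_def using sym vs vt k
    by (simp add: conv_form_diff_left conv_form_add_right L2_add)
  also have "\<dots> = conv_form K w g + conv_form K w (\<lambda>x. f x - g x)"
    using conv_form_diff_right[OF k f g w] by simp
  finally have split: "conv_form K (v s) (v s) - conv_form K (v t) (v t)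
      = conv_form K w g + conv_form K w (\<lambda>x. f x - g x)" .
  have rest: "\<bar>conv_form K w (\<lambda>x. f x - g x)\<bar> \<le> L1_norm K * \<eta>"
  proof -
    have "\<bar>conv_form K w (\<lambda>x. f x - g x)\<bar> \<le> L1_norm K * L2_norm w * L2_norm (\<lambda>x. f x - g x)"
      by (intro abs_conv_form_le k w L2_diff f g)
    also have "\<dots> \<le> L1_norm K * 1 * \<eta>"
      using ws \<delta> fg by (intro mult_mono) auto
    finally show ?thesis by simp
  qed
  define \<phi> where "\<phi> = conv K g"
  have \<phi>: "\<phi> \<in> test_functions" unfolding \<phi>_def by (rule test_function_conv[OF K g S])
  have \<phi>3: "(deriv ^^ 3) \<phi> = conv ?K3 g" unfolding \<phi>_def by (rule deriv_conv[OF K g])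
  define h where "h \<tau> = (\<integral>x. v \<tau> x * \<phi> x \<partial>lborel)" for \<tau>
  define h' where "h' \<tau> = conv_form ?K3 (v \<tau>) g - conv_form K (N \<tau>) g" for \<tau>
  have dh: "(h has_real_derivative h' \<tau>) (at \<tau> within {0..T})" if "\<tau> \<in> {0..T}" for \<tau>
    using evol[OF \<phi> that] unfolding h_def h'_def \<phi>3 by (simp add: conv_form_def \<phi>_def)
  obtain \<tau> where \<tau>: "\<tau> \<in> {0..T}" "\<bar>\<tau> - t\<bar> \<le> \<bar>s - t\<bar>" and mvt: "h s - h t = (s - t) * h' \<tau>"
    using mvt_two_points[OF dh s t] by blast
  have "\<phi> \<in> L2_space" by (rule kernel_L2[OF kernel_test_function[OF \<phi>]])
  then have "conv_form K w g = h s - h t"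
    using vs vt by (simp add: conv_form_def w_def h_def \<phi>_def left_diff_distrib integrable_mult_L2)
  then have wg: "conv_form K w g = (s - t) * h' \<tau>" using mvt by simp
  note v\<tau> = v[OF \<tau>(1)] and N\<tau> = N[OF \<tau>(1)]
  define q where "q = (\<lambda>x. g x - 2 * v \<tau> x)"
  have q: "q \<in> L2_space" unfolding q_def by (intro L2_diff g L2_cmult v\<tau>)
  have g_eq: "g = (\<lambda>x. 2 * v \<tau> x + q x)" by (simp add: q_def)
  have c\<tau>: "L2_norm (\<lambda>x. v \<tau> x - v t x) \<le> \<delta>" by (rule close[OF \<tau>])
  have q_le: "L2_norm q \<le> 4 * \<delta>"
  proof -
    have "q = (\<lambda>x. (g x - f x) + ((v s x - v t x) + (- 2) * (v \<tau> x - v t x)))"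
      by (auto simp: q_def f_def)
    moreover have "L2_norm (\<lambda>x. (g x - f x) + ((v s x - v t x) + (- 2) * (v \<tau> x - v t x)))
        \<le> L2_norm (\<lambda>x. g x - f x) + L2_norm (\<lambda>x. (v s x - v t x) + (- 2) * (v \<tau> x - v t x))"
      by (intro L2_norm_triangle L2_add L2_diff L2_cmult f g vs vt v\<tau>)
    moreover have "L2_norm (\<lambda>x. (v s x - v t x) + (- 2) * (v \<tau> x - v t x))
        \<le> L2_norm w + L2_norm (\<lambda>x. (- 2) * (v \<tau> x - v t x))"
      unfolding w_def by (intro L2_norm_triangle L2_diff L2_cmult vs vt v\<tau>)
    moreover have "L2_norm (\<lambda>x. (- 2) * (v \<tau> x - v t x)) = 2 * L2_norm (\<lambda>x. v \<tau> x - v t x)"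
      by (simp only: L2_norm_cmult)
    ultimately show ?thesis using fg ws c\<tau> \<eta> L2_norm_commute[of g f] by simp
  qed
  have v\<tau>_le: "L2_norm (v \<tau>) \<le> L2_norm (v t) + 1"
    using abs_L2_norm_diff_le[OF v\<tau> vt] c\<tau> \<delta> by linarith
  have "0 \<le> L2_norm (N \<tau>)" by simp
  then have M: "0 \<le> M" using N\<tau>(2) by linarith
  have disp: "\<bar>conv_form ?K3 (v \<tau>) g\<bar> \<le> 4 * \<delta> * (L1_norm ?K3 * (L2_norm (v t) + 1))"
  proof -
    have "conv_form ?K3 (v \<tau>) g = 2 * conv_form ?K3 (v \<tau>) (v \<tau>) + conv_form ?K3 (v \<tau>) q"
      unfolding g_eq using conv_form_add_right[OF k3 L2_cmult[OF v\<tau>, of 2] q v\<tau>]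
      by (simp add: conv_form_cmult_right)
    then have "\<bar>conv_form ?K3 (v \<tau>) g\<bar> = \<bar>conv_form ?K3 (v \<tau>) q\<bar>"
      by (simp add: conv_form_odd_kernel[OF k3 odd3 v\<tau>])
    also have "\<dots> \<le> L1_norm ?K3 * L2_norm (v \<tau>) * L2_norm q" by (rule abs_conv_form_le[OF k3 v\<tau> q])
    also have "\<dots> \<le> L1_norm ?K3 * (L2_norm (v t) + 1) * (4 * \<delta>)"
      using v\<tau>_le q_le by (intro mult_mono) auto
    finally show ?thesis by (simp add: ac_simps)
  qed
  have nonlin: "\<bar>conv_form K (N \<tau>) g\<bar> \<le> 2 * A + 4 * \<delta> * (L1_norm K * M)"
  proof -
    have "conv_form K (N \<tau>) g = 2 * conv_form K (N \<tau>) (v \<tau>) + conv_form K (N \<tau>) q"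
      unfolding g_eq using conv_form_add_right[OF k L2_cmult[OF v\<tau>, of 2] q N\<tau>(1)]
      by (simp add: conv_form_cmult_right)
    moreover have "\<bar>conv_form K (N \<tau>) q\<bar> \<le> L1_norm K * L2_norm (N \<tau>) * L2_norm q"
      by (rule abs_conv_form_le[OF k N\<tau>(1) q])
    moreover have "\<dots> \<le> L1_norm K * M * (4 * \<delta>)"
      using N\<tau>(2) q_le M by (intro mult_mono) auto
    ultimately show ?thesis using A[OF \<tau>(1)] by (simp add: ac_simps)
  qed
  have "\<bar>h' \<tau>\<bar> \<le> 2 * A + 4 * \<delta> * (L1_norm ?K3 * (L2_norm (v t) + 1) + L1_norm K * M)"
    unfolding h'_def using disp nonlin by (simp add: distrib_left)
  then have "\<bar>conv_form K w g\<bar> \<le> \<bar>s - t\<bar> *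
      (2 * A + 4 * \<delta> * (L1_norm ?K3 * (L2_norm (v t) + 1) + L1_norm K * M))"
    unfolding wg abs_mult by (rule mult_left_mono) simp
  then show ?thesis unfolding split using rest by linarith
qed

text \<open>
  The energy need not be differentiable in time, as the source may jump; it is locally Lipschitz
  with constant \<open>2 A\<close> up to an arbitrarily small error, which suffices.
\<close>

lemma conv_form_growth:
  assumes K: "K \<in> test_functions" and even: "\<And>z. K (- z) = K z"
    and A: "\<And>t. t \<in> {0..T} \<Longrightarrow> \<bar>conv_form K (N t) (v t)\<bar> \<le> A"
    and t: "t \<in> {0..T}"
  shows "\<bar>conv_form K (v t) (v t) - conv_form K (v 0) (v 0)\<bar> \<le> 2 * A * t"
proof (rule Lipschitz_bound_if_locally[OF _ t])
  fix t e :: real assume t: "t \<in> {0..T}" and e: "e > 0"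
  define C where "C = L1_norm ((deriv ^^ 3) K) * (L2_norm (v t) + 1) + L1_norm K * M"
  have "0 \<le> L2_norm (N t)" by simp
  then have "0 \<le> M" using N(2)[OF t] by linarith
  then have C: "0 \<le> C" by (simp add: C_def)
  define \<delta> where "\<delta> = min 1 (e / (8 * (C + 1)))"
  have \<delta>: "0 < \<delta>" "\<delta> \<le> 1" using e C by (auto simp: \<delta>_def)
  have \<delta>C: "4 * \<delta> * C \<le> e / 2"
  proof -
    have "4 * \<delta> * C \<le> 4 * (e / (8 * (C + 1))) * (C + 1)"
      using C e by (intro mult_mono) (auto simp: \<delta>_def)
    also have "\<dots> = e / 2" using C by (simp add: field_simps)
    finally show ?thesis .
  qed
  have "eventually (\<lambda>\<tau>. L2_norm (\<lambda>x. v \<tau> x - v t x) < \<delta>) (at t within {0..T})"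
    using cont[OF t] \<delta>(1) by (rule order_tendstoD)
  then obtain d where d: "d > 0"
    and D: "\<And>\<tau>. \<tau> \<in> {0..T} \<Longrightarrow> \<tau> \<noteq> t \<Longrightarrow> \<bar>\<tau> - t\<bar> < d \<Longrightarrow> L2_norm (\<lambda>x. v \<tau> x - v t x) < \<delta>"
    unfolding eventually_at dist_real_def by auto
  have D': "L2_norm (\<lambda>x. v \<tau> x - v t x) \<le> \<delta>" if "\<tau> \<in> {0..T}" "\<bar>\<tau> - t\<bar> < d" for \<tau>
    using D[OF that(1) _ that(2)] \<delta>(1) by (cases "\<tau> = t") (auto simp: L2_norm_def)
  show "\<exists>d>0. \<forall>s\<in>{0..T}. \<bar>s - t\<bar> < d \<longrightarrow>
      \<bar>conv_form K (v s) (v s) - conv_form K (v t) (v t)\<bar> \<le> (2 * A + e) * \<bar>s - t\<bar>"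
  proof (intro exI[of _ d] conjI d ballI impI)
    fix s assume s: "s \<in> {0..T}" and sd: "\<bar>s - t\<bar> < d"
    show "\<bar>conv_form K (v s) (v s) - conv_form K (v t) (v t)\<bar> \<le> (2 * A + e) * \<bar>s - t\<bar>"
    proof (cases "s = t")
      case False
      \<comment> \<open>The truncation error is not multiplied by \<open>\<bar>s - t\<bar>\<close>, so it is chosen after \<open>s\<close>.\<close>
      define \<eta> where "\<eta> = min \<delta> (\<bar>s - t\<bar> * (e / 2) / (L1_norm K + 1))"
      have L: "0 < L1_norm K + 1" using L1_norm_nonneg[of K] by linarith
      have \<eta>: "0 < \<eta>" "\<eta> \<le> \<delta>" using \<delta> e L False by (auto simp: \<eta>_def)
      have \<eta>L: "L1_norm K * \<eta> \<le> \<bar>s - t\<bar> * (e / 2)"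
      proof -
        have "L1_norm K * \<eta> \<le> (L1_norm K + 1) * (\<bar>s - t\<bar> * (e / 2) / (L1_norm K + 1))"
          using L \<eta>(1) by (intro mult_mono) (auto simp: \<eta>_def)
        also have "\<dots> = \<bar>s - t\<bar> * (e / 2)"
          using L by (metis nonzero_mult_div_cancel_left order_less_irrefl times_divide_eq_right)
        finally show ?thesis .
      qed
      have "\<bar>conv_form K (v s) (v s) - conv_form K (v t) (v t)\<bar>
          \<le> \<bar>s - t\<bar> * (2 * A + 4 * \<delta> * C) + L1_norm K * \<eta>"
        unfolding C_def
        by (rule conv_form_increment_bound[OF K even A t s \<delta> _ \<eta>]) (use sd D' in auto)
      also have "\<dots> \<le> \<bar>s - t\<bar> * (2 * A + e / 2) + \<bar>s - t\<bar> * (e / 2)"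
        using \<delta>C \<eta>L by (intro add_mono mult_left_mono) auto
      also have "\<dots> = (2 * A + e) * \<bar>s - t\<bar>" by (simp add: algebra_simps)
      finally show ?thesis .
    qed simp
  qed
qed

end

lemma conv_form_derivs_right:
  assumes "deriv_chain m E" "j \<le> m" "K \<in> test_functions"
  shows "conv_form ((deriv ^^ j) K) g (E 0) = conv_form K g (E j)"
  using assms(2,3)
proof (induction j arbitrary: K)
  case (Suc j)
  have "conv_form ((deriv ^^ Suc j) K) g (E 0) = conv_form ((deriv ^^ j) (deriv K)) g (E 0)"
    by (simp add: funpow_swap1)
  also have "\<dots> = conv_form (deriv K) g (E j)"
    using Suc by (intro Suc.IH test_function_deriv1) auto
  also have "\<dots> = conv_form K g (E (Suc j))"
    using Suc.prems assms(1) by (intro conv_form_deriv_right) (auto simp: deriv_chain_def)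
  finally show ?case .
qed simp

lemma conv_form_derivs_left:
  assumes "deriv_chain m D" "j \<le> m" "K \<in> test_functions" "g \<in> L2_space"
  shows "conv_form ((deriv ^^ j) K) (D 0) g = (-1) ^ j * conv_form K (D j) g"
  using assms(2,3)
proof (induction j arbitrary: K)
  case (Suc j)
  have "conv_form ((deriv ^^ Suc j) K) (D 0) g = conv_form ((deriv ^^ j) (deriv K)) (D 0) g"
    by (simp add: funpow_swap1)
  also have "\<dots> = (-1) ^ j * conv_form (deriv K) (D j) g"
    using Suc by (intro Suc.IH test_function_deriv1) auto
  also have "conv_form (deriv K) (D j) g = - conv_form K (D (Suc j)) g"
    using Suc.prems assms(1,4) by (intro conv_form_deriv_left) (auto simp: deriv_chain_def)
  finally show ?case by simp
qed simp

lemma conv_form_derivs: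
  assumes D: "deriv_chain m D" "i \<le> m" and E: "deriv_chain n E" "j \<le> n" and K: "K \<in> test_functions"
  shows "conv_form ((deriv ^^ (i + j)) K) (D 0) (E 0) = (-1) ^ i * conv_form K (D i) (E j)"
proof -
  have E0: "E 0 \<in> L2_space" using E by (auto simp: deriv_chain_def)
  have "conv_form ((deriv ^^ (i + j)) K) (D 0) (E 0) = conv_form ((deriv ^^ i) ((deriv ^^ j) K)) (D 0) (E 0)"
    by (simp add: funpow_add)
  also have "\<dots> = (-1) ^ i * conv_form ((deriv ^^ j) K) (D i) (E 0)"
    by (rule conv_form_derivs_left[OF D test_function_deriv[OF K] E0])
  also have "\<dots> = (-1) ^ i * conv_form K (D i) (E j)"
    by (simp add: conv_form_derivs_right[OF E K])
  finally show ?thesis .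
qed

lemma mollifier_deriv_even: "r > 0 \<Longrightarrow> (deriv ^^ (j + j)) (mollifier r) (- z) = (deriv ^^ (j + j)) (mollifier r) z"
  using deriv_parity[OF test_function_mollifier mollifier_even, of r "j + j" z]
  by (simp add: power_add power_mult_distrib[symmetric])

text \<open>
  Applied to the derivative of order \<open>2 j\<close> of a mollifier, the growth estimate concerns the \<open>j\<close>-th
  derivative; the sign \<open>(-1)\<^sup>j\<close> from moving derivatives is immaterial because both directions are
  controlled. The limit of concentrating mollifiers gives the \<open>L\<^sup>2\<close> norms.
\<close>

lemma (in dispersive_evolution) energy_growth:
  assumes D: "\<And>t. t \<in> {0..T} \<Longrightarrow> deriv_chain m (D t)" "\<And>t. t \<in> {0..T} \<Longrightarrow> D t 0 = v t" and j: "j \<le> m"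
    and A: "\<And>r t. r > 0 \<Longrightarrow> t \<in> {0..T} \<Longrightarrow> \<bar>conv_form ((deriv ^^ (j + j)) (mollifier r)) (N t) (v t)\<bar> \<le> A"
    and t: "t \<in> {0..T}"
  shows "(L2_norm (D t j))\<^sup>2 \<le> (L2_norm (D 0 j))\<^sup>2 + 2 * A * t"
proof -
  have 0: "0 \<in> {0..T}" using t by auto
  let ?r = "\<lambda>n. mollifier (real (Suc n))"
  have Q: "conv_form ((deriv ^^ (j + j)) (?r n)) (v s) (v s) = (-1) ^ j * conv_form (?r n) (D s j) (D s j)"
    if "s \<in> {0..T}" for s n
    using conv_form_derivs[OF D(1)[OF that] j D(1)[OF that] j test_function_mollifier[of "real (Suc n)"]]
    by (simp add: D(2)[OF that])
  have le: "conv_form (?r n) (D t j) (D t j) \<le> conv_form (?r n) (D 0 j) (D 0 j) + 2 * A * t" for n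
  proof -
    have "\<bar>conv_form ((deriv ^^ (j + j)) (?r n)) (v t) (v t)
        - conv_form ((deriv ^^ (j + j)) (?r n)) (v 0) (v 0)\<bar> \<le> 2 * A * t"
      using A t by (intro conv_form_growth test_function_deriv test_function_mollifier mollifier_deriv_even) auto
    then have "\<bar>(-1) ^ j * (conv_form (?r n) (D t j) (D t j) - conv_form (?r n) (D 0 j) (D 0 j))\<bar> \<le> 2 * A * t"
      unfolding Q[OF t] Q[OF 0] by (simp add: right_diff_distrib)
    then have "\<bar>conv_form (?r n) (D t j) (D t j) - conv_form (?r n) (D 0 j) (D 0 j)\<bar> \<le> 2 * A * t"
      by (simp add: abs_mult)
    then show ?thesis by linarith
  qed
  have L2: "D t j \<in> L2_space" "D 0 j \<in> L2_space"
    using D(1)[OF t] D(1)[OF 0] j by (auto simp: deriv_chain_def)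
  show ?thesis
    by (rule LIMSEQ_le[OF conv_form_mollifier_tendsto[OF L2(1)]
          tendsto_add[OF conv_form_mollifier_tendsto[OF L2(2)] tendsto_const]])
      (use le in auto)
qed

lemma low_order_form_bound:
  assumes E: "deriv_chain m E" "j \<le> m" "L2_norm (E j) \<le> B" and D: "deriv_chain n D" "j \<le> n" "L2_norm (D j) \<le> V"
    and r: "r > 0"
  shows "\<bar>conv_form ((deriv ^^ (j + j)) (mollifier r)) (E 0) (D 0)\<bar> \<le> B * V"
proof -
  have L2: "E j \<in> L2_space" "D j \<in> L2_space" using E D by (auto simp: deriv_chain_def)
  have "0 \<le> B" using E(3) L2_norm_nonneg[of "E j"] by linarith
  have "\<bar>conv_form ((deriv ^^ (j + j)) (mollifier r)) (E 0) (D 0)\<bar> = \<bar>conv_form (mollifier r) (E j) (D j)\<bar>"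
    using conv_form_derivs[OF E(1,2) D(1,2) test_function_mollifier[OF r]] by (simp add: abs_mult)
  also have "\<dots> \<le> L1_norm (mollifier r) * L2_norm (E j) * L2_norm (D j)"
    by (intro abs_conv_form_le kernel_mollifier r L2)
  also have "\<dots> \<le> 1 * B * V"
    using E(3) D(3) \<open>0 \<le> B\<close> by (intro mult_mono) (auto simp: L1_norm_mollifier[OF r])
  finally show ?thesis by simp
qed

text \<open>
  The source is only in \<open>H\<^sup>m\<close>, so of its \<open>m + 1\<close> derivatives one stays on the kernel, which thereby
  becomes odd. The main part \<open>a g\<close> is then a case for the commutator estimate, and the
  remainder \<open>R\<close> can absorb the derivative.
\<close>

lemma top_order_form_bound:
  assumes E: "deriv_chain m E" "E m = (\<lambda>x. a x * D (Suc m) x + R x)" and R: "Sobolev_le 1 R B"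
    and D: "deriv_chain (Suc m) D" "L2_norm (D (Suc m)) \<le> V" and a: "Sobolev_le 2 a A" and r: "r > 0"
  shows "\<bar>conv_form ((deriv ^^ (Suc m + Suc m)) (mollifier r)) (E 0) (D 0)\<bar>
    \<le> 2 * A * L1_norm (\<lambda>z. z * deriv bump z) * V\<^sup>2 + B * V"
proof -
  let ?\<rho> = "mollifier r"
  define g where "g = D (Suc m)"
  have g: "g \<in> L2_space" "L2_norm g \<le> V" using D by (auto simp: g_def deriv_chain_def)
  have \<rho>: "?\<rho> \<in> test_functions" by (rule test_function_mollifier[OF r])
  have \<rho>': "deriv ?\<rho> \<in> test_functions" by (rule test_function_deriv1[OF \<rho>])
  obtain a' where a': "L2_deriv a a'" "Sobolev_le 1 a' A"
    using a by (auto simp: numeral_2_eq_2 Sobolev_le_Suc[of "Suc 0"])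
  have a_sup: "AE x in lborel. \<bar>a x\<bar> \<le> 2 * A" by (rule Sobolev_le_sup_bound[OF a]) simp
  have a'_sup: "AE x in lborel. \<bar>a' x\<bar> \<le> 2 * A" by (rule Sobolev_le_sup_bound[OF a'(2)]) simp
  have am: "a \<in> borel_measurable borel" using Sobolev_leD(1)[OF a] by (rule borel_measurable_L2)
  have A0: "0 \<le> A" by (rule Sobolev_leD(3)[OF a])
  obtain Nn where Nn: "Nn \<in> null_sets lborel"
    and lip: "\<And>x y. x \<notin> Nn \<Longrightarrow> y \<notin> Nn \<Longrightarrow> \<bar>a x - a y\<bar> \<le> (2 * A) * \<bar>x - y\<bar>"
    using L2_deriv_Lipschitz[OF a'(1) a'_sup] by blast
  obtain R' where R': "L2_deriv R R'" "R' \<in> L2_space" "L2_norm R' \<le> B"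
    using R by (auto simp: Sobolev_le_Suc Sobolev_le_0)
  have R2: "R \<in> L2_space" by (rule Sobolev_leD(1)[OF R])
  have B0: "0 \<le> B" by (rule Sobolev_leD(3)[OF R])
  have odd: "deriv ?\<rho> (- z) = - deriv ?\<rho> z" for z
    using deriv_parity[OF \<rho> mollifier_even, of 1 z] by simp
  have ag: "(\<lambda>x. a x * g x) \<in> L2_space" by (rule L2_mult_bounded(1)[OF g(1) am a_sup])
  have "(deriv ^^ (Suc m + Suc m)) ?\<rho> = (deriv ^^ (m + Suc m)) (deriv ?\<rho>)"
    by (simp add: funpow_swap1)
  then have "conv_form ((deriv ^^ (Suc m + Suc m)) ?\<rho>) (E 0) (D 0) = (-1) ^ m * conv_form (deriv ?\<rho>) (E m) g"
    using conv_form_derivs[OF E(1) order_refl D(1) order_refl \<rho>'] by (simp add: g_def)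
  also have "conv_form (deriv ?\<rho>) (E m) g = conv_form (deriv ?\<rho>) (\<lambda>x. a x * g x) g + conv_form (deriv ?\<rho>) R g"
    unfolding E(2) g_def[symmetric] by (intro conv_form_add_left kernel_test_function \<rho>' ag R2 g)
  also have "conv_form (deriv ?\<rho>) R g = - conv_form ?\<rho> R' g"
    by (rule conv_form_deriv_left[OF R'(1) \<rho> g(1)])
  finally have eq: "\<bar>conv_form ((deriv ^^ (Suc m + Suc m)) ?\<rho>) (E 0) (D 0)\<bar>
      = \<bar>conv_form (deriv ?\<rho>) (\<lambda>x. a x * g x) g + - conv_form ?\<rho> R' g\<bar>"
    by (simp add: abs_mult)
  have "\<bar>conv_form (deriv ?\<rho>) (\<lambda>x. a x * g x) g\<bar> \<le> (2 * A) * L1_norm (\<lambda>z. z * deriv ?\<rho> z) * (L2_norm g)\<^sup>2"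
    by (rule conv_form_odd_commutator[OF kernel_test_function[OF \<rho>'] odd g(1) am a_sup _ Nn lip])
      (use A0 in auto)
  also have "\<dots> \<le> (2 * A) * L1_norm (\<lambda>z. z * deriv bump z) * V\<^sup>2"
    unfolding L1_norm_moment_deriv_mollifier[OF r] using A0 g(2) by (intro mult_left_mono power_mono) auto
  finally have 1: "\<bar>conv_form (deriv ?\<rho>) (\<lambda>x. a x * g x) g\<bar> \<le> \<dots>" .
  have "\<bar>conv_form ?\<rho> R' g\<bar> \<le> L1_norm ?\<rho> * L2_norm R' * L2_norm g"
    by (intro abs_conv_form_le kernel_mollifier r R' g)
  also have "\<dots> \<le> 1 * B * V"
    using R'(3) g(2) B0 by (intro mult_mono) (auto simp: L1_norm_mollifier[OF r])
  finally have 2: "\<bar>conv_form ?\<rho> R' g\<bar> \<le> B * V" by simp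
  show ?thesis unfolding eq using 1 2 by linarith
qed

section \<open>A priori bounds for the generalised KdV equation\<close>

text \<open>
  One factor \<open>4\<^sup>m\<^sup>+\<^sup>1\<close> for each of the \<open>k\<close> multiplications in \<open>v\<^sup>k v\<^sub>x\<close>, from the algebra property.
\<close>

definition nonlin_const :: "nat \<Rightarrow> nat \<Rightarrow> real" where
  "nonlin_const m k = (4 ^ Suc m) ^ k"

definition growth_const :: "nat \<Rightarrow> nat \<Rightarrow> real" where
  "growth_const m k = nonlin_const m k * (2 * L1_norm (\<lambda>z. z * deriv bump z) + 1)"

lemma nonlin_const_nonneg: "0 \<le> nonlin_const m k" by (simp add: nonlin_const_def)

lemma growth_const_nonneg: "0 \<le> growth_const m k"
  by (simp add: growth_const_def nonlin_const_nonneg)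

definition nonlin :: "nat \<Rightarrow> (real \<Rightarrow> real) \<Rightarrow> real \<Rightarrow> real" where
  "nonlin k f = (\<lambda>x. f x ^ k * weak_deriv 1 f x)"

lemma nonlin_structure:
  assumes f: "f \<in> H_space (Suc m)" "H_norm (Suc m) f \<le> M" and k: "1 \<le> k"
  obtains E R A where "E 0 = nonlin k f" "deriv_chain m E"
    "\<And>j. j \<le> m \<Longrightarrow> L2_norm (E j) \<le> nonlin_const m k * M ^ (k + 1)"
    "E m = (\<lambda>x. f x ^ k * derivs f (Suc m) x + R x)"
    "Sobolev_le 1 R (nonlin_const m k * M ^ (k + 1))"
    "Sobolev_le (Suc m) (\<lambda>x. f x ^ k) A" "A * M\<^sup>2 \<le> nonlin_const m k * M ^ (k + 2)"
proof -
  obtain k' where k': "k = Suc k'" using k by (cases k) auto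
  note ch = deriv_chain_derivs[OF f(1)]
  have le: "L2_norm (derivs f j) \<le> M" if "j \<le> Suc m" for j
    using L2_norm_le_H_norm[OF ch that] f(2) by simp
  have M0: "0 \<le> M" using f(2) H_norm_nonneg[of "Suc m" f] by linarith
  have Sf: "Sobolev_le (Suc m) f M"
    unfolding Sobolev_le_def using ch le by (intro exI[of _ "derivs f"]) auto
  define A where "A = (4 ^ Suc m) ^ k' * M ^ k"
  have SA: "Sobolev_le (Suc m) (\<lambda>x. f x ^ k) A"
    using Sobolev_le_power[OF Sf, of k'] by (simp only: k' A_def)
  have c: "4 ^ Suc m * (A * M) = nonlin_const m k * M ^ (k + 1)"
    by (simp add: A_def nonlin_const_def k' ac_simps)
  have le_tail: "L2_norm (derivs f (Suc j)) \<le> M" if "j \<le> m" for j using le[of "Suc j"] that by simp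
  have L: "\<exists>E R. E 0 = (\<lambda>x. f x ^ k * derivs f (Suc 0) x) \<and> deriv_chain m E
      \<and> (\<forall>j\<le>m. L2_norm (E j) \<le> 4 ^ Suc m * (A * M))
      \<and> E m = (\<lambda>x. f x ^ k * derivs f (Suc m) x + R x) \<and> Sobolev_le 1 R (4 ^ Suc m * (A * M))"
    by (rule Leibniz_top_order[OF SA deriv_chain_tail[OF ch] le_tail])
  obtain E R where E: "E 0 = (\<lambda>x. f x ^ k * derivs f (Suc 0) x)" "deriv_chain m E"
      "\<forall>j\<le>m. L2_norm (E j) \<le> 4 ^ Suc m * (A * M)"
      "E m = (\<lambda>x. f x ^ k * derivs f (Suc m) x + R x)" "Sobolev_le 1 R (4 ^ Suc m * (A * M))"
    using L by (elim exE conjE) (rule that)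
  have A2: "A * M\<^sup>2 \<le> nonlin_const m k * M ^ (k + 2)"
  proof -
    have "A * M\<^sup>2 = (4 ^ Suc m) ^ k' * M ^ (k + 2)"
      by (simp add: A_def power_add power2_eq_square)
    also have "\<dots> \<le> (4 ^ Suc m) ^ k * M ^ (k + 2)"
    proof (rule mult_right_mono)
      have "(1::real) \<le> 4 ^ Suc m" by (rule one_le_power) simp
      then show "((4::real) ^ Suc m) ^ k' \<le> (4 ^ Suc m) ^ k" unfolding k' by (intro power_increasing) auto
    qed (use M0 in simp)
    finally show ?thesis by (simp add: nonlin_const_def)
  qed
  show ?thesis
  proof (rule that[of E R A, OF _ E(2) _ E(4) E(5)[unfolded c] SA A2])
    show "E 0 = nonlin k f" unfolding E(1) by (simp add: nonlin_def)
    show "L2_norm (E j) \<le> nonlin_const m k * M ^ (k + 1)" if "j \<le> m" for j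
      using E(3)[unfolded c] that by blast
  qed
qed

lemma nonlin_chain:
  assumes "f \<in> H_space (Suc m)" "H_norm (Suc m) f \<le> M" and "1 \<le> k"
  shows "\<exists>E. E 0 = nonlin k f \<and> deriv_chain m E \<and> (\<forall>j\<le>m. L2_norm (E j) \<le> nonlin_const m k * M ^ (k + 1))"
  by (rule nonlin_structure[OF assms]) (intro exI conjI allI impI)

lemma nonlin_L2:
  assumes f: "f \<in> H_space (Suc m)" "H_norm (Suc m) f \<le> M" and k: "1 \<le> k"
  shows "nonlin k f \<in> L2_space" "L2_norm (nonlin k f) \<le> nonlin_const m k * M ^ (k + 1)"
proof -
  obtain E where "E 0 = nonlin k f" "deriv_chain m E" "L2_norm (E 0) \<le> nonlin_const m k * M ^ (k + 1)"
    using nonlin_chain[OF assms] by auto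
  then show "nonlin k f \<in> L2_space" "L2_norm (nonlin k f) \<le> nonlin_const m k * M ^ (k + 1)"
    by (auto simp: deriv_chain_def)
qed

lemma nonlin_form_bound:
  assumes f: "f \<in> H_space (Suc m)" "H_norm (Suc m) f \<le> M" and k: "1 \<le> k" and m: "1 \<le> m"
    and j: "j \<le> Suc m" and r: "r > 0"
  shows "\<bar>conv_form ((deriv ^^ (j + j)) (mollifier r)) (nonlin k f) f\<bar> \<le> growth_const m k * M ^ (k + 2)"
proof -
  obtain E R A where E: "E 0 = nonlin k f" "deriv_chain m E"
    "\<And>j. j \<le> m \<Longrightarrow> L2_norm (E j) \<le> nonlin_const m k * M ^ (k + 1)"
    "E m = (\<lambda>x. f x ^ k * derivs f (Suc m) x + R x)"
    and R: "Sobolev_le 1 R (nonlin_const m k * M ^ (k + 1))"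
    and SA: "Sobolev_le (Suc m) (\<lambda>x. f x ^ k) A" and A2: "A * M\<^sup>2 \<le> nonlin_const m k * M ^ (k + 2)"
    by (rule nonlin_structure[OF f k]) (rule that)
  define \<mu> where "\<mu> = L1_norm (\<lambda>z. z * deriv bump z)"
  have \<mu>: "0 \<le> \<mu>" by (simp add: \<mu>_def)
  note ch = deriv_chain_derivs[OF f(1)]
  have le: "L2_norm (derivs f j) \<le> M" if "j \<le> Suc m" for j
    using L2_norm_le_H_norm[OF ch that] f(2) by simp
  have M0: "0 \<le> M" using f(2) H_norm_nonneg[of "Suc m" f] by linarith
  have X: "0 \<le> nonlin_const m k * M ^ (k + 2)" using M0 nonlin_const_nonneg by simp
  have g: "growth_const m k * M ^ (k + 2) = 2 * \<mu> * (nonlin_const m k * M ^ (k + 2)) + nonlin_const m k * M ^ (k + 2)"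
    by (simp add: growth_const_def \<mu>_def algebra_simps)
  have MM: "nonlin_const m k * M ^ (k + 1) * M = nonlin_const m k * M ^ (k + 2)"
    by (simp add: ac_simps)
  show ?thesis
  proof (cases "j = Suc m")
    case False
    then have j': "j \<le> m" using j by simp
    have "\<bar>conv_form ((deriv ^^ (j + j)) (mollifier r)) (E 0) (derivs f 0)\<bar>
        \<le> nonlin_const m k * M ^ (k + 1) * M"
      by (rule low_order_form_bound[OF E(2) j' E(3)[OF j'] ch j le[OF j] r])
    also have "\<dots> \<le> growth_const m k * M ^ (k + 2)"
      unfolding MM g using mult_nonneg_nonneg[OF \<mu> X] by linarith
    finally show ?thesis by (simp add: E(1))
  next
    case True
    have a2: "Sobolev_le 2 (\<lambda>x. f x ^ k) A" by (rule Sobolev_le_mono[OF SA]) (use m in auto)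
    have "\<bar>conv_form ((deriv ^^ (Suc m + Suc m)) (mollifier r)) (E 0) (derivs f 0)\<bar>
        \<le> 2 * A * \<mu> * M\<^sup>2 + nonlin_const m k * M ^ (k + 1) * M"
      unfolding \<mu>_def by (rule top_order_form_bound[OF E(2,4) R ch le[OF order_refl] a2 r])
    also have "\<dots> \<le> growth_const m k * M ^ (k + 2)"
      unfolding MM g using mult_left_mono[OF A2, of "2 * \<mu>"] \<mu> by (simp add: ac_simps)
    finally show ?thesis by (simp add: E(1) True)
  qed
qed

lemma gkdv_solutionD:
  assumes "gkdv_solution k \<sigma> v0 T v" "t \<in> {0..T}"
  shows "v t \<in> H_space \<sigma>"
    "((\<lambda>\<tau>. H_norm \<sigma> (\<lambda>x. v \<tau> x - v t x)) \<longlongrightarrow> 0) (at t within {0..T})"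
    "\<phi> \<in> test_functions \<Longrightarrow>
      ((\<lambda>\<tau>. \<integral>x. v \<tau> x * \<phi> x \<partial>lborel) has_real_derivative
        (\<integral>x. v t x * (deriv ^^ 3) \<phi> x \<partial>lborel) - (\<integral>x. nonlin k (v t) x * \<phi> x \<partial>lborel)) (at t within {0..T})"
  using assms by (auto simp: gkdv_solution_def nonlin_def)

lemma gkdv_derivs_continuous:
  assumes sol: "gkdv_solution k \<sigma> v0 T v" and t: "t \<in> {0..T}" and j: "j \<le> \<sigma>"
  shows "((\<lambda>\<tau>. L2_norm (\<lambda>x. derivs (v \<tau>) j x - derivs (v t) j x)) \<longlongrightarrow> 0) (at t within {0..T})"
proof (rule tendsto_0_le[where K = 1])
  show "((\<lambda>\<tau>. H_norm \<sigma> (\<lambda>x. v \<tau> x - v t x)) \<longlongrightarrow> 0) (at t within {0..T})"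
    by (rule gkdv_solutionD(2)[OF sol t])
  have "L2_norm (\<lambda>x. derivs (v \<tau>) j x - derivs (v t) j x) \<le> H_norm \<sigma> (\<lambda>x. v \<tau> x - v t x)" if "\<tau> \<in> {0..T}" for \<tau>
    using L2_norm_le_H_norm[OF deriv_chain_diff[OF deriv_chain_derivs[OF gkdv_solutionD(1)[OF sol that]]
          deriv_chain_derivs[OF gkdv_solutionD(1)[OF sol t]]] j] by simp
  then show "\<forall>\<^sub>F \<tau> in at t within {0..T}. norm (L2_norm (\<lambda>x. derivs (v \<tau>) j x - derivs (v t) j x))
      \<le> norm (H_norm \<sigma> (\<lambda>x. v \<tau> x - v t x)) * 1"
    by (auto simp: eventually_at_filter)
qed

lemma continuous_on_L2_norm:
  assumes f: "\<And>t. t \<in> S \<Longrightarrow> f t \<in> L2_space"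
    and c: "\<And>t. t \<in> S \<Longrightarrow> ((\<lambda>\<tau>. L2_norm (\<lambda>x. f \<tau> x - f t x)) \<longlongrightarrow> 0) (at t within S)"
  shows "continuous_on S (\<lambda>t. L2_norm (f t))"
  unfolding continuous_on_def
proof
  fix t assume t: "t \<in> S"
  have "((\<lambda>\<tau>. L2_norm (f \<tau>) - L2_norm (f t)) \<longlongrightarrow> 0) (at t within S)"
  proof (rule tendsto_0_le[OF c[OF t], where K = 1])
    show "\<forall>\<^sub>F \<tau> in at t within S. norm (L2_norm (f \<tau>) - L2_norm (f t)) \<le> norm (L2_norm (\<lambda>x. f \<tau> x - f t x)) * 1"
      using abs_L2_norm_diff_le[OF f f[OF t]] by (auto simp: eventually_at_filter)
  qed
  then show "((\<lambda>t. L2_norm (f t)) \<longlongrightarrow> L2_norm (f t)) (at t within S)"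
    by (simp add: LIM_zero_iff)
qed

lemma H_norm_square_derivs:
  assumes "f \<in> H_space m" shows "(H_norm m f)\<^sup>2 = (\<Sum>j\<le>m. (L2_norm (derivs f j))\<^sup>2)"
  using H_norm_deriv_chain[OF deriv_chain_derivs[OF assms]] by (simp add: sum_nonneg)

lemma gkdv_H_norm_continuous:
  assumes sol: "gkdv_solution k \<sigma> v0 T v"
  shows "continuous_on {0..T} (\<lambda>t. (H_norm \<sigma> (v t))\<^sup>2)"
proof -
  note H = gkdv_solutionD(1)[OF sol]
  have "continuous_on {0..T} (\<lambda>t. L2_norm (derivs (v t) j))" if "j \<le> \<sigma>" for j
    using deriv_chain_derivs[OF H] gkdv_derivs_continuous[OF sol] that
    by (intro continuous_on_L2_norm) (auto simp: deriv_chain_def)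
  then have "continuous_on {0..T} (\<lambda>t. \<Sum>j\<le>\<sigma>. (L2_norm (derivs (v t) j))\<^sup>2)"
    by (intro continuous_intros) auto
  then show ?thesis
    by (rule continuous_on_eq) (simp add: H_norm_square_derivs[OF H])
qed

lemma gkdv_dispersive_evolution:
  assumes sol: "gkdv_solution k (Suc m) v0 T v" and k: "1 \<le> k" and t: "t \<in> {0..T}"
    and M: "\<And>\<tau>. \<tau> \<in> {0..t} \<Longrightarrow> H_norm (Suc m) (v \<tau>) \<le> M"
  shows "dispersive_evolution t v (\<lambda>\<tau>. nonlin k (v \<tau>)) (nonlin_const m k * M ^ (k + 1))"
proof
  fix \<tau> assume \<tau>: "\<tau> \<in> {0..t}"
  then have \<tau>T: "\<tau> \<in> {0..T}" and sub: "{0..t} \<subseteq> {0..T}" using t by auto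
  note H = gkdv_solutionD(1)[OF sol \<tau>T]
  show "v \<tau> \<in> L2_space" using H by (simp add: H_space_def)
  show "nonlin k (v \<tau>) \<in> L2_space" "L2_norm (nonlin k (v \<tau>)) \<le> nonlin_const m k * M ^ (k + 1)"
    by (rule nonlin_L2[OF H M[OF \<tau>] k])+
  have "((\<lambda>\<tau>'. L2_norm (\<lambda>x. v \<tau>' x - v \<tau> x)) \<longlongrightarrow> 0) (at \<tau> within {0..T})"
    using gkdv_derivs_continuous[OF sol \<tau>T, of 0] by simp
  then show "((\<lambda>\<tau>'. L2_norm (\<lambda>x. v \<tau>' x - v \<tau> x)) \<longlongrightarrow> 0) (at \<tau> within {0..t})"
    by (rule tendsto_within_subset[OF _ sub])
  show "((\<lambda>\<tau>. \<integral>x. v \<tau> x * \<phi> x \<partial>lborel) has_real_derivative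
        (\<integral>x. v \<tau> x * (deriv ^^ 3) \<phi> x \<partial>lborel) - (\<integral>x. nonlin k (v \<tau>) x * \<phi> x \<partial>lborel)) (at \<tau> within {0..t})"
    if "\<phi> \<in> test_functions" for \<phi>
    by (rule DERIV_subset[OF gkdv_solutionD(3)[OF sol \<tau>T that] sub])
qed

lemma gkdv_energy_growth:
  assumes sol: "gkdv_solution k (Suc m) v0 T v" and k: "1 \<le> k" and m: "1 \<le> m" and t: "t \<in> {0..T}"
    and M: "\<And>\<tau>. \<tau> \<in> {0..t} \<Longrightarrow> H_norm (Suc m) (v \<tau>) \<le> M"
  shows "(H_norm (Suc m) (v t))\<^sup>2 \<le> (H_norm (Suc m) (v 0))\<^sup>2
    + (2 * real (m + 2) * growth_const m k) * M ^ (k + 2) * t"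
proof -
  interpret dispersive_evolution t v "\<lambda>\<tau>. nonlin k (v \<tau>)" "nonlin_const m k * M ^ (k + 1)"
    by (rule gkdv_dispersive_evolution[OF sol k t M])
  have H: "v \<tau> \<in> H_space (Suc m)" if "\<tau> \<in> {0..t}" for \<tau>
    using gkdv_solutionD(1)[OF sol, of \<tau>] that t by auto
  let ?A = "growth_const m k * M ^ (k + 2)"
  have ends: "t \<in> {0..t}" "0 \<in> {0..t}" using t by auto
  have "(L2_norm (derivs (v t) j))\<^sup>2 \<le> (L2_norm (derivs (v 0) j))\<^sup>2 + 2 * ?A * t" if "j \<le> Suc m" for j
    by (rule energy_growth[where D = "\<lambda>\<tau>. derivs (v \<tau>)", OF deriv_chain_derivs[OF H] _ that _ ends(1)])
      (use nonlin_form_bound[OF H M k m that] in auto)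
  then have "(\<Sum>j\<le>Suc m. (L2_norm (derivs (v t) j))\<^sup>2) \<le> (\<Sum>j\<le>Suc m. (L2_norm (derivs (v 0) j))\<^sup>2 + 2 * ?A * t)"
    by (intro sum_mono) auto
  also have "\<dots> = (\<Sum>j\<le>Suc m. (L2_norm (derivs (v 0) j))\<^sup>2) + real (m + 2) * (2 * ?A * t)"
    by (simp only: sum.distrib sum_constant card_atMost) simp
  finally show ?thesis
    unfolding H_norm_square_derivs[OF H[OF ends(1)]] H_norm_square_derivs[OF H[OF ends(2)]]
    by (simp only: mult.assoc mult.left_commute)
qed

text \<open>
  At the first time at which \<open>E\<close> reaches \<open>M\<close> the growth hypothesis is still available and
  contradicts \<open>E = M\<close>.
\<close>

lemma continuity_bootstrap:
  fixes E :: "real \<Rightarrow> real"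
  assumes cont: "continuous_on {0..T} E"
    and growth: "\<And>t. t \<in> {0..T} \<Longrightarrow> (\<And>\<tau>. \<tau> \<in> {0..t} \<Longrightarrow> E \<tau> \<le> M) \<Longrightarrow> E t \<le> E 0 + G * t"
    and E0: "E 0 < M" and small: "E 0 + G * T < M" and G: "0 \<le> G" and t: "t \<in> {0..T}"
  shows "E t \<le> M"
proof (rule ccontr)
  assume "\<not> E t \<le> M"
  then have Et: "M \<le> E t" by simp
  define S where "S = {0..t} \<inter> E -` {M..}"
  have ct: "continuous_on {0..t} E" by (rule continuous_on_subset[OF cont]) (use t in auto)
  have "closed S" unfolding S_def by (intro continuous_closed_preimage ct) auto
  moreover have "bounded S" by (rule bounded_subset[of "{0..t}"]) (auto simp: S_def)
  ultimately have "compact S" by (simp add: compact_eq_bounded_closed)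
  moreover have "S \<noteq> {}" using Et t by (auto simp: S_def)
  ultimately obtain s where s: "s \<in> S" and least: "\<And>x. x \<in> S \<Longrightarrow> s \<le> x"
    using compact_attains_inf by metis
  have sI: "0 \<le> s" "s \<le> t" "M \<le> E s" using s by (auto simp: S_def)
  have "\<exists>x. 0 \<le> x \<and> x \<le> s \<and> E x = M"
    by (rule IVT') (use sI E0 continuous_on_subset[OF ct, of "{0..s}"] in auto)
  then obtain x where x: "0 \<le> x" "x \<le> s" "E x = M" by blast
  then have "x \<in> S" using sI by (auto simp: S_def)
  then have "x = s" using least[of x] x by simp
  then have Es: "E s = M" using x by simp
  have "E \<tau> \<le> M" if \<tau>: "\<tau> \<in> {0..s}" for \<tau>
  proof (rule ccontr)
    assume "\<not> E \<tau> \<le> M"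
    then have "\<tau> \<in> S" using \<tau> sI by (auto simp: S_def)
    then have "\<tau> = s" using least[of \<tau>] \<tau> by simp
    then show False using Es \<open>\<not> E \<tau> \<le> M\<close> by simp
  qed
  then have "E s \<le> E 0 + G * s" using sI t by (intro growth) auto
  also have "\<dots> \<le> E 0 + G * T" using G sI t by (intro add_left_mono mult_left_mono) auto
  finally show False using Es small by simp
qed

text \<open>
  Small enough that the energy growth over the whole time interval, computed with twice the initial norm \<open>h\<close>
  in place of the solution, stays below \<open>h\<^sup>2\<close>; the summand \<open>1\<close> makes the inverse safe.
\<close>

definition time_const :: "nat \<Rightarrow> nat \<Rightarrow> real" where
  "time_const m k = inverse (2 ^ (k + 2) * (2 * real (m + 2) * growth_const m k + 1))"

lemma time_const_pos: "0 < time_const m k"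
  using growth_const_nonneg[of m k] by (simp add: time_const_def add_nonneg_pos)

lemma gkdv_initial:
  assumes sol: "gkdv_solution k \<sigma> v0 T v" and "0 \<le> T" and v0: "v0 \<in> H_space \<sigma>"
  shows "H_norm \<sigma> (v 0) = H_norm \<sigma> v0" "AE x in lborel. v 0 x = v0 x"
proof -
  show ae: "AE x in lborel. v 0 x = v0 x" using sol by (simp add: gkdv_solution_def)
  have "v 0 \<in> H_space \<sigma>" using gkdv_solutionD(1)[OF sol, of 0] assms(2) by simp
  then show "H_norm \<sigma> (v 0) = H_norm \<sigma> v0"
    using v0 ae by (intro H_norm_cong_AE) (auto simp: H_space_def borel_measurable_L2)
qed

lemma gkdv_a_priori_bound:
  assumes sol: "gkdv_solution k (Suc m) v0 T v" and v0: "v0 \<in> H_space (Suc m)"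
    and k: "1 \<le> k" and m: "1 \<le> m" and T: "0 < T"
    and small: "T * H_norm (Suc m) v0 ^ k \<le> time_const m k" and t: "t \<in> {0..T}"
  shows "H_norm (Suc m) (v t) \<le> 2 * H_norm (Suc m) v0"
proof -
  define G where "G = 2 * real (m + 2) * growth_const m k"
  have G: "0 \<le> G" using growth_const_nonneg by (simp add: G_def)
  define h0 where "h0 = H_norm (Suc m) v0"
  have h0: "0 \<le> h0" by (simp add: h0_def)
  have init: "H_norm (Suc m) (v 0) = h0"
    using gkdv_initial[OF sol _ v0] T by (simp add: h0_def)
  \<comment> \<open>The bootstrap runs with every \<open>h\<close> slightly above \<open>h0\<close>, which covers zero data as well.\<close>
  have lim: "((\<lambda>h. G * 2 ^ (k + 2) * h ^ k * T) \<longlongrightarrow> G * 2 ^ (k + 2) * h0 ^ k * T) (at_right h0)"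
    by (intro tendsto_intros)
  have lt3: "G * 2 ^ (k + 2) * h0 ^ k * T < 3"
  proof -
    have "T * h0 ^ k * (2 ^ (k + 2) * (G + 1)) \<le> time_const m k * (2 ^ (k + 2) * (G + 1))"
      using small G by (intro mult_right_mono) (auto simp: h0_def)
    also have "\<dots> = 1"
    proof -
      have "0 < 2 ^ (k + 2) * (G + 1)" using G by (intro mult_pos_pos) auto
      then have nz: "2 ^ (k + 2) * (G + 1) \<noteq> 0" by linarith
      have tc: "time_const m k = inverse (2 ^ (k + 2) * (G + 1))"
        by (simp only: time_const_def G_def)
      show ?thesis unfolding tc by (rule left_inverse[OF nz])
    qed
    finally have "G * 2 ^ (k + 2) * h0 ^ k * T + T * h0 ^ k * 2 ^ (k + 2) \<le> 1"
      by (simp add: algebra_simps)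
    moreover have "0 \<le> T * h0 ^ k * 2 ^ (k + 2)" using T h0 by simp
    ultimately show ?thesis by linarith
  qed
  have ev: "eventually (\<lambda>h. H_norm (Suc m) (v t) \<le> 2 * h) (at_right h0)"
    using order_tendstoD(2)[OF lim lt3] eventually_at_right_less[of h0]
  proof eventually_elim
    case (elim h)
    then have h: "0 < h" "h0 < h" using h0 by auto
    let ?E = "\<lambda>t. (H_norm (Suc m) (v t))\<^sup>2"
    let ?G = "G * (2 * h) ^ (k + 2)"
    have E0: "?E 0 < h\<^sup>2" unfolding init using h h0 by (intro power_strict_mono) auto
    have "?E t \<le> (2 * h)\<^sup>2"
    proof (rule continuity_bootstrap[where G = ?G, OF gkdv_H_norm_continuous[OF sol] _ _ _ _ t])
      fix s assume s: "s \<in> {0..T}" and le: "\<And>\<tau>. \<tau> \<in> {0..s} \<Longrightarrow> ?E \<tau> \<le> (2 * h)\<^sup>2"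
      have "H_norm (Suc m) (v \<tau>) \<le> 2 * h" if "\<tau> \<in> {0..s}" for \<tau>
        by (rule power2_le_imp_le[OF le[OF that]]) (use h in simp)
      from gkdv_energy_growth[OF sol k m s this]
      show "?E s \<le> ?E 0 + ?G * s" by (simp only: G_def)
    next
      show "?E 0 < (2 * h)\<^sup>2" using E0 h by (simp add: power_mult_distrib) (smt (verit) zero_le_power2)
      have "?G * T = (G * 2 ^ (k + 2) * h ^ k * T) * h\<^sup>2"
        by (simp add: power_mult_distrib power_add power2_eq_square)
      also have "\<dots> < 3 * h\<^sup>2" using elim h by (intro mult_strict_right_mono) auto
      finally show "?E 0 + ?G * T < (2 * h)\<^sup>2" using E0 by (simp add: power_mult_distrib)
      show "0 \<le> ?G" using G h by simp
    qed
    then show ?case by (rule power2_le_imp_le) (use h in simp)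
  qed
  have "((\<lambda>h. 2 * h) \<longlongrightarrow> 2 * h0) (at_right h0)" by (intro tendsto_intros)
  from tendsto_lowerbound[OF this ev] show ?thesis by (simp add: h0_def)
qed

section \<open>Distance between the two solutions\<close>

lemma le_of_square_growth:
  fixes W W0 c :: real
  assumes "W\<^sup>2 \<le> W0\<^sup>2 + c * W" "0 \<le> W0" "0 \<le> c" shows "W \<le> W0 + c"
proof (rule ccontr)
  assume "\<not> W \<le> W0 + c"
  then have W: "W0 + c < W" "0 < W" using assms by auto
  then have "(W0 + c) * W < W * W" by (intro mult_strict_right_mono) auto
  moreover have "W0 * W0 \<le> W0 * W" using assms W by (intro mult_left_mono) auto
  ultimately show False using assms(1) by (simp add: power2_eq_square algebra_simps)
qed

text \<open>
  The source of the difference is estimated by the triangle inequality alone. It has \<open>m\<close> derivatives in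
  \<open>L\<^sup>2\<close>, as many as are needed up to order \<open>n\<close>, so there is no top order term to treat here. Each derivative is
  estimated at the time where its norm is largest.
\<close>

lemma gkdv_difference_bound:
  assumes u: "gkdv_solution k (Suc m) u0 T u" and U: "gkdv_solution l (Suc m) U0 T U"
    and kl: "1 \<le> k" "1 \<le> l" and n: "n \<le> m"
    and a: "\<And>t. t \<in> {0..T} \<Longrightarrow> H_norm (Suc m) (u t) \<le> a"
    and b: "\<And>t. t \<in> {0..T} \<Longrightarrow> H_norm (Suc m) (U t) \<le> b"
    and t: "t \<in> {0..T}"
  shows "H_norm n (\<lambda>x. u t x - U t x) \<le> real (Suc n) * (H_norm n (\<lambda>x. u 0 x - U 0 x)
     + 2 * (nonlin_const m k * a ^ (k + 1) + nonlin_const m l * b ^ (l + 1)) * T)"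
proof -
  have T: "T \<in> {0..T}" "0 \<in> {0..T}" using t by auto
  define B where "B = nonlin_const m k * a ^ (k + 1) + nonlin_const m l * b ^ (l + 1)"
  have "0 \<le> a" "0 \<le> b" using a[OF t] b[OF t] H_norm_nonneg order_trans by blast+
  then have B0: "0 \<le> B" by (simp add: B_def nonlin_const_nonneg)
  interpret eu: dispersive_evolution T u "\<lambda>\<tau>. nonlin k (u \<tau>)" "nonlin_const m k * a ^ (k + 1)"
    by (rule gkdv_dispersive_evolution[OF u kl(1) T(1) a])
  interpret eU: dispersive_evolution T U "\<lambda>\<tau>. nonlin l (U \<tau>)" "nonlin_const m l * b ^ (l + 1)"
    by (rule gkdv_dispersive_evolution[OF U kl(2) T(1) b])
  define w where "w \<tau> x = u \<tau> x - U \<tau> x" for \<tau> x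
  define N where "N \<tau> x = nonlin k (u \<tau>) x - nonlin l (U \<tau>) x" for \<tau> x
  define D where "D \<tau> j x = derivs (u \<tau>) j x - derivs (U \<tau>) j x" for \<tau> j x
  note Hu = gkdv_solutionD(1)[OF u] and HU = gkdv_solutionD(1)[OF U]
  have D: "deriv_chain (Suc m) (D \<tau>)" if "\<tau> \<in> {0..T}" for \<tau>
    unfolding D_def by (intro deriv_chain_diff deriv_chain_derivs Hu HU that)
  have D0: "D \<tau> 0 = w \<tau>" for \<tau> by (simp add: D_def w_def fun_eq_iff)
  have Dc: "((\<lambda>\<tau>'. L2_norm (\<lambda>x. D \<tau>' j x - D \<tau> j x)) \<longlongrightarrow> 0) (at \<tau> within {0..T})"
    if \<tau>: "\<tau> \<in> {0..T}" and j: "j \<le> Suc m" for \<tau> j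
  proof -
    have "((\<lambda>\<tau>'. L2_norm (\<lambda>x. derivs (u \<tau>') j x - derivs (u \<tau>) j x)
        + L2_norm (\<lambda>x. derivs (U \<tau>') j x - derivs (U \<tau>) j x)) \<longlongrightarrow> 0 + 0) (at \<tau> within {0..T})"
      by (intro tendsto_add gkdv_derivs_continuous[OF u \<tau> j] gkdv_derivs_continuous[OF U \<tau> j])
    then have lim: "((\<lambda>\<tau>'. L2_norm (\<lambda>x. derivs (u \<tau>') j x - derivs (u \<tau>) j x)
        + L2_norm (\<lambda>x. derivs (U \<tau>') j x - derivs (U \<tau>) j x)) \<longlongrightarrow> 0) (at \<tau> within {0..T})"
      by simp
    have "L2_norm (\<lambda>x. D \<tau>' j x - D \<tau> j x) \<le> L2_norm (\<lambda>x. derivs (u \<tau>') j x - derivs (u \<tau>) j x)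
        + L2_norm (\<lambda>x. derivs (U \<tau>') j x - derivs (U \<tau>) j x)" if \<tau>': "\<tau>' \<in> {0..T}" for \<tau>'
    proof -
      have L: "derivs (u s) j \<in> L2_space" "derivs (U s) j \<in> L2_space" if "s \<in> {0..T}" for s
        using deriv_chain_derivs[OF Hu[OF that]] deriv_chain_derivs[OF HU[OF that]] j
        by (auto simp: deriv_chain_def)
      have "L2_norm (\<lambda>x. (derivs (u \<tau>') j x - derivs (u \<tau>) j x) + - (derivs (U \<tau>') j x - derivs (U \<tau>) j x))
          \<le> L2_norm (\<lambda>x. derivs (u \<tau>') j x - derivs (u \<tau>) j x)
            + L2_norm (\<lambda>x. - (derivs (U \<tau>') j x - derivs (U \<tau>) j x))"
        by (intro L2_norm_triangle L2_minus L2_diff L \<tau> \<tau>')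
      moreover have "(\<lambda>x. D \<tau>' j x - D \<tau> j x)
          = (\<lambda>x. (derivs (u \<tau>') j x - derivs (u \<tau>) j x) + - (derivs (U \<tau>') j x - derivs (U \<tau>) j x))"
        by (auto simp: D_def)
      ultimately show ?thesis
        using L2_norm_minus[of "\<lambda>x. derivs (U \<tau>') j x - derivs (U \<tau>) j x"] by simp
    qed
    then show ?thesis
      by (intro tendsto_0_le[OF lim, where K = 1]) (auto simp: eventually_at_filter)
  qed
  interpret w: dispersive_evolution T w N B
  proof
    fix \<tau> assume \<tau>: "\<tau> \<in> {0..T}"
    show "w \<tau> \<in> L2_space" unfolding w_def by (intro L2_diff eu.v eU.v \<tau>)
    show N2: "N \<tau> \<in> L2_space" unfolding N_def by (intro L2_diff eu.N eU.N \<tau>)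
    have "L2_norm (\<lambda>x. nonlin k (u \<tau>) x + - nonlin l (U \<tau>) x)
        \<le> L2_norm (nonlin k (u \<tau>)) + L2_norm (\<lambda>x. - nonlin l (U \<tau>) x)"
      by (intro L2_norm_triangle L2_minus eu.N eU.N \<tau>)
    then have "L2_norm (N \<tau>) \<le> L2_norm (nonlin k (u \<tau>)) + L2_norm (nonlin l (U \<tau>))"
      unfolding L2_norm_minus by (simp add: N_def[abs_def])
    then show "L2_norm (N \<tau>) \<le> B" using eu.N(2)[OF \<tau>] eU.N(2)[OF \<tau>] unfolding B_def by linarith
    show "((\<lambda>\<tau>'. L2_norm (\<lambda>x. w \<tau>' x - w \<tau> x)) \<longlongrightarrow> 0) (at \<tau> within {0..T})"
      using Dc[OF \<tau>, of 0] by (simp add: D0)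
    fix \<phi> assume \<phi>: "\<phi> \<in> test_functions"
    have \<phi>2: "\<phi> \<in> L2_space" "(deriv ^^ 3) \<phi> \<in> L2_space"
      using \<phi> by (intro kernel_L2 kernel_test_function test_function_deriv; simp)+
    have eq: "(\<integral>x. w s x * \<psi> x \<partial>lborel) = (\<integral>x. u s x * \<psi> x \<partial>lborel) - (\<integral>x. U s x * \<psi> x \<partial>lborel)"
      if "s \<in> {0..T}" "\<psi> \<in> L2_space" for s \<psi>
      unfolding w_def using integrable_mult_L2[OF eu.v[OF that(1)] that(2)] integrable_mult_L2[OF eU.v[OF that(1)] that(2)]
      by (simp add: left_diff_distrib)
    have eqN: "(\<integral>x. N \<tau> x * \<phi> x \<partial>lborel) = (\<integral>x. nonlin k (u \<tau>) x * \<phi> x \<partial>lborel) - (\<integral>x. nonlin l (U \<tau>) x * \<phi> x \<partial>lborel)"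
      unfolding N_def using integrable_mult_L2[OF eu.N(1)[OF \<tau>] \<phi>2(1)] integrable_mult_L2[OF eU.N(1)[OF \<tau>] \<phi>2(1)]
      by (simp add: left_diff_distrib)
    have "((\<lambda>\<tau>. (\<integral>x. u \<tau> x * \<phi> x \<partial>lborel) - (\<integral>x. U \<tau> x * \<phi> x \<partial>lborel)) has_real_derivative
        (\<integral>x. w \<tau> x * (deriv ^^ 3) \<phi> x \<partial>lborel) - (\<integral>x. N \<tau> x * \<phi> x \<partial>lborel)) (at \<tau> within {0..T})"
      by (rule DERIV_cong[OF DERIV_diff[OF eu.evol[OF \<phi> \<tau>] eU.evol[OF \<phi> \<tau>]]])
        (simp add: eq[OF \<tau> \<phi>2(2)] eqN)
    then show "((\<lambda>\<tau>. \<integral>x. w \<tau> x * \<phi> x \<partial>lborel) has_real_derivative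
        (\<integral>x. w \<tau> x * (deriv ^^ 3) \<phi> x \<partial>lborel) - (\<integral>x. N \<tau> x * \<phi> x \<partial>lborel)) (at \<tau> within {0..T})"
      by (rule has_field_derivative_transform_within[OF _ zero_less_one \<tau>]) (simp add: eq[OF _ \<phi>2(1)])
  qed
  have level: "L2_norm (D t j) \<le> L2_norm (D 0 j) + 2 * B * T" if j: "j \<le> n" for j
  proof -
    have jm: "j \<le> m" "j \<le> Suc m" using j n by auto
    have "continuous_on {0..T} (\<lambda>\<tau>. L2_norm (D \<tau> j))"
      using D jm by (intro continuous_on_L2_norm Dc) (auto simp: deriv_chain_def)
    then obtain s where s: "s \<in> {0..T}" and max: "\<And>\<tau>. \<tau> \<in> {0..T} \<Longrightarrow> L2_norm (D \<tau> j) \<le> L2_norm (D s j)"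
      using continuous_attains_sup[of "{0..T}" "\<lambda>\<tau>. L2_norm (D \<tau> j)"] t by auto
    define W where "W = L2_norm (D s j)"
    have form: "\<bar>conv_form ((deriv ^^ (j + j)) (mollifier r)) (N \<tau>) (w \<tau>)\<bar> \<le> B * W"
      if r: "r > 0" and \<tau>: "\<tau> \<in> {0..T}" for r \<tau>
    proof -
      obtain E where E: "E 0 = nonlin k (u \<tau>)" "deriv_chain m E" "L2_norm (E j) \<le> nonlin_const m k * a ^ (k + 1)"
        using nonlin_chain[OF Hu[OF \<tau>] a[OF \<tau>] kl(1)] jm(1) by auto
      obtain F where F: "F 0 = nonlin l (U \<tau>)" "deriv_chain m F" "L2_norm (F j) \<le> nonlin_const m l * b ^ (l + 1)"
        using nonlin_chain[OF HU[OF \<tau>] b[OF \<tau>] kl(2)] jm(1) by auto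
      have "L2_norm (\<lambda>x. E j x + - F j x) \<le> L2_norm (E j) + L2_norm (\<lambda>x. - F j x)"
        using E(2) F(2) jm by (intro L2_norm_triangle L2_minus) (auto simp: deriv_chain_def)
      then have EF: "L2_norm (\<lambda>x. E j x - F j x) \<le> B"
        unfolding L2_norm_minus using E(3) F(3) by (simp add: B_def)
      have "\<bar>conv_form ((deriv ^^ (j + j)) (mollifier r)) (\<lambda>x. E 0 x - F 0 x) (D \<tau> 0)\<bar> \<le> B * W"
        by (rule low_order_form_bound[OF deriv_chain_diff[OF E(2) F(2)] jm(1) EF D[OF \<tau>] jm(2) _ r])
          (use max[OF \<tau>] in \<open>simp add: W_def\<close>)
      moreover have "(\<lambda>x. E 0 x - F 0 x) = N \<tau>" by (simp add: E F N_def[abs_def])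
      ultimately show ?thesis by (simp add: D0)
    qed
    have "W\<^sup>2 \<le> (L2_norm (D 0 j))\<^sup>2 + 2 * (B * W) * s"
      unfolding W_def by (rule w.energy_growth[where D = D, OF D D0 jm(2) _ s]) (use form in \<open>auto simp: W_def\<close>)
    also have "\<dots> \<le> (L2_norm (D 0 j))\<^sup>2 + 2 * (B * W) * T"
      using s B0 by (intro add_left_mono mult_left_mono) (auto simp: W_def)
    finally have "W\<^sup>2 \<le> (L2_norm (D 0 j))\<^sup>2 + (2 * B * T) * W" by (simp add: ac_simps)
    then have "W \<le> L2_norm (D 0 j) + 2 * B * T"
      by (rule le_of_square_growth) (use B0 t in auto)
    then show ?thesis using max[OF t] unfolding W_def by linarith
  qed
  have nch: "deriv_chain n (D \<tau>)" if "\<tau> \<in> {0..T}" for \<tau>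
    using deriv_chain_mono[OF D[OF that]] n by simp
  have "H_norm n (w t) \<le> (\<Sum>j\<le>n. L2_norm (D t j))"
    using H_norm_le_sum[OF nch[OF t]] by (simp add: D0)
  also have "\<dots> \<le> (\<Sum>j\<le>n. H_norm n (w 0) + 2 * B * T)"
  proof (rule sum_mono)
    fix j assume j: "j \<in> {..n}"
    have "L2_norm (D 0 j) \<le> H_norm n (w 0)"
      using L2_norm_le_H_norm[OF nch[OF T(2)], of j] j by (simp add: D0)
    then show "L2_norm (D t j) \<le> H_norm n (w 0) + 2 * B * T" using level[of j] j by auto
  qed
  also have "\<dots> = real (Suc n) * (H_norm n (w 0) + 2 * B * T)" by simp
  finally show ?thesis by (simp add: w_def[abs_def] B_def)
qed

lemma mult_le_if_le_inverse:
  assumes "ereal T \<le> ereal c * min (inverse (ereal a)) (inverse (ereal b))" "0 \<le> a" "0 < c"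
  shows "T * a \<le> c"
proof (cases "a = 0")
  case False
  then have a: "0 < a" using assms by simp
  have "ereal T \<le> ereal c * inverse (ereal a)"
    by (rule order_trans[OF assms(1) ereal_mult_left_mono[OF min.cobounded1]]) (use assms(3) in simp)
  then have "T \<le> c * inverse a" using a by simp
  then show ?thesis using a by (simp add: field_simps)
qed (use assms in simp)

lemma H_norm_0: "f \<in> L2_space \<Longrightarrow> H_norm 0 f = L2_norm f"
  using H_norm_deriv_chain[of 0 "\<lambda>_. f"] by (simp add: deriv_chain_def)

lemma Linf_norm_le:
  assumes f: "f \<in> H_space s" "g \<in> H_space s" and s: "1 \<le> s"
    and B: "H_norm s (\<lambda>x. f x - g x) \<le> B"
  shows "Linf_norm (\<lambda>x. f x - g x) \<le> ereal (2 * B)"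
proof -
  have ch: "deriv_chain s (\<lambda>j x. derivs f j x - derivs g j x)"
    by (intro deriv_chain_diff deriv_chain_derivs f)
  have w: "(\<lambda>x. f x - g x) \<in> L2_space" using f by (auto simp: H_space_def intro: L2_diff)
  note wm = borel_measurable_L2[OF w]
  have "Sobolev_le s (\<lambda>x. f x - g x) B"
    unfolding Sobolev_le_def using ch order_trans[OF L2_norm_le_H_norm[OF ch]] B
    by (intro exI[of _ "\<lambda>j x. derivs f j x - derivs g j x"]) auto
  from Sobolev_le_sup_bound[OF this s]
  have "AE x in lborel. ereal \<bar>f x - g x\<bar> \<le> ereal (2 * B)" by simp
  then show ?thesis unfolding Linf_norm_def using wm by (intro esssup_I) auto
qed

text \<open>
  The solution of the KdV equation is the case \<open>k = 1\<close> of the a priori bound, and both bounds have to hold.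
\<close>

definition life_const :: "nat \<Rightarrow> nat \<Rightarrow> real" where
  "life_const s k = min (time_const s 1) (time_const s k)"

definition distance_const :: "nat \<Rightarrow> nat \<Rightarrow> nat \<Rightarrow> real \<Rightarrow> real \<Rightarrow> real \<Rightarrow> real \<Rightarrow> real" where
  "distance_const n s k c0 C0 C T = real (Suc n) * (C +
     2 * (nonlin_const s 1 * (2 * \<bar>c0\<bar>) ^ 2 + nonlin_const s k * (2 * \<bar>C0\<bar>) ^ (k + 1)) * T)"

lemma distance_bound:
  assumes s: "1 \<le> s" and k: "1 \<le> k" and n: "n \<le> s" and T: "0 < T" and \<epsilon>: "0 < \<epsilon>"
    and H: "u0 \<in> H_space (s + 1)" "U0 \<in> H_space (s + 1)"
    and u0: "H_norm (s + 1) u0 \<le> c0 * \<epsilon>" and U0: "H_norm (s + 1) U0 \<le> C0 * \<epsilon>"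
    and dist: "H_norm n (\<lambda>x. u0 x - U0 x) \<le> C * max (\<epsilon> ^ 2) (\<epsilon> ^ (k + 1))"
    and life: "ereal T \<le> T_tilde life_const s k u0 U0"
    and u: "gkdv_solution 1 (s + 1) u0 T u" and U: "gkdv_solution k (s + 1) U0 T U" and t: "t \<in> {0..T}"
  shows "H_norm n (\<lambda>x. u t x - U t x) \<le> distance_const n s k c0 C0 C T * max (\<epsilon> ^ 2) (\<epsilon> ^ (k + 1))"
proof -
  let ?m = "max (\<epsilon> ^ 2) (\<epsilon> ^ (k + 1))"
  have c: "0 < life_const s k" by (simp add: life_const_def time_const_pos)
  have life': "ereal T \<le> ereal (life_const s k) *
      min (inverse (ereal (H_norm (Suc s) U0 ^ k))) (inverse (ereal (H_norm (Suc s) u0)))"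
    using life by (simp add: T_tilde_def)
  have "T * H_norm (Suc s) U0 ^ k \<le> life_const s k"
    by (rule mult_le_if_le_inverse[OF life' _ c]) simp
  then have lU: "T * H_norm (Suc s) U0 ^ k \<le> time_const s k" by (simp add: life_const_def)
  have "T * H_norm (Suc s) u0 \<le> life_const s k"
    by (rule mult_le_if_le_inverse[OF life'[unfolded min.commute[of "inverse (ereal (H_norm (Suc s) U0 ^ k))"]] _ c]) simp
  then have lu: "T * H_norm (Suc s) u0 ^ 1 \<le> time_const s 1" by (simp add: life_const_def)
  note u' = u[unfolded Suc_eq_plus1[symmetric]] and U' = U[unfolded Suc_eq_plus1[symmetric]]
    and H' = H[unfolded Suc_eq_plus1[symmetric]]
  \<comment> \<open>Absolute values spare a proof that \<open>c0\<close> and \<open>C0\<close> are nonnegative.\<close>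
  have a: "H_norm (Suc s) (u \<tau>) \<le> 2 * \<bar>c0\<bar> * \<epsilon>" if "\<tau> \<in> {0..T}" for \<tau>
  proof -
    have "H_norm (Suc s) (u \<tau>) \<le> 2 * H_norm (Suc s) u0"
      by (rule gkdv_a_priori_bound[OF u' H'(1) order_refl s T lu that])
    also have "\<dots> \<le> 2 * (c0 * \<epsilon>)" using u0 by simp
    also have "\<dots> \<le> 2 * (\<bar>c0\<bar> * \<epsilon>)" using \<epsilon> by (intro mult_left_mono mult_right_mono) auto
    finally show ?thesis by simp
  qed
  have b: "H_norm (Suc s) (U \<tau>) \<le> 2 * \<bar>C0\<bar> * \<epsilon>" if "\<tau> \<in> {0..T}" for \<tau>
  proof -
    have "H_norm (Suc s) (U \<tau>) \<le> 2 * H_norm (Suc s) U0"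
      by (rule gkdv_a_priori_bound[OF U' H'(2) k s T lU that])
    also have "\<dots> \<le> 2 * (C0 * \<epsilon>)" using U0 by simp
    also have "\<dots> \<le> 2 * (\<bar>C0\<bar> * \<epsilon>)" using \<epsilon> by (intro mult_left_mono mult_right_mono) auto
    finally show ?thesis by simp
  qed
  have init: "H_norm n (\<lambda>x. u 0 x - U 0 x) = H_norm n (\<lambda>x. u0 x - U0 x)"
  proof (rule H_norm_cong_AE)
    have L: "u 0 \<in> L2_space" "U 0 \<in> L2_space" "u0 \<in> L2_space" "U0 \<in> L2_space"
      using gkdv_solutionD(1)[OF u', of 0] gkdv_solutionD(1)[OF U', of 0] H' T by (auto simp: H_space_def)
    show "(\<lambda>x. u 0 x - U 0 x) \<in> borel_measurable borel" "(\<lambda>x. u0 x - U0 x) \<in> borel_measurable borel"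
      by (intro borel_measurable_L2 L2_diff L)+
    show "AE x in lborel. u 0 x - U 0 x = u0 x - U0 x"
      using gkdv_initial(2)[OF u' _ H'(1)] gkdv_initial(2)[OF U' _ H'(2)] T
      by (auto elim!: eventually_elim2)
  qed
  have p: "nonlin_const s j * (2 * \<bar>q\<bar> * \<epsilon>) ^ (j + 1) \<le> nonlin_const s j * (2 * \<bar>q\<bar>) ^ (j + 1) * ?m"
    if "\<epsilon> ^ (j + 1) \<le> ?m" for j q
    using mult_left_mono[OF that, of "nonlin_const s j * (2 * \<bar>q\<bar>) ^ (j + 1)"] nonlin_const_nonneg[of s j]
    by (simp add: power_mult_distrib mult.assoc)
  have p1: "nonlin_const s 1 * (2 * \<bar>c0\<bar> * \<epsilon>) ^ (1 + 1) \<le> nonlin_const s 1 * (2 * \<bar>c0\<bar>) ^ (1 + 1) * ?m"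
    by (rule p) (simp only: one_add_one max.cobounded1)
  have p2: "nonlin_const s k * (2 * \<bar>C0\<bar> * \<epsilon>) ^ (k + 1) \<le> nonlin_const s k * (2 * \<bar>C0\<bar>) ^ (k + 1) * ?m"
    by (rule p) (rule max.cobounded2)
  have "H_norm n (\<lambda>x. u t x - U t x) \<le> real (Suc n) * (H_norm n (\<lambda>x. u 0 x - U 0 x)
     + 2 * (nonlin_const s 1 * (2 * \<bar>c0\<bar> * \<epsilon>) ^ (1 + 1) + nonlin_const s k * (2 * \<bar>C0\<bar> * \<epsilon>) ^ (k + 1)) * T)"
    by (rule gkdv_difference_bound[OF u' U' order_refl k n a b t])
  also have "\<dots> \<le> real (Suc n) * (C * ?m
     + 2 * (nonlin_const s 1 * (2 * \<bar>c0\<bar>) ^ (1 + 1) * ?m + nonlin_const s k * (2 * \<bar>C0\<bar>) ^ (k + 1) * ?m) * T)"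
    unfolding init using T
    by (intro mult_left_mono add_mono mult_right_mono dist p1 p2) auto
  also have "\<dots> = distance_const n s k c0 C0 C T * ?m"
    by (simp only: distance_const_def one_add_one distrib_right distrib_left mult.assoc mult.commute[of ?m])
  finally show ?thesis .
qed

theorem corollary1:
  shows "\<exists>c :: nat \<Rightarrow> nat \<Rightarrow> real.
    (\<forall>s k. 1 \<le> k \<longrightarrow> 0 < c s k) \<and>
    (\<forall>k \<ge> 1. \<forall>(c0 :: real) (C0 :: real) (C :: real). \<forall>T > 0. \<exists>C' :: real.
       \<forall>\<epsilon> > 0. \<forall>u0 U0 u U.
         u0 \<in> H_space 2 \<longrightarrow> U0 \<in> H_space 2 \<longrightarrow>
         H_norm 2 u0 \<le> c0 * \<epsilon> \<longrightarrow> H_norm 2 U0 \<le> C0 * \<epsilon> \<longrightarrow>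
         L2_norm (\<lambda>x. u0 x - U0 x) \<le> C * max (\<epsilon> ^ 2) (\<epsilon> ^ (k + 1)) \<longrightarrow>
         ereal T \<le> T_tilde c 1 k u0 U0 \<longrightarrow>
         gkdv_solution 1 2 u0 T u \<longrightarrow> gkdv_solution k 2 U0 T U \<longrightarrow>
         (SUP t\<in>{0..T}. ereal (L2_norm (\<lambda>x. u t x - U t x)))
           \<le> ereal (C' * max (\<epsilon> ^ 2) (\<epsilon> ^ (k + 1)))) \<and>
    (\<forall>s \<ge> 1. \<forall>k \<ge> 1. \<forall>(c0s :: real) (C0s :: real) (Cs :: real). \<forall>T > 0. \<exists>(Cs' :: real) (Cs'' :: real).
       \<forall>\<epsilon> > 0. \<forall>u0 U0 u U.
         u0 \<in> H_space (s + 1) \<longrightarrow> U0 \<in> H_space (s + 1) \<longrightarrow>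
         H_norm (s + 1) u0 \<le> c0s * \<epsilon> \<longrightarrow> H_norm (s + 1) U0 \<le> C0s * \<epsilon> \<longrightarrow>
         H_norm s (\<lambda>x. u0 x - U0 x) \<le> Cs * max (\<epsilon> ^ 2) (\<epsilon> ^ (k + 1)) \<longrightarrow>
         ereal T \<le> T_tilde c s k u0 U0 \<longrightarrow>
         gkdv_solution 1 (s + 1) u0 T u \<longrightarrow> gkdv_solution k (s + 1) U0 T U \<longrightarrow>
         (SUP t\<in>{0..T}. ereal (H_norm s (\<lambda>x. u t x - U t x)))
           \<le> ereal (Cs' * max (\<epsilon> ^ 2) (\<epsilon> ^ (k + 1))) \<and>
         (SUP t\<in>{0..T}. Linf_norm (\<lambda>x. u t x - U t x))
           \<le> ereal (Cs'' * max (\<epsilon> ^ 2) (\<epsilon> ^ (k + 1))))"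
proof (intro exI[of _ life_const] conjI allI impI)
  fix s k :: nat
  show "0 < life_const s k" by (simp add: life_const_def time_const_pos)
next
  fix k :: nat and c0 C0 C T :: real
  assume k: "1 \<le> k" and T: "0 < T"
  show "\<exists>C' :: real. \<forall>\<epsilon> > 0. \<forall>u0 U0 u U.
         u0 \<in> H_space 2 \<longrightarrow> U0 \<in> H_space 2 \<longrightarrow>
         H_norm 2 u0 \<le> c0 * \<epsilon> \<longrightarrow> H_norm 2 U0 \<le> C0 * \<epsilon> \<longrightarrow>
         L2_norm (\<lambda>x. u0 x - U0 x) \<le> C * max (\<epsilon> ^ 2) (\<epsilon> ^ (k + 1)) \<longrightarrow>
         ereal T \<le> T_tilde life_const 1 k u0 U0 \<longrightarrow>
         gkdv_solution 1 2 u0 T u \<longrightarrow> gkdv_solution k 2 U0 T U \<longrightarrow>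
         (SUP t\<in>{0..T}. ereal (L2_norm (\<lambda>x. u t x - U t x)))
           \<le> ereal (C' * max (\<epsilon> ^ 2) (\<epsilon> ^ (k + 1)))"
  proof (intro exI[of _ "distance_const 0 1 k c0 C0 C T"] allI impI SUP_least)
    fix \<epsilon> :: real and u0 U0 u U t
    assume \<epsilon>: "0 < \<epsilon>" and H: "u0 \<in> H_space 2" "U0 \<in> H_space 2"
      and small: "H_norm 2 u0 \<le> c0 * \<epsilon>" "H_norm 2 U0 \<le> C0 * \<epsilon>"
      and dist: "L2_norm (\<lambda>x. u0 x - U0 x) \<le> C * max (\<epsilon> ^ 2) (\<epsilon> ^ (k + 1))"
      and life: "ereal T \<le> T_tilde life_const 1 k u0 U0"
      and sol: "gkdv_solution 1 2 u0 T u" "gkdv_solution k 2 U0 T U" and t: "t \<in> {0..T}"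
    have L: "(\<lambda>x. u0 x - U0 x) \<in> L2_space" "(\<lambda>x. u t x - U t x) \<in> L2_space"
      using H gkdv_solutionD(1)[OF sol(1) t] gkdv_solutionD(1)[OF sol(2) t]
      by (auto simp: H_space_def intro: L2_diff)
    show "ereal (L2_norm (\<lambda>x. u t x - U t x))
        \<le> ereal (distance_const 0 1 k c0 C0 C T * max (\<epsilon> ^ 2) (\<epsilon> ^ (k + 1)))"
      using distance_bound[OF order_refl k zero_le_one T \<epsilon>, of u0 U0 c0 C0 C u U t] H small dist life sol t
      by (simp add: H_norm_0[OF L(1)] H_norm_0[OF L(2)] one_add_one del: One_nat_def)
  qed
next
  fix s k :: nat and c0 C0 C T :: real
  assume s: "1 \<le> s" and k: "1 \<le> k" and T: "0 < T"
  let ?K = "distance_const s s k c0 C0 C T"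
  show "\<exists>(Cs' :: real) (Cs'' :: real).
       \<forall>\<epsilon> > 0. \<forall>u0 U0 u U.
         u0 \<in> H_space (s + 1) \<longrightarrow> U0 \<in> H_space (s + 1) \<longrightarrow>
         H_norm (s + 1) u0 \<le> c0 * \<epsilon> \<longrightarrow> H_norm (s + 1) U0 \<le> C0 * \<epsilon> \<longrightarrow>
         H_norm s (\<lambda>x. u0 x - U0 x) \<le> C * max (\<epsilon> ^ 2) (\<epsilon> ^ (k + 1)) \<longrightarrow>
         ereal T \<le> T_tilde life_const s k u0 U0 \<longrightarrow>
         gkdv_solution 1 (s + 1) u0 T u \<longrightarrow> gkdv_solution k (s + 1) U0 T U \<longrightarrow>
         (SUP t\<in>{0..T}. ereal (H_norm s (\<lambda>x. u t x - U t x)))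
           \<le> ereal (Cs' * max (\<epsilon> ^ 2) (\<epsilon> ^ (k + 1))) \<and>
         (SUP t\<in>{0..T}. Linf_norm (\<lambda>x. u t x - U t x))
           \<le> ereal (Cs'' * max (\<epsilon> ^ 2) (\<epsilon> ^ (k + 1)))"
  proof (rule exI[of _ ?K], rule exI[of _ "2 * ?K"], intro allI impI conjI SUP_least)
    fix \<epsilon> :: real and u0 U0 u U t
    assume asm: "0 < \<epsilon>" "u0 \<in> H_space (s + 1)" "U0 \<in> H_space (s + 1)"
      "H_norm (s + 1) u0 \<le> c0 * \<epsilon>" "H_norm (s + 1) U0 \<le> C0 * \<epsilon>"
      "H_norm s (\<lambda>x. u0 x - U0 x) \<le> C * max (\<epsilon> ^ 2) (\<epsilon> ^ (k + 1))"
      "ereal T \<le> T_tilde life_const s k u0 U0"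
      and sol: "gkdv_solution 1 (s + 1) u0 T u" "gkdv_solution k (s + 1) U0 T U" and t: "t \<in> {0..T}"
    show bd: "ereal (H_norm s (\<lambda>x. u t x - U t x)) \<le> ereal (?K * max (\<epsilon> ^ 2) (\<epsilon> ^ (k + 1)))"
      using distance_bound[OF s k order_refl T asm sol t] by simp
  next
    fix \<epsilon> :: real and u0 U0 u U t
    assume asm: "0 < \<epsilon>" "u0 \<in> H_space (s + 1)" "U0 \<in> H_space (s + 1)"
      "H_norm (s + 1) u0 \<le> c0 * \<epsilon>" "H_norm (s + 1) U0 \<le> C0 * \<epsilon>"
      "H_norm s (\<lambda>x. u0 x - U0 x) \<le> C * max (\<epsilon> ^ 2) (\<epsilon> ^ (k + 1))"
      "ereal T \<le> T_tilde life_const s k u0 U0"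
      and sol: "gkdv_solution 1 (s + 1) u0 T u" "gkdv_solution k (s + 1) U0 T U" and t: "t \<in> {0..T}"
    have Hs: "u t \<in> H_space s" "U t \<in> H_space s"
      using gkdv_solutionD(1)[OF sol(1) t] gkdv_solutionD(1)[OF sol(2) t] by (auto simp: H_space_def)
    from Linf_norm_le[OF Hs s distance_bound[OF s k order_refl T asm sol t]]
    show "Linf_norm (\<lambda>x. u t x - U t x) \<le> ereal (2 * ?K * max (\<epsilon> ^ 2) (\<epsilon> ^ (k + 1)))"
      by (simp add: mult.assoc)
  qed
qed

end
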